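(* Let $\alpha$ be a computable ordinal and write $\alpha=\lambda+k$ with $k\in\mathbb N$ and $\lambda$ not a successor ordinal (so $\lambda=0$ or $\lambda$ is a limit ordinal). The isomorphism problem for well-founded computable trees of rank at most $\alpha$ belongs to level $\Pi^0_{\lambda+2k+1}$ of the hyperarithmetical hierarchy.
   Context: A tree is a partial order $(F,\leq)$ with a greatest element such that for every $p$ the set $\{a\mid p<a\}$ is a finite linear order; it is well-founded if there is no infinite strictly descending chain. Its rank is defined via $\mathsf{rank}(p)=\sup\{\mathsf{rank}(p')+1\mid p'<p\}$ and $\mathsf{rank}(F)=\sup\{\mathsf{rank}(p)+1\mid p\in F\}$. A computable tree is a tree $(F,\leq)$ with $F\subseteq\mathbb N$ such that $F$, $\leq$ and the direct successor relation $E=\{(x,y)\mid x>y,\ \neg\exists z: x>z>y\}$ are all computable (given by indices). The isomorphism problem is the set of pairs of such trees (of rank at most $\alpha$) that are isomorphic. The hyperarithmetical levels $\Sigma^0_\beta,\Pi^0_\beta$ for computable $\beta$ are as in Ash–Knight: via ordinal notations $O$ and sets $H(a)$, $\Sigma^0_\beta$ for infinite $\beta$ consists of sets c.e. in $H(a)$ with $|a|_O=\beta$, $\Sigma^0_n$ for finite $n>0$ consists of sets c.e. in $H(a)$ with $|a|_O=n-1$, and $\Pi^0_\beta$ are the complements. *)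

theory Defs
  imports Main "HOL-Library.Nat_Bijection" "HOL-Library.Countable_Set_Type"
begin

unbundle cardinal_syntax

section \<open>Countable ordinals\<close>

text \<open>
  The ordinals below the first uncountable ordinal, realised as the elements of the
  well-order \<open>cardSuc natLeq\<close>.  All ordinals involved here (computable ordinals, ranks of
  trees on the natural numbers) are countable.
\<close>

lemma Well_order_omega1: "Well_order (cardSuc natLeq)"
  by (rule cardSuc_Well_order[OF natLeq_Card_order])

typedef countable_ordinal = "Field (cardSuc natLeq)"
  using Field_cardSuc_not_empty[OF natLeq_Card_order] by blast

instantiation countable_ordinal :: linorder
begin

definition less_eq_countable_ordinal where
  "\<beta> \<le> \<gamma> \<longleftrightarrow> (Rep_countable_ordinal \<beta>, Rep_countable_ordinal \<gamma>) \<in> cardSuc natLeq"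

definition less_countable_ordinal where
  "\<beta> < \<gamma> \<longleftrightarrow> \<beta> \<le> \<gamma> \<and> \<not> \<gamma> \<le> (\<beta> :: countable_ordinal)"

instance
proof -
  have r: "refl_on (Field (cardSuc natLeq)) (cardSuc natLeq)" "trans (cardSuc natLeq)"
      "antisym (cardSuc natLeq)" "total_on (Field (cardSuc natLeq)) (cardSuc natLeq)"
    using Well_order_omega1
    unfolding well_order_on_def linear_order_on_def partial_order_on_def preorder_on_def by auto
  show "OFCLASS(countable_ordinal, linorder_class)"
  proof
    fix x y z :: countable_ordinal
    show "x \<le> x"
      using r(1) Rep_countable_ordinal[of x]
      unfolding less_eq_countable_ordinal_def refl_on_def by blast
    show "x \<le> y \<Longrightarrow> y \<le> z \<Longrightarrow> x \<le> z"
      using r(2) unfolding less_eq_countable_ordinal_def trans_def by blast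
    show "x \<le> y \<Longrightarrow> y \<le> x \<Longrightarrow> x = y"
      using r(3) unfolding less_eq_countable_ordinal_def antisym_def
      by (blast dest: Rep_countable_ordinal_inject[THEN iffD1])
    show "x \<le> y \<or> y \<le> x"
      using r(1,4) Rep_countable_ordinal[of x] Rep_countable_ordinal[of y]
      unfolding less_eq_countable_ordinal_def total_on_def refl_on_def
      by (cases "Rep_countable_ordinal x = Rep_countable_ordinal y") auto
  qed (rule less_countable_ordinal_def)
qed

end

instance countable_ordinal :: wellorder
proof
  fix P :: "countable_ordinal \<Rightarrow> bool" and a
  assume step: "\<And>x. (\<And>y. y < x \<Longrightarrow> P y) \<Longrightarrow> P x"
  have "wf (cardSuc natLeq - Id)"
    using Well_order_omega1 unfolding well_order_on_def by blast
  then have "wf (inv_image (cardSuc natLeq - Id) Rep_countable_ordinal)"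
    by (rule wf_inv_image)
  moreover have "{(x, y). x < y} \<subseteq> inv_image (cardSuc natLeq - Id) Rep_countable_ordinal"
    by (auto simp: inv_image_def less_countable_ordinal_def less_eq_countable_ordinal_def)
  ultimately have "wf {(x, y :: countable_ordinal). x < y}"
    by (rule wf_subset)
  then show "P a"
    by (induction a rule: wf_induct_rule) (use step in blast)
qed

instantiation countable_ordinal :: conditionally_complete_linorder
begin

definition inf_countable_ordinal :: "countable_ordinal \<Rightarrow> _" where
  "inf_countable_ordinal = min"

definition sup_countable_ordinal :: "countable_ordinal \<Rightarrow> _" where
  "sup_countable_ordinal = max"

definition Inf_countable_ordinal :: "countable_ordinal set \<Rightarrow> countable_ordinal" where
  "Inf_countable_ordinal A = (LEAST \<beta>. \<beta> \<in> A)"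

definition Sup_countable_ordinal :: "countable_ordinal set \<Rightarrow> countable_ordinal" where
  "Sup_countable_ordinal A = (LEAST \<beta>. \<forall>\<gamma>\<in>A. \<gamma> \<le> \<beta>)"

instance
proof
  fix x z :: countable_ordinal and X
  show "z \<le> Inf X" if "X \<noteq> {}" "\<And>x. x \<in> X \<Longrightarrow> z \<le> x"
  proof -
    obtain y where "y \<in> X" using \<open>X \<noteq> {}\<close> by blast
    then have "(LEAST \<beta>. \<beta> \<in> X) \<in> X" by (rule LeastI)
    then show ?thesis using that(2) unfolding Inf_countable_ordinal_def by blast
  qed
  show "x \<le> Sup X" if "x \<in> X" "bdd_above X"
  proof -
    obtain u where "\<forall>y\<in>X. y \<le> u" using \<open>bdd_above X\<close> unfolding bdd_above_def by blast
    then have "\<forall>y\<in>X. y \<le> Sup X" unfolding Sup_countable_ordinal_def by (rule LeastI)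
    then show ?thesis using \<open>x \<in> X\<close> by blast
  qed
  show "Sup X \<le> z" if "X \<noteq> {}" "\<And>x. x \<in> X \<Longrightarrow> x \<le> z"
    unfolding Sup_countable_ordinal_def by (rule Least_le) (use that(2) in blast)
qed (simp_all add: inf_countable_ordinal_def sup_countable_ordinal_def
      Inf_countable_ordinal_def Least_le)

end

text \<open>Countable sets are bounded, so suprema of countable sets are genuine suprema.\<close>

lemma countable_atMost_ordinal: "countable {..\<beta> :: countable_ordinal}"
proof -
  let ?r = "cardSuc natLeq" and ?R = Rep_countable_ordinal
  have "|underS ?r (?R \<beta>)| <o ?r"
    by (rule card_of_underS[OF cardSuc_Card_order[OF natLeq_Card_order] Rep_countable_ordinal])
  then have "|underS ?r (?R \<beta>)| \<le>o natLeq"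
    by (simp add: cardSuc_ordLeq_ordLess[OF natLeq_Card_order card_of_Card_order])
  then have "countable (underS ?r (?R \<beta>))"
    by (simp add: countable_card_le_natLeq)
  moreover have "?R ` {..\<beta>} \<subseteq> insert (?R \<beta>) (underS ?r (?R \<beta>))"
    by (auto simp: underS_def less_eq_countable_ordinal_def)
  ultimately have "countable (?R ` {..\<beta>})"
    using countable_insert countable_subset by metis
  then show ?thesis
    by (rule countable_image_inj_on) (auto simp: inj_on_def Rep_countable_ordinal_inject)
qed

lemma uncountable_ordinals: "\<not> countable (UNIV :: countable_ordinal set)"
proof
  assume "countable (UNIV :: countable_ordinal set)"
  then have "countable (range Rep_countable_ordinal)"
    by simp
  then have "|Field (cardSuc natLeq)| \<le>o natLeq"
    using type_definition.Rep_range[OF type_definition_countable_ordinal]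
    by (simp add: countable_card_le_natLeq)
  moreover have "|Field (cardSuc natLeq)| =o cardSuc natLeq"
    by (rule card_of_Field_ordIso[OF cardSuc_Card_order[OF natLeq_Card_order]])
  ultimately have "cardSuc natLeq \<le>o natLeq"
    using ordIso_symmetric ordIso_ordLeq_trans by blast
  then show False
    using cardSuc_greater[OF natLeq_Card_order] not_ordLess_ordLeq by blast
qed

lemma countable_bounded_ordinal:
  fixes A :: "countable_ordinal set"
  assumes "countable A"
  shows "\<exists>\<beta>. \<forall>\<gamma>\<in>A. \<gamma> < \<beta>"
proof (rule ccontr)
  assume "\<not> ?thesis"
  then have "UNIV = (\<Union>\<gamma>\<in>A. {..\<gamma>})"
    by (force simp: not_less)
  moreover have "countable (\<Union>\<gamma>\<in>A. {..\<gamma>})"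
    using assms countable_atMost_ordinal by blast
  ultimately show False
    using uncountable_ordinals by metis
qed

instantiation countable_ordinal :: zero
begin
definition zero_countable_ordinal :: countable_ordinal where
  "(0 :: countable_ordinal) = (LEAST \<beta>. True)"
instance ..
end

definition osuc :: "countable_ordinal \<Rightarrow> countable_ordinal" where
  "osuc \<beta> = (LEAST \<gamma>. \<beta> < \<gamma>)"

lemma zero_ordinal_le: "0 \<le> (\<beta> :: countable_ordinal)"
  by (simp add: zero_countable_ordinal_def Least_le)

lemma less_osuc: "\<beta> < osuc \<beta>"
proof -
  obtain \<gamma> where "\<beta> < \<gamma>" using countable_bounded_ordinal[of "{\<beta>}"] by auto
  then show ?thesis unfolding osuc_def by (rule LeastI)
qed

lemma osuc_le_iff: "osuc \<beta> \<le> \<gamma> \<longleftrightarrow> \<beta> < \<gamma>"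
  using less_osuc[of \<beta>] by (auto simp: osuc_def intro: Least_le)

lemma Sup_empty_ordinal: "Sup {} = (0 :: countable_ordinal)"
  by (simp add: Sup_countable_ordinal_def zero_countable_ordinal_def)

lemma countable_bdd_above_ordinal: "countable A \<Longrightarrow> bdd_above (A :: countable_ordinal set)"
  using countable_bounded_ordinal[of A] by (auto simp: bdd_above_def intro: less_imp_le)

definition successor_ordinal :: "countable_ordinal \<Rightarrow> bool" where
  "successor_ordinal \<beta> \<longleftrightarrow> (\<exists>\<gamma>. \<beta> = osuc \<gamma>)"

text \<open>\<open>\<beta> + n\<close> for a natural number \<open>n\<close>.\<close>

definition oplus :: "countable_ordinal \<Rightarrow> nat \<Rightarrow> countable_ordinal" (infixl "+\<^sub>o" 65) where
  "\<beta> +\<^sub>o n = (osuc ^^ n) \<beta>"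

definition finite_ordinal :: "countable_ordinal \<Rightarrow> bool" where
  "finite_ordinal \<beta> \<longleftrightarrow> (\<exists>n. \<beta> = 0 +\<^sub>o n)"


section \<open>Relative computability\<close>

text \<open>
  Programs for partial functions on the natural numbers; tuples are coded by
  \<^const>\<open>prod_encode\<close>.  \<open>CQuery\<close> asks the oracle whether the input belongs to it,
  \<open>CPrec\<close> is primitive recursion and \<open>CMu\<close> unbounded search.
\<close>

datatype code =
    CZero | CSuc | CFst | CSnd | CQuery
  | CPair code code | CComp code code | CPrec code code | CMu code

primrec run :: "nat set \<Rightarrow> code \<Rightarrow> nat \<Rightarrow> nat option" where
  "run X CZero = (\<lambda>x. Some 0)"
| "run X CSuc = (\<lambda>x. Some (Suc x))"
| "run X CFst = (\<lambda>x. Some (fst (prod_decode x)))"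
| "run X CSnd = (\<lambda>x. Some (snd (prod_decode x)))"
| "run X CQuery = (\<lambda>x. Some (if x \<in> X then 1 else 0))"
| "run X (CPair c d) = (\<lambda>x. Option.bind (run X c x) (\<lambda>u.
     Option.bind (run X d x) (\<lambda>v. Some (prod_encode (u, v)))))"
| "run X (CComp c d) = (\<lambda>x. Option.bind (run X d x) (run X c))"
| "run X (CPrec c d) = (\<lambda>z. let (x, n) = prod_decode z in
     rec_nat (run X c x)
       (\<lambda>m r. Option.bind r (\<lambda>y. run X d (prod_encode (x, prod_encode (m, y))))) n)"
| "run X (CMu c) = (\<lambda>x.
     let found = (\<lambda>n. run X c (prod_encode (x, n)) = Some 0 \<and>
                      (\<forall>m<n. \<exists>y. run X c (prod_encode (x, m)) = Some (Suc y)))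
     in if \<exists>n. found n then Some (LEAST n. found n) else None)"

lemma prod_decode_div_le:
  assumes "(a, b) = prod_decode (n div 4)"
  shows "a \<le> n" "b \<le> n"
proof -
  have "prod_encode (a, b) = n div 4"
    by (metis assms prod_decode_inverse)
  then show "a \<le> n" "b \<le> n"
    using le_prod_encode_1[of a b] le_prod_encode_2[of b a] by linarith+
qed

text \<open>Every natural number is the index of a program, and every program has an index.\<close>

function code_of :: "nat \<Rightarrow> code" where
  "code_of 0 = CZero"
| "code_of (Suc 0) = CSuc"
| "code_of (Suc (Suc 0)) = CFst"
| "code_of (Suc (Suc (Suc 0))) = CSnd"
| "code_of (Suc (Suc (Suc (Suc 0)))) = CQuery"
| "code_of (Suc (Suc (Suc (Suc (Suc n))))) =
     (let (a, b) = prod_decode (n div 4) in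
      if n mod 4 = 0 then CPair (code_of a) (code_of b)
      else if n mod 4 = 1 then CComp (code_of a) (code_of b)
      else if n mod 4 = 2 then CPrec (code_of a) (code_of b)
      else CMu (code_of (n div 4)))"
  by pat_completeness auto
termination
  by (relation "measure id") (simp_all add: prod_decode_div_le le_imp_less_Suc le_SucI)

lemma surj_code_of: "surj code_of"
proof -
  have mod4: "(4 * m + 1) mod 4 = 1" "(4 * m + 1) div 4 = m" "(4 * m + 2) mod 4 = 2"
    "(4 * m + 2) div 4 = m" "(4 * m + 3) mod 4 = 3" "(4 * m + 3) div 4 = m" for m :: nat
    by presburger+
  have "\<exists>e. code_of e = c" for c
  proof (induction c)
    case (CPair c d)
    then obtain a b where "code_of a = c" "code_of b = d" by blast
    then have "code_of (Suc (Suc (Suc (Suc (Suc (4 * prod_encode (a, b))))))) = CPair c d"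
      by (simp only: code_of.simps(6)) simp
    then show ?case by blast
  next
    case (CComp c d)
    then obtain a b where "code_of a = c" "code_of b = d" by blast
    then have "code_of (Suc (Suc (Suc (Suc (Suc (4 * prod_encode (a, b) + 1)))))) = CComp c d"
      by (simp only: code_of.simps(6) mod4 prod_encode_inverse) simp
    then show ?case by blast
  next
    case (CPrec c d)
    then obtain a b where "code_of a = c" "code_of b = d" by blast
    then have "code_of (Suc (Suc (Suc (Suc (Suc (4 * prod_encode (a, b) + 2)))))) = CPrec c d"
      by (simp only: code_of.simps(6) mod4 prod_encode_inverse) simp
    then show ?case by blast
  next
    case (CMu c)
    then obtain a where "code_of a = c" by blast
    then have "code_of (Suc (Suc (Suc (Suc (Suc (4 * a + 3)))))) = CMu c"
      by (simp only: code_of.simps(6) mod4 prod_encode_inverse) (simp split: prod.split)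
    then show ?case by blast
  qed (blast intro: code_of.simps)+
  then show ?thesis by (metis surjI)
qed

definition phi :: "nat set \<Rightarrow> nat \<Rightarrow> nat \<Rightarrow> nat option" where
  "phi X e = run X (code_of e)"

definition ce_in :: "nat set \<Rightarrow> nat set \<Rightarrow> bool" where
  "ce_in X S \<longleftrightarrow> (\<exists>e. S = {x. phi X e x \<noteq> None})"

definition jump :: "nat set \<Rightarrow> nat set" where
  "jump X = {e. phi X e e \<noteq> None}"

definition decides :: "nat \<Rightarrow> nat set \<Rightarrow> bool" where
  "decides e S \<longleftrightarrow> (\<forall>x. phi {} e x = Some (if x \<in> S then 1 else 0))"

definition decides_rel :: "nat \<Rightarrow> nat rel \<Rightarrow> bool" where
  "decides_rel e r \<longleftrightarrow> decides e (prod_encode ` r)"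

definition computable_ordinal :: "countable_ordinal \<Rightarrow> bool" where
  "computable_ordinal \<alpha> \<longleftrightarrow>
     (\<exists>r e. decides_rel e r \<and> r =o {(\<beta>, \<gamma>). \<beta> \<le> \<gamma> \<and> \<gamma> < \<alpha>})"


section \<open>Ordinal notations and the hyperarithmetical hierarchy\<close>

text \<open>\<open>inO a\<close> means \<open>a \<in> O\<close>, and \<open>lessO\<close> is the order \<open><\<^sub>O\<close>.\<close>

inductive inO :: "nat \<Rightarrow> bool" and lessO :: "nat \<Rightarrow> nat \<Rightarrow> bool" where
  inO_zero: "inO 1"
| inO_suc: "inO a \<Longrightarrow> inO (2 ^ a)"
| inO_lim: "(\<And>n. phi {} e n = Some (f n)) \<Longrightarrow> (\<And>n. inO (f n)) \<Longrightarrow>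
    (\<And>n. lessO (f n) (f (Suc n))) \<Longrightarrow> inO (3 * 5 ^ e)"
| lessO_suc: "inO a \<Longrightarrow> lessO a (2 ^ a)"
| lessO_suc_trans: "inO a \<Longrightarrow> lessO b a \<Longrightarrow> lessO b (2 ^ a)"
| lessO_lim: "inO (3 * 5 ^ e) \<Longrightarrow> phi {} e n = Some a \<Longrightarrow> lessO b a \<Longrightarrow>
    lessO b (3 * 5 ^ e)"

text \<open>\<open>denotes a \<beta>\<close> means \<open>a \<in> O\<close> and \<open>|a|\<^sub>O = \<beta>\<close>.\<close>

inductive denotes :: "nat \<Rightarrow> countable_ordinal \<Rightarrow> bool" where
  denotes_zero: "denotes 1 0"
| denotes_suc: "denotes a \<beta> \<Longrightarrow> denotes (2 ^ a) (osuc \<beta>)"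
| denotes_lim: "inO (3 * 5 ^ e) \<Longrightarrow> (\<And>n. phi {} e n = Some (f n)) \<Longrightarrow>
    (\<And>n. denotes (f n) (g n)) \<Longrightarrow> denotes (3 * 5 ^ e) (SUP n. g n)"

text \<open>\<open>H_set a X\<close> means \<open>a \<in> O\<close> and \<open>X = H(a)\<close>.\<close>

inductive H_set :: "nat \<Rightarrow> nat set \<Rightarrow> bool" where
  H_zero: "H_set 1 {}"
| H_suc: "H_set a X \<Longrightarrow> H_set (2 ^ a) (jump X)"
| H_lim: "inO (3 * 5 ^ e) \<Longrightarrow> (\<And>u. lessO u (3 * 5 ^ e) \<Longrightarrow> H_set u (Y u)) \<Longrightarrow>
    H_set (3 * 5 ^ e) {prod_encode (u, v) | u v. lessO u (3 * 5 ^ e) \<and> v \<in> Y u}"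

lemma two_power_neq_lim: "2 ^ a \<noteq> (3 * 5 ^ e :: nat)"
proof
  assume "2 ^ a = (3 * 5 ^ e :: nat)"
  then have "(3 :: nat) dvd 2 ^ a" by simp
  moreover have "\<not> (3 :: nat) dvd 2 ^ a"
    by (induction a) (simp_all, presburger)
  ultimately show False by blast
qed

lemma two_power_eq_1: "Suc 0 = 2 ^ a \<longleftrightarrow> a = 0"
  by (cases a) auto

lemma lim_neq_1: "3 * 5 ^ e \<noteq> Suc 0"
  by presburger

lemmas index_simps = two_power_neq_lim two_power_neq_lim[symmetric] two_power_eq_1
  lim_neq_1 lim_neq_1[symmetric]

lemma denotes_inO: "denotes a \<beta> \<Longrightarrow> inO a"
  by (induction rule: denotes.induct) (auto intro: inO_lessO.intros simp flip: One_nat_def)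

lemma denotes_pos: "denotes a \<beta> \<Longrightarrow> a \<noteq> 0"
  by (induction rule: denotes.induct) auto

lemma H_set_pos: "H_set a X \<Longrightarrow> a \<noteq> 0"
  by (induction rule: H_set.induct) auto

lemma H_set_inO: "H_set a X \<Longrightarrow> inO a"
  by (induction rule: H_set.induct) (auto intro: inO_lessO.intros simp flip: One_nat_def)

lemma denotes_unique: "denotes a \<beta> \<Longrightarrow> denotes a \<gamma> \<Longrightarrow> \<gamma> = \<beta>"
proof (induction arbitrary: \<gamma> rule: denotes.induct)
  case denotes_zero
  then show ?case
    by cases (auto dest: denotes_pos simp: index_simps)
next
  case (denotes_suc a \<beta>)
  from denotes_suc.prems denotes_pos[OF denotes_suc.hyps]
  obtain \<gamma>' where "denotes a \<gamma>'" "\<gamma> = osuc \<gamma>'"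
    by cases (auto simp: index_simps)
  then show ?case using denotes_suc.IH by blast
next
  case (denotes_lim e f g)
  from denotes_lim.prems obtain f' g' where
    *: "\<And>n. phi {} e n = Some (f' n)" "\<And>n. denotes (f' n) (g' n)" "\<gamma> = (SUP n. g' n)"
    by cases (auto simp: index_simps)
  have "f' n = f n" for n
    using *(1)[of n] denotes_lim.hyps(2)[of n] by simp
  then have "g' n = g n" for n
    using denotes_lim.IH[of n "g' n"] *(2)[of n] by simp
  then show ?case using *(3) by presburger
qed

lemma H_set_unique: "H_set a X \<Longrightarrow> H_set a Z \<Longrightarrow> Z = X"
proof (induction arbitrary: Z rule: H_set.induct)
  case H_zero
  then show ?case
    by cases (auto dest: H_set_pos simp: index_simps)
next
  case (H_suc a X)
  from H_suc.prems H_set_pos[OF H_suc.hyps] obtain Z' where "H_set a Z'" "Z = jump Z'"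
    by cases (auto simp: index_simps)
  then show ?case using H_suc.IH by blast
next
  case (H_lim e Y)
  from H_lim.prems obtain Y' where
    *: "\<And>u. lessO u (3 * 5 ^ e) \<Longrightarrow> H_set u (Y' u)"
      "Z = {prod_encode (u, v) | u v. lessO u (3 * 5 ^ e) \<and> v \<in> Y' u}"
    by cases (auto simp: index_simps)
  have "Y' u = Y u" if "lessO u (3 * 5 ^ e)" for u
    using H_lim.IH[OF that *(1)[OF that]] .
  then show ?case unfolding *(2) by blast
qed

lemma denotes_ex: "inO a \<Longrightarrow> \<exists>\<beta>. denotes a \<beta>"
proof (induction rule: inO_lessO.inducts(1)[where ?P2.0 = "\<lambda>_ _. True"])
  case inO_zero
  show ?case using denotes_zero by blast
next
  case (inO_suc a)
  then show ?case using denotes_suc by blast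
next
  case (inO_lim e f)
  define g where "g n = (SOME \<beta>. denotes (f n) \<beta>)" for n
  have "denotes (f n) (g n)" for n
    unfolding g_def using inO_lim.IH[of n] by (metis someI_ex)
  moreover have "inO (3 * 5 ^ e)"
    using inO_lim inO_lessO.inO_lim[of e f] by blast
  ultimately show ?case
    using denotes_lim[of e f g] inO_lim(1) by blast
qed auto

lemma H_set_ex: "inO a \<Longrightarrow> (\<exists>X. H_set a X) \<and> (\<forall>u. lessO u a \<longrightarrow> (\<exists>X. H_set u X))"
proof (induction rule: inO_lessO.inducts(1)[where ?P2.0 = "\<lambda>_ _. True"])
  case inO_zero
  have "\<not> lessO u 1" for u
  proof
    assume "lessO u 1"
    moreover have "\<not> inO 0" by (auto elim: inO.cases)
    ultimately show False by cases (auto simp: index_simps)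
  qed
  then show ?case using H_zero by blast
next
  case (inO_suc a)
  have "\<exists>X. H_set u X" if "lessO u (2 ^ a)" for u
    using that by cases (use inO_suc in \<open>auto simp: index_simps\<close>)
  then show ?case using inO_suc H_suc by blast
next
  case (inO_lim e f)
  have lim: "inO (3 * 5 ^ e)"
    using inO_lim inO_lessO.inO_lim[of e f] by blast
  have *: "\<exists>X. H_set u X" if "lessO u (3 * 5 ^ e)" for u
    using that by cases (use inO_lim in \<open>auto simp: index_simps\<close>)
  define Y where "Y u = (SOME X. H_set u X)" for u
  have "H_set u (Y u)" if "lessO u (3 * 5 ^ e)" for u
    unfolding Y_def using *[OF that] by (rule someI_ex)
  then show ?case using H_lim[OF lim, of Y] * by blast
qed auto

text \<open>\<open>\<Sigma>\<^sup>0\<^sub>\<beta>\<close> and \<open>\<Pi>\<^sup>0\<^sub>\<beta>\<close> for \<open>\<beta> > 0\<close>; note the shift by one at finite levels.\<close>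

definition Sigma0 :: "countable_ordinal \<Rightarrow> nat set set" where
  "Sigma0 \<beta> = {S. \<exists>a \<gamma> X. denotes a \<gamma> \<and> (if finite_ordinal \<beta> then \<beta> = osuc \<gamma> else \<beta> = \<gamma>) \<and>
                          H_set a X \<and> ce_in X S}"

definition Pi0 :: "countable_ordinal \<Rightarrow> nat set set" where
  "Pi0 \<beta> = {S. - S \<in> Sigma0 \<beta>}"


section \<open>Trees\<close>

text \<open>Orders are given as sets \<open>r\<close> of pairs \<open>(x, y)\<close> with \<open>x \<le> y\<close>; \<open>r - Id\<close> is the strict part.\<close>

definition tree :: "'a set \<Rightarrow> 'a rel \<Rightarrow> bool" where
  "tree F r \<longleftrightarrow> partial_order_on F r \<and> (\<exists>g\<in>F. \<forall>x\<in>F. (x, g) \<in> r) \<and>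
     (\<forall>p\<in>F. let A = {a. (p, a) \<in> r - Id} in finite A \<and> linear_order_on A (Restr r A))"

definition well_founded :: "'a rel \<Rightarrow> bool" where
  "well_founded r \<longleftrightarrow> \<not> (\<exists>c :: nat \<Rightarrow> 'a. \<forall>i. (c (Suc i), c i) \<in> r - Id)"

text \<open>Meaningful only for countable well-founded orders.\<close>

definition node_rank :: "'a rel \<Rightarrow> 'a \<Rightarrow> countable_ordinal" where
  "node_rank r = wfrec (r - Id) (\<lambda>rk p. SUP q \<in> {q. (q, p) \<in> r - Id}. osuc (rk q))"

lemma node_rank_eq:
  assumes "well_founded r"
  shows "node_rank r p = (SUP q \<in> {q. (q, p) \<in> r - Id}. osuc (node_rank r q))"
proof -
  have "wf (r - Id)"
    using assms unfolding well_founded_def wf_iff_no_infinite_down_chain .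
  from def_wfrec[OF eq_reflection[OF node_rank_def] this, of p] show ?thesis
    by (simp add: cut_apply image_def)
qed

definition tree_rank :: "'a set \<Rightarrow> 'a rel \<Rightarrow> countable_ordinal" where
  "tree_rank F r = (SUP p\<in>F. osuc (node_rank r p))"

definition direct_succ :: "'a rel \<Rightarrow> 'a rel" where
  "direct_succ r = {(x, y). (y, x) \<in> r - Id \<and> \<not> (\<exists>z. (z, x) \<in> r - Id \<and> (y, z) \<in> r - Id)}"

text \<open>\<open>t\<close> codes indices for the characteristic functions of \<open>F\<close>, \<open>\<le>\<close> and \<open>E\<close>.\<close>

definition computable_tree :: "nat \<Rightarrow> nat set \<Rightarrow> nat rel \<Rightarrow> bool" where
  "computable_tree t F r \<longleftrightarrow> tree F r \<and>
     (\<exists>i j k. t = prod_encode (i, prod_encode (j, k)) \<and>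
        decides i F \<and> decides_rel j r \<and> decides_rel k (direct_succ r))"

definition tree_isomorphic :: "'a set \<Rightarrow> 'a rel \<Rightarrow> 'b set \<Rightarrow> 'b rel \<Rightarrow> bool" where
  "tree_isomorphic F r F' r' \<longleftrightarrow>
     (\<exists>f. bij_betw f F F' \<and> (\<forall>x\<in>F. \<forall>y\<in>F. (x, y) \<in> r \<longleftrightarrow> (f x, f y) \<in> r'))"

definition tree_iso_problem :: "countable_ordinal \<Rightarrow> nat set" where
  "tree_iso_problem \<alpha> = {prod_encode (s, t) | s t. \<exists>F r F' r'.
     computable_tree s F r \<and> well_founded r \<and> tree_rank F r \<le> \<alpha> \<and>
     computable_tree t F' r' \<and> well_founded r' \<and> tree_rank F' r' \<le> \<alpha> \<and>
     tree_isomorphic F r F' r'}"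

end

theory Submission
  imports Defs
begin

text \<open>
  Two nodes of rank at most \<open>\<beta>\<close> have isomorphic subtrees iff every isomorphism type of rank below \<open>\<beta>\<close>
  occurs equally often among their children.  Expressed by ``at least \<open>m\<close> children isomorphic to \<open>z\<close>'',
  passing from rank \<open>\<beta>\<close> to \<open>\<beta> + 1\<close> therefore costs two jumps (\<open>back_forth\<close>).  At a limit notation \<open>u\<close> the
  set \<open>H(u)\<close> contains all earlier \<open>H(v)\<close> as columns, so isomorphism for ranks below \<open>|u|\<close> is a
  c.e. union over a fundamental sequence, provided that indices for the earlier stages are
  computable from the notation.  A notation for \<open>l\<close> comes from a computable well-order: extend a
  notation \<open>b\<close> by an element \<open>x\<close> as the limit of the sequence that starts at \<open>b\<close> and is
  successively extended by the elements below \<open>x\<close>, so that all notations lie on one branch of \<open>O\<close>.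
  Being an index of a tree is \<open>\<Pi>\<^sup>0\<^sub>3\<close>, which is low enough
  whenever \<open>\<alpha> > 0\<close>, and for \<open>\<alpha> = 0\<close> the problem is empty.
\<close>

section \<open>Functions and predicates computable relative to a family of oracles\<close>

text \<open>The shape of the bound reflects how the doubling of jumps behaves at limits. Between
  limits the oracle runs ahead of the ordinal, two jumps per successor, but at a limit notation
  \<open>u\<close> the oracle is \<open>H(u)\<close> itself, because all oracles used before it
  still lie below \<open>u\<close>. So only the finite tail k is doubled. The final 1 has two
  sources. Infinite levels have no index shift, and one more jump turns the enumeration of
  isomorphic pairs into a decision, so that the other pairs can be enumerated. At finite levels the
  1 is the shift between a level and its number of jumps.

  Well-foundedness, far too complex for a separate test, is absorbed into the recursion: the
  relation on nodes carries the rank bound, which excludes infinite descent.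

  The obstacle is uniformity. One program at a limit must combine infinitely many earlier stages,
  each relative to its own column. Hence operators act on indices of enumerations, by programs that
  are the same for all oracles.\<close>

abbreviation pr :: "nat \<Rightarrow> nat \<Rightarrow> nat" where
  "pr a b \<equiv> prod_encode (a, b)"

abbreviation p1 :: "nat \<Rightarrow> nat" where
  "p1 z \<equiv> fst (prod_decode z)"

abbreviation p2 :: "nat \<Rightarrow> nat" where
  "p2 z \<equiv> snd (prod_decode z)"

lemma pr_p1_p2 [simp]: "pr (p1 z) (p2 z) = z"
  by simp

text \<open>Everything is uniform in \<open>i\<close>: a single program has to work for all oracles \<open>X i\<close>.\<close>

definition cfun :: "('i \<Rightarrow> nat set) \<Rightarrow> ('i \<Rightarrow> nat \<Rightarrow> nat) \<Rightarrow> bool" where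
  "cfun X f \<longleftrightarrow> (\<exists>c. \<forall>i x. run (X i) c x = Some (f i x))"

definition cdec :: "('i \<Rightarrow> nat set) \<Rightarrow> ('i \<Rightarrow> nat \<Rightarrow> bool) \<Rightarrow> bool" where
  "cdec X P \<longleftrightarrow> cfun X (\<lambda>i x. if P i x then 1 else 0)"

text \<open>A projection of a decidable relation instead of the domain of a program: closure under
  connectives and quantifiers then only recodes witnesses, and \<open>cenum_index\<close> recovers
  an index where one is needed.\<close>

definition cenum :: "('i \<Rightarrow> nat set) \<Rightarrow> ('i \<Rightarrow> nat \<Rightarrow> bool) \<Rightarrow> bool" where
  "cenum X P \<longleftrightarrow> (\<exists>D. cdec X D \<and> (\<forall>i x. P i x \<longleftrightarrow> (\<exists>n. D i (pr x n))))"

lemma cfun_cong: "cfun X f \<Longrightarrow> (\<And>i x. g i x = f i x) \<Longrightarrow> cfun X g"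
  unfolding cfun_def by simp

lemma cdec_cong: "cdec X P \<Longrightarrow> (\<And>i x. Q i x \<longleftrightarrow> P i x) \<Longrightarrow> cdec X Q"
  unfolding cdec_def cfun_def by simp

lemma cenum_cong: "cenum X P \<Longrightarrow> (\<And>i x. Q i x \<longleftrightarrow> P i x) \<Longrightarrow> cenum X Q"
  unfolding cenum_def by simp

text \<open>Rules that follow the syntax of a term or formula, so that
  \<open>intro computable\<close> assembles a program from the expression.\<close>

named_theorems computable

lemma cfun_id [computable]: "cfun X (\<lambda>i x. x)"
  unfolding cfun_def by (rule exI[of _ "CPair CFst CSnd"]) simp

lemma cfun_subst:
  assumes "cfun X g" "cfun X f"
  shows "cfun X (\<lambda>i x. g i (f i x))"
proof -
  from assms obtain c d where "\<forall>i x. run (X i) c x = Some (g i x)"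
    "\<forall>i x. run (X i) d x = Some (f i x)" unfolding cfun_def by blast
  then have "\<forall>i x. run (X i) (CComp c d) x = Some (g i (f i x))" by simp
  then show ?thesis unfolding cfun_def by blast
qed

lemma cfun_Suc [computable]: "cfun X f \<Longrightarrow> cfun X (\<lambda>i x. Suc (f i x))"
  by (rule cfun_subst[of X "\<lambda>i. Suc"]) (auto simp: cfun_def intro: exI[of _ CSuc])

lemma cfun_p1 [computable]: "cfun X f \<Longrightarrow> cfun X (\<lambda>i x. p1 (f i x))"
  by (rule cfun_subst[of X "\<lambda>i. p1"]) (auto simp: cfun_def intro: exI[of _ CFst])

lemma cfun_p2 [computable]: "cfun X f \<Longrightarrow> cfun X (\<lambda>i x. p2 (f i x))"
  by (rule cfun_subst[of X "\<lambda>i. p2"]) (auto simp: cfun_def intro: exI[of _ CSnd])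

lemma cfun_const [computable]: "cfun X (\<lambda>i x. k)"
proof (induction k)
  case 0
  show ?case unfolding cfun_def by (rule exI[of _ CZero]) simp
qed (rule cfun_Suc)

lemma cfun_pr [computable]:
  assumes "cfun X f" "cfun X g"
  shows "cfun X (\<lambda>i x. pr (f i x) (g i x))"
proof -
  from assms obtain c d where "\<forall>i x. run (X i) c x = Some (f i x)"
    "\<forall>i x. run (X i) d x = Some (g i x)" unfolding cfun_def by blast
  then have "\<forall>i x. run (X i) (CPair c d) x = Some (pr (f i x) (g i x))" by simp
  then show ?thesis unfolding cfun_def by blast
qed

lemma cfun_rec [computable]:
  assumes "cfun X n" "cfun X a" "cfun X (\<lambda>i z. h i (p1 z) (p1 (p2 z)) (p2 (p2 z)))"
  shows "cfun X (\<lambda>i x. rec_nat (a i x) (h i x) (n i x))"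
proof -
  from assms obtain c d where *: "\<forall>i x. run (X i) c x = Some (a i x)"
    "\<forall>i z. run (X i) d z = Some (h i (p1 z) (p1 (p2 z)) (p2 (p2 z)))"
    unfolding cfun_def by blast
  have "run (X i) (CPrec c d) (pr x m) = Some (rec_nat (a i x) (h i x) m)" for i x m
    by (induction m) (use * in simp_all)
  then have "cfun X (\<lambda>i z. rec_nat (a i (p1 z)) (h i (p1 z)) (p2 z))"
    unfolding cfun_def by (metis pr_p1_p2)
  from cfun_subst[OF this cfun_pr[OF cfun_id assms(1)]] show ?thesis by simp
qed

lemma cfun_oracle:
  assumes "cfun X f"
  shows "cfun X (\<lambda>i x. if f i x \<in> X i then 1 else 0)"
  by (rule cfun_subst[of X "\<lambda>i x. if x \<in> X i then 1 else 0", OF _ assms])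
     (auto simp: cfun_def intro: exI[of _ CQuery])

lemma cfun_funpow [computable]:
  assumes "cfun X n" "cfun X a" "cfun X (\<lambda>i z. f i (p1 z) (p2 z))"
  shows "cfun X (\<lambda>i x. (f i x ^^ n i x) (a i x))"
proof -
  have "rec_nat b (\<lambda>_. f i x) m = (f i x ^^ m) b" for i x m b
    by (induction m) simp_all
  moreover have "cfun X (\<lambda>i z. f i (p1 z) (p2 (p2 z)))"
    using cfun_subst[OF assms(3), of "\<lambda>i z. pr (p1 z) (p2 (p2 z))"]
    by (simp add: computable)
  ultimately show ?thesis
    using cfun_rec[OF assms(1,2), of "\<lambda>i x _. f i x"] by simp
qed

lemma cfun_add [computable]:
  assumes "cfun X f" "cfun X g"
  shows "cfun X (\<lambda>i x. f i x + g i x)"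
proof -
  have "rec_nat a (\<lambda>_. Suc) b = a + b" for a b by (induction b) simp_all
  then show ?thesis using cfun_rec[OF assms(2,1), of "\<lambda>_ _ _. Suc"] by (simp add: computable)
qed

lemma cfun_pred [computable]: "cfun X f \<Longrightarrow> cfun X (\<lambda>i x. f i x - 1)"
proof -
  assume "cfun X f"
  have "rec_nat 0 (\<lambda>m _. m) a = a - 1" for a :: nat by (cases a) simp_all
  then show ?thesis using cfun_rec[OF \<open>cfun X f\<close> cfun_const[of X 0], of "\<lambda>_ _ m _. m"]
    by (simp add: computable)
qed

lemma cfun_diff [computable]:
  assumes "cfun X f" "cfun X g"
  shows "cfun X (\<lambda>i x. f i x - g i x)"
proof -
  have "rec_nat a (\<lambda>_ y. y - 1) b = a - b" for a b :: nat by (induction b) simp_all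
  moreover have "cfun X (\<lambda>i z. p2 (p2 z) - 1)" by (intro computable)
  ultimately show ?thesis using cfun_rec[OF assms(2,1), of "\<lambda>_ _ _ y. y - 1"] by simp
qed

lemma cfun_mult [computable]:
  assumes "cfun X f" "cfun X g"
  shows "cfun X (\<lambda>i x. f i x * g i x)"
proof -
  have "rec_nat 0 (\<lambda>_ y. y + a) b = a * b" for a b :: nat by (induction b) simp_all
  moreover have "cfun X (\<lambda>i z. p2 (p2 z) + f i (p1 z))"
    by (intro computable cfun_subst[OF assms(1)])
  ultimately show ?thesis
    using cfun_rec[OF assms(2) cfun_const[of X 0], of "\<lambda>i x _ y. y + f i x"] by simp
qed

lemma cfun_power [computable]:
  assumes "cfun X f" "cfun X g"
  shows "cfun X (\<lambda>i x. f i x ^ g i x)"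
proof -
  have "rec_nat 1 (\<lambda>_ y. y * a) b = a ^ b" for a b :: nat by (induction b) simp_all
  moreover have "cfun X (\<lambda>i z. p2 (p2 z) * f i (p1 z))"
    by (intro computable cfun_subst[OF assms(1)])
  ultimately show ?thesis
    using cfun_rec[OF assms(2) cfun_const[of X 1], of "\<lambda>i x _ y. y * f i x"] by simp
qed

text \<open>Primitive recursion on the truth value acts as a case distinction: the base value is the
  else branch, and a single step that ignores its arguments gives the then branch.\<close>

lemma cfun_if [computable]:
  assumes "cdec X P" "cfun X f" "cfun X g"
  shows "cfun X (\<lambda>i x. if P i x then f i x else g i x)"
proof -
  have "cfun X (\<lambda>i z. f i (p1 z))"
    using cfun_subst[OF assms(2) cfun_p1[OF cfun_id]] .
  from cfun_rec[OF assms(1)[unfolded cdec_def] assms(3) this]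
  have "cfun X (\<lambda>i x. rec_nat (g i x) (\<lambda>_ _. f i x) (if P i x then 1 else 0))" .
  then show ?thesis by (rule cfun_cong) simp
qed

section \<open>Closure properties of decidable predicates\<close>

lemma cdec_comp: "cdec X P \<Longrightarrow> cfun X f \<Longrightarrow> cdec X (\<lambda>i x. P i (f i x))"
  unfolding cdec_def by (rule cfun_subst)

lemma cdec_const [computable]: "cdec X (\<lambda>i x. b)"
  unfolding cdec_def by (intro computable)

lemma cdec_oracle [computable]: "cfun X f \<Longrightarrow> cdec X (\<lambda>i x. f i x \<in> X i)"
  unfolding cdec_def by (rule cfun_oracle)

lemma cdec_not [computable]:
  assumes "cdec X P"
  shows "cdec X (\<lambda>i x. \<not> P i x)"
  unfolding cdec_def
  by (rule cfun_cong[OF cfun_if[OF assms cfun_const[of X 0] cfun_const[of X 1]]]) simp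

lemma cdec_conj [computable]:
  assumes "cdec X P" "cdec X Q"
  shows "cdec X (\<lambda>i x. P i x \<and> Q i x)"
  unfolding cdec_def
  by (rule cfun_cong[OF cfun_if[OF assms(1) assms(2)[unfolded cdec_def] cfun_const[of X 0]]]) simp

lemma cdec_disj [computable]: "cdec X P \<Longrightarrow> cdec X Q \<Longrightarrow> cdec X (\<lambda>i x. P i x \<or> Q i x)"
  by (rule cdec_cong[OF cdec_not[OF cdec_conj[OF cdec_not cdec_not]], of X P Q]) simp_all

lemma cdec_pos: "cfun X f \<Longrightarrow> cdec X (\<lambda>i x. 0 < f i x)"
proof -
  assume "cfun X f"
  then have "cfun X (\<lambda>i x. 1 - (1 - f i x))" by (intro computable)
  then show ?thesis unfolding cdec_def by (rule cfun_cong) auto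
qed

lemma cdec_less [computable]: "cfun X f \<Longrightarrow> cfun X g \<Longrightarrow> cdec X (\<lambda>i x. f i x < g i x)"
  by (rule cdec_cong[OF cdec_pos[OF cfun_diff], of X g f]) auto

lemma cdec_le [computable]: "cfun X f \<Longrightarrow> cfun X g \<Longrightarrow> cdec X (\<lambda>i x. f i x \<le> g i x)"
  by (rule cdec_cong[OF cdec_not[OF cdec_less], of X g f]) auto

lemma cdec_eq [computable]: "cfun X f \<Longrightarrow> cfun X g \<Longrightarrow> cdec X (\<lambda>i x. f i x = g i x)"
  by (rule cdec_cong[OF cdec_conj[OF cdec_le cdec_le], of X f g g f]) auto

lemma cdec_all_less [computable]:
  assumes "cfun X n" "cdec X (\<lambda>i z. P i (p1 z) (p2 z))"
  shows "cdec X (\<lambda>i x. \<forall>m<n i x. P i x m)"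
proof -
  have rec: "rec_nat 1 (\<lambda>m y. if P i x m \<and> y = 1 then 1 else 0) k = (if \<forall>m<k. P i x m then 1 else (0::nat))"
    for i x k by (induction k) (auto simp: less_Suc_eq)
  have "cdec X (\<lambda>i z. P i (p1 z) (p1 (p2 z)))"
    by (rule cdec_cong[OF cdec_comp[OF assms(2), of "\<lambda>i z. pr (p1 z) (p1 (p2 z))"]])
       (intro computable, simp)
  then have "cfun X (\<lambda>i x. rec_nat 1 (\<lambda>m y. if P i x m \<and> y = 1 then 1 else 0) (n i x))"
    by (intro computable assms(1))
  then show ?thesis unfolding cdec_def by (rule cfun_cong) (simp only: rec)
qed

text \<open>Every number codes an infinite sequence by iterated pairing. Only an initial segment is
  ever used, so no length is stored and no test for well-formed codes is required.\<close>

definition nth_of :: "nat \<Rightarrow> nat \<Rightarrow> nat" where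
  "nth_of w n = p1 ((p2 ^^ n) w)"

lemma nth_of_exists: "\<exists>w. \<forall>m<n. nth_of w m = f m"
proof (induction n arbitrary: f)
  case (Suc n)
  from Suc[of "\<lambda>m. f (Suc m)"] obtain w where w: "\<forall>m<n. nth_of w m = f (Suc m)" by blast
  have "nth_of (pr (f 0) w) m = f m" if "m < Suc n" for m
    using w that by (cases m) (simp_all add: nth_of_def funpow_Suc_right del: funpow.simps(2))
  then show ?case by blast
qed simp

lemma cfun_nth_of [computable]: "cfun X f \<Longrightarrow> cfun X g \<Longrightarrow> cfun X (\<lambda>i x. nth_of (f i x) (g i x))"
  unfolding nth_of_def by (intro computable)

section \<open>Closure properties of enumerable predicates\<close>

lemma cenumI: "cdec X (\<lambda>i z. D i (p1 z) (p2 z)) \<Longrightarrow> cenum X (\<lambda>i x. \<exists>n. D i x n)"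
  unfolding cenum_def by (intro exI[of _ "\<lambda>i z. D i (p1 z) (p2 z)"]) simp

lemma cenumE:
  assumes "cenum X P"
  obtains D where "cdec X (\<lambda>i z. D i (p1 z) (p2 z))" "P = (\<lambda>i x. \<exists>n. D i x n)"
proof -
  from assms obtain D where D: "cdec X D" "\<forall>i x. P i x \<longleftrightarrow> (\<exists>n. D i (pr x n))"
    unfolding cenum_def by blast
  show ?thesis by (rule that[of "\<lambda>i x n. D i (pr x n)"]) (use D in \<open>auto simp: fun_eq_iff\<close>)
qed

lemma cenum_cdec: "cdec X P \<Longrightarrow> cenum X P"
  using cenumI[of X "\<lambda>i x n. P i x"] cdec_comp[of X P "\<lambda>_. p1"] by (simp add: computable)

lemma cenum_comp:
  assumes "cenum X P" "cfun X f"
  shows "cenum X (\<lambda>i x. P i (f i x))"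
proof -
  from assms(1) obtain D where D: "cdec X (\<lambda>i z. D i (p1 z) (p2 z))" "P = (\<lambda>i x. \<exists>n. D i x n)"
    by (rule cenumE)
  have "cdec X (\<lambda>i z. D i (f i (p1 z)) (p2 z))"
    using cdec_comp[OF D(1), of "\<lambda>i z. pr (f i (p1 z)) (p2 z)"]
      cfun_subst[OF assms(2), of "\<lambda>_. p1"] by (simp add: computable)
  from cenumI[OF this] show ?thesis unfolding D(2) .
qed

lemma cenum_ex [computable]:
  assumes "cenum X (\<lambda>i z. P i (p1 z) (p2 z))"
  shows "cenum X (\<lambda>i x. \<exists>n. P i x n)"
proof -
  from assms obtain D where D: "cdec X (\<lambda>i z. D i (p1 z) (p2 z))"
    "(\<lambda>i z. P i (p1 z) (p2 z)) = (\<lambda>i x. \<exists>n. D i x n)" by (rule cenumE)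
  have P: "P i x m \<longleftrightarrow> (\<exists>n. D i (pr x m) n)" for i x m
    using fun_cong[OF fun_cong[OF D(2), of i], of "pr x m"] by simp
  have "cdec X (\<lambda>i z. D i (pr (p1 z) (p1 (p2 z))) (p2 (p2 z)))"
    using cdec_comp[OF D(1), of "\<lambda>i z. pr (pr (p1 z) (p1 (p2 z))) (p2 (p2 z))"]
    by (simp add: computable)
  from cenumI[OF this]
  have "cenum X (\<lambda>i x. \<exists>n. D i (pr x (p1 n)) (p2 n))" .
  moreover have "(\<exists>n. D i (pr x (p1 n)) (p2 n)) \<longleftrightarrow> (\<exists>n. P i x n)" for i x
    unfolding P by (metis fst_conv snd_conv prod_encode_inverse)
  ultimately show ?thesis by simp
qed

lemma cenum_conj [computable]:
  assumes "cenum X P" "cenum X Q"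
  shows "cenum X (\<lambda>i x. P i x \<and> Q i x)"
proof -
  from assms(1) obtain D where D: "cdec X (\<lambda>i z. D i (p1 z) (p2 z))" "P = (\<lambda>i x. \<exists>n. D i x n)"
    by (rule cenumE)
  from assms(2) obtain E where E: "cdec X (\<lambda>i z. E i (p1 z) (p2 z))" "Q = (\<lambda>i x. \<exists>n. E i x n)"
    by (rule cenumE)
  have "cdec X (\<lambda>i z. D i (p1 (p1 z)) (p2 (p1 z)))"
    using cdec_comp[OF D(1), of "\<lambda>i z. p1 z"] by (simp add: computable)
  moreover have "cdec X (\<lambda>i z. E i (p1 (p1 z)) (p2 z))"
    using cdec_comp[OF E(1), of "\<lambda>i z. pr (p1 (p1 z)) (p2 z)"] by (simp add: computable)
  ultimately have "cenum X (\<lambda>i x. \<exists>m n. D i x m \<and> E i x n)"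
    by (intro computable cenum_cdec)
  then show ?thesis unfolding D(2) E(2) by simp
qed

lemma cenum_disj [computable]:
  assumes "cenum X P" "cenum X Q"
  shows "cenum X (\<lambda>i x. P i x \<or> Q i x)"
proof -
  from assms(1) obtain D where D: "cdec X (\<lambda>i z. D i (p1 z) (p2 z))" "P = (\<lambda>i x. \<exists>n. D i x n)"
    by (rule cenumE)
  from assms(2) obtain E where E: "cdec X (\<lambda>i z. E i (p1 z) (p2 z))" "Q = (\<lambda>i x. \<exists>n. E i x n)"
    by (rule cenumE)
  have "cenum X (\<lambda>i x. \<exists>n. D i x n \<or> E i x n)"
    by (intro computable cenum_cdec D E)
  then show ?thesis unfolding D(2) E(2) by (simp add: ex_disj_distrib)
qed

text \<open>The finitely many witnesses are packed into one sequence number \<open>w\<close>, which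
  moves the existential quantifier in front of the bounded universal one.\<close>

lemma cenum_all_less [computable]:
  assumes "cfun X n" "cenum X (\<lambda>i z. P i (p1 z) (p2 z))"
  shows "cenum X (\<lambda>i x. \<forall>m<n i x. P i x m)"
proof -
  from assms(2) obtain D where D: "cdec X (\<lambda>i z. D i (p1 z) (p2 z))"
    "(\<lambda>i z. P i (p1 z) (p2 z)) = (\<lambda>i x. \<exists>n. D i x n)" by (rule cenumE)
  have P: "P i x m \<longleftrightarrow> (\<exists>n. D i (pr x m) n)" for i x m
    using fun_cong[OF fun_cong[OF D(2), of i], of "pr x m"] by simp
  have "cdec X (\<lambda>i z. D i (pr (p1 (p1 z)) (p2 z)) (nth_of (p2 (p1 z)) (p2 z)))"
    using cdec_comp[OF D(1), of "\<lambda>i z. pr (pr (p1 (p1 z)) (p2 z)) (nth_of (p2 (p1 z)) (p2 z))"]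
    by (simp add: computable)
  moreover have "cfun X (\<lambda>i z. n i (p1 z))"
    by (rule cfun_subst[OF assms(1)]) (intro computable)
  ultimately have "cdec X (\<lambda>i z. \<forall>m<n i (p1 z). D i (pr (p1 z) m) (nth_of (p2 z) m))"
    by (intro computable)
  from cenumI[OF this] have "cenum X (\<lambda>i x. \<exists>w. \<forall>m<n i x. D i (pr x m) (nth_of w m))" .
  moreover have "(\<exists>w. \<forall>m<n i x. D i (pr x m) (nth_of w m)) \<longleftrightarrow> (\<forall>m<n i x. P i x m)" for i x
  proof
    assume "\<forall>m<n i x. P i x m"
    then obtain f where "\<forall>m<n i x. D i (pr x m) (f m)" unfolding P by metis
    then show "\<exists>w. \<forall>m<n i x. D i (pr x m) (nth_of w m)"
      using nth_of_exists[of "n i x" f] by metis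
  qed (auto simp: P)
  ultimately show ?thesis by simp
qed

section \<open>The universal program and the jump\<close>

lemmas cenum_atoms [computable] = cenum_cdec[OF cdec_eq] cenum_cdec[OF cdec_less] cenum_cdec[OF cdec_le]
  cenum_cdec[OF cdec_oracle] cenum_cdec[OF cdec_const]

lemma code_of_pair: "code_of (5 + 4 * pr a b) = CPair (code_of a) (code_of b)"
proof -
  have "5 + 4 * pr a b = Suc (Suc (Suc (Suc (Suc (4 * pr a b)))))" by simp
  then show ?thesis by (simp only: code_of.simps(6)) simp
qed

lemma div_mod_4:
  "(Suc (4 * m)) mod 4 = 1" "(Suc (4 * m)) div 4 = m" "(Suc (Suc (4 * m))) mod 4 = 2"
  "(Suc (Suc (4 * m))) div 4 = m" "(Suc (Suc (Suc (4 * m)))) mod 4 = 3" "(Suc (Suc (Suc (4 * m)))) div 4 = m" for m :: nat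
  by presburger+

lemma code_of_comp: "code_of (6 + 4 * pr a b) = CComp (code_of a) (code_of b)"
proof -
  have "6 + 4 * pr a b = Suc (Suc (Suc (Suc (Suc (Suc (4 * pr a b))))))" by simp
  then show ?thesis by (simp only: code_of.simps(6) div_mod_4) simp
qed

lemma code_of_prec: "code_of (7 + 4 * pr a b) = CPrec (code_of a) (code_of b)"
proof -
  have "7 + 4 * pr a b = Suc (Suc (Suc (Suc (Suc (Suc (Suc (4 * pr a b)))))))" by simp
  then show ?thesis by (simp only: code_of.simps(6) div_mod_4) simp
qed

lemma code_of_mu: "code_of (8 + 4 * a) = CMu (code_of a)"
proof -
  have "8 + 4 * a = Suc (Suc (Suc (Suc (Suc (Suc (Suc (Suc (4 * a))))))))" by simp
  then show ?thesis by (simp only: code_of.simps(6) div_mod_4) (simp split: prod.split)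
qed

lemma index_cases:
  obtains "e = 0" | "e = 1" | "e = 2" | "e = 3" | "e = 4"
  | a b where "e = 5 + 4 * pr a b" "a < e" "b < e"
  | a b where "e = 6 + 4 * pr a b" "a < e" "b < e"
  | a b where "e = 7 + 4 * pr a b" "a < e" "b < e"
  | a where "e = 8 + 4 * a" "a < e"
proof -
  consider "e = 0" | "e = 1" | "e = 2" | "e = 3" | "e = 4" | "5 \<le> e" by linarith
  then show ?thesis
  proof cases
    case 6
    define q where "q = (e - 5) div 4"
    have le: "p1 q \<le> q" "p2 q \<le> q"
      using le_prod_encode_1[of "p1 q" "p2 q"] le_prod_encode_2[of "p2 q" "p1 q"] by simp_all
    have "e - 5 = 4 * q + (e - 5) mod 4" unfolding q_def by simp
    moreover have "(e - 5) mod 4 < 4" by simp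
    ultimately consider "e = 5 + 4 * q" | "e = 6 + 4 * q" | "e = 7 + 4 * q" | "e = 8 + 4 * q"
      using 6 by linarith
    then show ?thesis
      by cases (use le that(6-8)[of "p1 q" "p2 q"] that(9)[of q] in simp_all)
  qed (use that in blast)+
qed

section \<open>Computations as derivations in a finitary rule system\<close>

lemma phi_basic:
  "phi Y 0 x = Some 0" "phi Y 1 x = Some (Suc x)" "phi Y 2 x = Some (p1 x)" "phi Y 3 x = Some (p2 x)"
  "phi Y 4 x = Some (if x \<in> Y then 1 else 0)"
  by (simp_all add: phi_def numeral_eq_Suc)

lemma phi_pair: "phi Y (5 + 4 * pr a b) x =
    Option.bind (phi Y a x) (\<lambda>u. Option.bind (phi Y b x) (\<lambda>v. Some (pr u v)))"
  unfolding phi_def code_of_pair by simp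

lemma phi_comp: "phi Y (6 + 4 * pr a b) x = Option.bind (phi Y b x) (phi Y a)"
  unfolding phi_def code_of_comp by simp

lemma phi_prec: "phi Y (7 + 4 * pr a b) x = rec_nat (phi Y a (p1 x))
    (\<lambda>m r. Option.bind r (\<lambda>y. phi Y b (pr (p1 x) (pr m y)))) (p2 x)"
  unfolding phi_def code_of_prec by (simp add: case_prod_beta)

lemma phi_prec_0: "p2 x = 0 \<Longrightarrow> phi Y (7 + 4 * pr a b) x = phi Y a (p1 x)"
  unfolding phi_prec by simp

lemma phi_prec_Suc: "p2 x = Suc m \<Longrightarrow> phi Y (7 + 4 * pr a b) x =
    Option.bind (phi Y (7 + 4 * pr a b) (pr (p1 x) m)) (\<lambda>y. phi Y b (pr (p1 x) (pr m y)))"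
  unfolding phi_prec by simp

lemma run_CMu: "run Y (CMu c) x = Some n \<longleftrightarrow>
    run Y c (pr x n) = Some 0 \<and> (\<forall>m<n. \<exists>y. run Y c (pr x m) = Some (Suc y))"
proof -
  define found where "found n \<longleftrightarrow> run Y c (pr x n) = Some 0 \<and>
      (\<forall>m<n. \<exists>y. run Y c (pr x m) = Some (Suc y))" for n
  have unique: "m = n" if "found m" "found n" for m n
    using that unfolding found_def by (metis linorder_neqE_nat option.inject nat.distinct(1))
  have "run Y (CMu c) x = (if \<exists>n. found n then Some (LEAST n. found n) else None)"
    by (simp only: run.simps Let_def found_def)
  then have "run Y (CMu c) x = Some n \<longleftrightarrow> found n"
    by (metis LeastI unique option.inject option.distinct(1))
  then show ?thesis unfolding found_def .
qed

lemma phi_mu: "phi Y (8 + 4 * a) x = Some n \<longleftrightarrow>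
    phi Y a (pr x n) = Some 0 \<and> (\<forall>m<n. \<exists>y. phi Y a (pr x m) = Some (Suc y))"
  unfolding phi_def code_of_mu run_CMu ..

text \<open>One rule per program constructor, with \<open>H\<close> as the set of facts already
  derived; the fact that \<open>e\<close> maps \<open>x\<close> to \<open>y\<close> is coded as
  \<open>pr e (pr x y)\<close>. \<open>H\<close> occurs only positively, and only existential and
  bounded quantifiers are used, so that the closure rules for \<open>cenum\<close> apply once
  membership in \<open>H\<close> is enumerable.\<close>

definition eval_step :: "nat set \<Rightarrow> nat set \<Rightarrow> nat \<Rightarrow> nat \<Rightarrow> nat \<Rightarrow> bool" where
  "eval_step Y H e x y \<longleftrightarrow>
     e = 0 \<and> y = 0 \<or> e = 1 \<and> y = Suc x \<or> e = 2 \<and> y = p1 x \<or> e = 3 \<and> y = p2 x \<or>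
     e = 4 \<and> y = (if x \<in> Y then 1 else 0) \<or>
     (\<exists>a b u v. e = 5 + 4 * pr a b \<and> pr a (pr x u) \<in> H \<and> pr b (pr x v) \<in> H \<and> y = pr u v) \<or>
     (\<exists>a b u. e = 6 + 4 * pr a b \<and> pr b (pr x u) \<in> H \<and> pr a (pr u y) \<in> H) \<or>
     (\<exists>a b. e = 7 + 4 * pr a b \<and> p2 x = 0 \<and> pr a (pr (p1 x) y) \<in> H) \<or>
     (\<exists>a b m u. e = 7 + 4 * pr a b \<and> p2 x = Suc m \<and> pr e (pr (pr (p1 x) m) u) \<in> H \<and>
        pr b (pr (pr (p1 x) (pr m u)) y) \<in> H) \<or>
     (\<exists>a. e = 8 + 4 * a \<and> pr a (pr (pr x y) 0) \<in> H \<and>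
        (\<forall>m<y. \<exists>v. pr a (pr (pr x m) (Suc v)) \<in> H))"

lemma eval_step_mono: "eval_step Y H e x y \<Longrightarrow> H \<subseteq> H' \<Longrightarrow> eval_step Y H' e x y"
  unfolding eval_step_def
  by (elim disj_forward ex_forward conj_forward all_forward imp_forward) (assumption | rule subsetD)+

lemma eval_step_sound:
  assumes "\<And>e x y. pr e (pr x y) \<in> H \<Longrightarrow> phi Y e x = Some y" "eval_step Y H e x y"
  shows "phi Y e x = Some y"
  using assms(2) unfolding eval_step_def
proof (elim disjE exE conjE, goal_cases)
  case (10 a)
  then show ?case unfolding \<open>e = _\<close> phi_mu using assms(1) by blast
qed (auto simp: phi_basic phi_pair phi_comp phi_prec_0 phi_prec_Suc dest!: assms(1) simp del: One_nat_def)

text \<open>Induction on the index covers every constructor except primitive recursion, which calls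
  the same program with a smaller counter; there an inner induction on the counter applies the
  closure hypothesis at each step.\<close>

lemma eval_complete:
  assumes step: "\<And>e x y. eval_step Y H e x y \<Longrightarrow> pr e (pr x y) \<in> H"
  shows "phi Y e x = Some y \<Longrightarrow> pr e (pr x y) \<in> H"
proof (induction e arbitrary: x y rule: less_induct)
  case (less e)
  note IH = less.IH and prem = less.prems
  have *: "phi Y e x = Some y \<Longrightarrow> eval_step Y H e x y" for x y
  proof (cases e rule: index_cases)
    case (6 a b)
    assume "phi Y e x = Some y"
    then obtain u v where "phi Y a x = Some u" "phi Y b x = Some v" "y = pr u v"
      unfolding 6(1) phi_pair by (auto simp: bind_eq_Some_conv)
    then have "\<exists>a b u v. e = 5 + 4 * pr a b \<and> pr a (pr x u) \<in> H \<and> pr b (pr x v) \<in> H \<and> y = pr u v"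
      using IH 6 by blast
    then show ?thesis by (simp only: eval_step_def simp_thms)
  next
    case (7 a b)
    assume "phi Y e x = Some y"
    then obtain u where "phi Y b x = Some u" "phi Y a u = Some y"
      unfolding 7(1) phi_comp by (auto simp: bind_eq_Some_conv)
    then have "\<exists>a b u. e = 6 + 4 * pr a b \<and> pr b (pr x u) \<in> H \<and> pr a (pr u y) \<in> H"
      using IH 7 by blast
    then show ?thesis by (simp only: eval_step_def simp_thms)
  next
    case (8 a b)
    assume "phi Y e x = Some y"
    moreover have "phi Y e (pr x n) = Some y \<Longrightarrow> eval_step Y H e (pr x n) y" for x n y
    proof (induction n arbitrary: y)
      case 0
      then have "phi Y a x = Some y" unfolding 8(1) by (simp add: phi_prec_0)
      then have "\<exists>a b. e = 7 + 4 * pr a b \<and> p2 (pr x 0) = 0 \<and> pr a (pr (p1 (pr x 0)) y) \<in> H"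
        using IH[OF 8(2)] 8(1) by (intro exI[of _ a] exI[of _ b]) simp
      then show ?case by (simp only: eval_step_def simp_thms)
    next
      case (Suc n)
      then obtain u where u: "phi Y e (pr x n) = Some u" "phi Y b (pr x (pr n u)) = Some y"
        unfolding 8(1) by (subst (asm) (2) phi_prec_Suc) (auto simp: bind_eq_Some_conv)
      have "pr e (pr (pr x n) u) \<in> H" by (rule step[OF Suc.IH[OF u(1)]])
      moreover have "pr b (pr (pr x (pr n u)) y) \<in> H" by (rule IH[OF 8(3) u(2)])
      ultimately have "\<exists>a b m u. e = 7 + 4 * pr a b \<and> p2 (pr x (Suc n)) = Suc m \<and>
          pr e (pr (pr (p1 (pr x (Suc n))) m) u) \<in> H \<and>
          pr b (pr (pr (p1 (pr x (Suc n))) (pr m u)) y) \<in> H"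
        using 8(1) by (intro exI[of _ a] exI[of _ b] exI[of _ n] exI[of _ u]) simp
      then show ?case by (simp only: eval_step_def simp_thms)
    qed
    ultimately show ?thesis by (metis pr_p1_p2)
  next
    case (9 a)
    assume "phi Y e x = Some y"
    then have "phi Y a (pr x y) = Some 0" "\<forall>m<y. \<exists>v. phi Y a (pr x m) = Some (Suc v)"
      unfolding 9(1) phi_mu by auto
    then have "\<exists>a. e = 8 + 4 * a \<and> pr a (pr (pr x y) 0) \<in> H \<and>
        (\<forall>m<y. \<exists>v. pr a (pr (pr x m) (Suc v)) \<in> H)"
      using IH 9 by blast
    then show ?thesis by (simp only: eval_step_def simp_thms)
  qed (auto simp: phi_basic[simplified] eval_step_def)
  show ?case by (rule step[OF *[OF prem]])
qed

text \<open>Every rule has finitely many premises; even unbounded search with result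
  \<open>y\<close> inspects only \<open>y + 1\<close> facts.\<close>

lemma eval_step_finite:
  assumes "eval_step Y H e x y"
  shows "\<exists>T. finite T \<and> T \<subseteq> H \<and> eval_step Y T e x y"
  using assms unfolding eval_step_def
proof (elim disjE exE conjE, goal_cases)
  case (6 a b u v)
  then show ?case by (intro exI[of _ "{pr a (pr x u), pr b (pr x v)}"]) auto
next
  case (7 a b u)
  then show ?case by (intro exI[of _ "{pr b (pr x u), pr a (pr u y)}"]) auto
next
  case (8 a b)
  then show ?case by (intro exI[of _ "{pr a (pr (p1 x) y)}"]) auto
next
  case (9 a b m u)
  then show ?case
    by (intro exI[of _ "{pr e (pr (pr (p1 x) m) u), pr b (pr (pr (p1 x) (pr m u)) y)}"]) auto
next
  case (10 a)
  then obtain v where "\<forall>m<y. pr a (pr (pr x m) (Suc (v m))) \<in> H" by metis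
  then show ?case using 10
    by (intro exI[of _ "insert (pr a (pr (pr x y) 0)) ((\<lambda>m. pr a (pr (pr x m) (Suc (v m)))) ` {..<y})"])
       auto
qed (rule exI[of _ "{}"], simp)+

definition eval_list :: "nat set \<Rightarrow> nat list \<Rightarrow> bool" where
  "eval_list Y L \<longleftrightarrow> (\<forall>k<length L. eval_step Y {L ! j | j. j < k} (p1 (L ! k)) (p1 (p2 (L ! k))) (p2 (p2 (L ! k))))"

lemma eval_list_append:
  assumes "eval_list Y L" "eval_list Y M"
  shows "eval_list Y (L @ M)"
  unfolding eval_list_def
proof (intro allI impI)
  fix k assume k: "k < length (L @ M)"
  show "eval_step Y {(L @ M) ! j |j. j < k} (p1 ((L @ M) ! k)) (p1 (p2 ((L @ M) ! k))) (p2 (p2 ((L @ M) ! k)))"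
  proof (cases "k < length L")
    case True
    then have "{(L @ M) ! j |j. j < k} = {L ! j |j. j < k}"
      by (intro Collect_cong ex_cong1) (auto simp: nth_append)
    then show ?thesis using assms(1) True unfolding eval_list_def by (simp add: nth_append)
  next
    case False
    then obtain m where m: "k = length L + m" "m < length M"
      using k by (metis le_Suc_ex length_append nat_add_left_cancel_less not_less)
    then have "eval_step Y {M ! j |j. j < m} (p1 (M ! m)) (p1 (p2 (M ! m))) (p2 (p2 (M ! m)))"
      using assms(2) unfolding eval_list_def by blast
    moreover have "{M ! j |j. j < m} \<subseteq> {(L @ M) ! j |j. j < k}"
    proof
      fix t assume "t \<in> {M ! j |j. j < m}"
      then obtain j where "j < m" "t = M ! j" by blast
      then have "t = (L @ M) ! (length L + j)" "length L + j < k" using m by simp_all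
      then show "t \<in> {(L @ M) ! j |j. j < k}" by blast
    qed
    ultimately show ?thesis using m(1) by (auto intro: eval_step_mono)
  qed
qed

text \<open>From right to left, soundness goes by induction on the position in the list. Conversely,
  the facts that occur in some derivation are closed under \<open>eval_step\<close>, because the
  derivations of finitely many premises can be concatenated; \<open>eval_complete\<close> then
  applies.\<close>

lemma phi_eq_Some_iff_list:
  "phi Y e x = Some y \<longleftrightarrow> (\<exists>L. eval_list Y L \<and> pr e (pr x y) \<in> set L)"
proof
  assume "\<exists>L. eval_list Y L \<and> pr e (pr x y) \<in> set L"
  then obtain L where L: "eval_list Y L" "pr e (pr x y) \<in> set L" by blast
  have *: "k < length L \<Longrightarrow> L ! k = pr e (pr x y) \<Longrightarrow> phi Y e x = Some y" for k e x y
  proof (induction k arbitrary: e x y rule: less_induct)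
    case (less k)
    then have "eval_step Y {L ! j | j. j < k} e x y"
      using L(1) unfolding eval_list_def by force
    then show ?case
    proof (rule eval_step_sound[rotated])
      fix e x y assume "pr e (pr x y) \<in> {L ! j | j. j < k}"
      then obtain j where "j < k" "L ! j = pr e (pr x y)" by auto
      then show "phi Y e x = Some y" using less by simp
    qed
  qed
  from L(2) show "phi Y e x = Some y" using * by (auto simp: in_set_conv_nth)
next
  let ?H = "{t. \<exists>L. eval_list Y L \<and> t \<in> set L}"
  have fin: "finite T \<Longrightarrow> T \<subseteq> ?H \<Longrightarrow> \<exists>L. eval_list Y L \<and> T \<subseteq> set L" for T
  proof (induction T rule: finite_induct)
    case empty
    show ?case by (rule exI[of _ "[]"]) (simp add: eval_list_def)
  next
    case (insert t T)
    then obtain L M where "eval_list Y L" "T \<subseteq> set L" "eval_list Y M" "t \<in> set M" by auto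
    then show ?case by (intro exI[of _ "L @ M"]) (auto simp: eval_list_append)
  qed
  assume "phi Y e x = Some y"
  then have "pr e (pr x y) \<in> ?H"
  proof (rule eval_complete[rotated])
    fix e x y assume "eval_step Y ?H e x y"
    from eval_step_finite[OF this] obtain T where T: "finite T" "T \<subseteq> ?H" "eval_step Y T e x y"
      by blast
    from fin[OF T(1,2)] obtain L where L: "eval_list Y L" "T \<subseteq> set L" by blast
    have sub: "T \<subseteq> {L ! j | j. j < length L}"
      using L(2) unfolding set_conv_nth .
    let ?L = "L @ [pr e (pr x y)]"
    have prefix: "{?L ! j |j. j < k} = {L ! j |j. j < k}" if "k \<le> length L" for k
      using that by (intro Collect_cong ex_cong1) (auto simp: nth_append)
    have "eval_list Y ?L"
      unfolding eval_list_def
    proof (intro allI impI)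
      fix k assume "k < length ?L"
      then consider "k < length L" | "k = length L" by fastforce
      then show "eval_step Y {?L ! j |j. j < k} (p1 (?L ! k)) (p1 (p2 (?L ! k))) (p2 (p2 (?L ! k)))"
      proof cases
        case 1
        then show ?thesis using L(1) unfolding eval_list_def prefix[OF less_imp_le[OF 1]]
          by (simp add: nth_append)
      next
        case 2
        then show ?thesis using eval_step_mono[OF T(3) sub] unfolding 2 prefix[OF order_refl] by simp
      qed
    qed
    then show "pr e (pr x y) \<in> ?H" by (auto intro!: exI[of _ ?L])
  qed
  then show "\<exists>L. eval_list Y L \<and> pr e (pr x y) \<in> set L" by blast
qed

text \<open>A normal form in the style of Kleene: the derivation becomes a sequence number and the
  set of earlier facts a bounded quantifier, which is the form that the closure rules
  accept.\<close>

lemma phi_eq_Some_iff: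
  "phi Y e x = Some y \<longleftrightarrow> (\<exists>s n.
     (\<forall>k<n. eval_step Y {t. \<exists>j<k. t = nth_of s j} (p1 (nth_of s k)) (p1 (p2 (nth_of s k))) (p2 (p2 (nth_of s k)))) \<and>
     (\<exists>k<n. pr e (pr x y) = nth_of s k))" (is "_ \<longleftrightarrow> ?R")
proof
  assume "phi Y e x = Some y"
  then obtain L where L: "eval_list Y L" "pr e (pr x y) \<in> set L"
    unfolding phi_eq_Some_iff_list by blast
  obtain s where s: "\<forall>m<length L. nth_of s m = L ! m" using nth_of_exists by blast
  have "{t. \<exists>j<k. t = nth_of s j} = {L ! j | j. j < k}" if "k < length L" for k
    using that s by (intro Collect_cong) (auto simp: conj_commute)
  then have "\<forall>k<length L. eval_step Y {t. \<exists>j<k. t = nth_of s j} (p1 (nth_of s k)) (p1 (p2 (nth_of s k))) (p2 (p2 (nth_of s k)))"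
    using L(1) s unfolding eval_list_def by simp
  moreover have "\<exists>k<length L. pr e (pr x y) = nth_of s k"
    using L(2) s by (auto simp: in_set_conv_nth)
  ultimately show ?R by blast
next
  assume ?R
  then obtain s n where *: "\<forall>k<n. eval_step Y {t. \<exists>j<k. t = nth_of s j} (p1 (nth_of s k)) (p1 (p2 (nth_of s k))) (p2 (p2 (nth_of s k)))"
     "\<exists>k<n. pr e (pr x y) = nth_of s k" by blast
  let ?L = "map (nth_of s) [0..<n]"
  have "{?L ! j | j. j < k} = {t. \<exists>j<k. t = nth_of s j}" if "k < n" for k
    using that by (intro Collect_cong ex_cong1) auto
  then have "eval_list Y ?L" using *(1) unfolding eval_list_def by simp
  moreover have "pr e (pr x y) \<in> set ?L" using *(2) by auto
  ultimately show "phi Y e x = Some y" unfolding phi_eq_Some_iff_list by blast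
qed


text \<open>The simulated oracle may depend on a computed parameter \<open>w\<close>. At limit
  stages this lets a single program run computations relative to different columns of its own
  oracle.\<close>

lemma cenum_phi:
  assumes Y: "cdec X (\<lambda>i z. p2 z \<in> Y i (p1 z))"
    and f: "cfun X w" "cfun X e" "cfun X a" "cfun X b"
  shows "cenum X (\<lambda>i x. phi (Y i (w i x)) (e i x) (a i x) = Some (b i x))"
proof -
  have Y': "cdec X (\<lambda>i z. f i z \<in> Y i (g i z))" if "cfun X f" "cfun X g" for f g
    using cdec_comp[OF Y cfun_pr[OF that(2,1)]] by simp
  have "cenum X (\<lambda>i z. phi (Y i (p1 z)) (p1 (p2 z)) (p1 (p2 (p2 z))) = Some (p2 (p2 (p2 z))))"
    unfolding phi_eq_Some_iff eval_step_def mem_Collect_eq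
    by (intro computable Y')
  from cenum_comp[OF this cfun_pr[OF f(1) cfun_pr[OF f(2) cfun_pr[OF f(3,4)]]]]
  show ?thesis by simp
qed

lemma cenum_phi_const [computable]:
  assumes "cfun X e" "cfun X a" "cfun X b"
  shows "cenum X (\<lambda>i x. phi {} (e i x) (a i x) = Some (b i x))"
  by (rule cenum_phi[where w = "\<lambda>_ _. 0"]) (use assms in \<open>simp_all add: cdec_const cfun_const\<close>)

section \<open>Indices of enumerable sets\<close>

definition enum_set :: "nat set \<Rightarrow> nat \<Rightarrow> nat set" where
  "enum_set X e = {x. phi X e x \<noteq> None}"

lemma ce_in_iff: "ce_in X S \<longleftrightarrow> (\<exists>e. S = enum_set X e)"
  unfolding ce_in_def enum_set_def ..

lemma cenum_enum_set:
  assumes Y: "cdec X (\<lambda>i z. p2 z \<in> Y i (p1 z))"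
    and f: "cfun X w" "cfun X e" "cfun X a"
  shows "cenum X (\<lambda>i x. a i x \<in> enum_set (Y i (w i x)) (e i x))"
proof -
  have g: "cfun X (\<lambda>i z. g i (p1 z))" if "cfun X g" for g
    by (rule cfun_subst[OF that]) (intro computable)
  have "cenum X (\<lambda>i x. \<exists>y. phi (Y i (w i x)) (e i x) (a i x) = Some y)"
    by (rule cenum_ex, rule cenum_phi[OF Y]) (intro g f computable)+
  then show ?thesis by (simp add: enum_set_def)
qed

text \<open>Unbounded search for a witness halts exactly where the predicate holds. The decision
  program is the same for all \<open>i\<close>, hence so is the index of the search.\<close>

lemma cenum_index:
  assumes "cenum X P"
  shows "\<exists>e. \<forall>i x. P i x \<longleftrightarrow> x \<in> enum_set (X i) e"
proof -
  from assms obtain D where D: "cdec X D" "\<And>i x. P i x \<longleftrightarrow> (\<exists>n. D i (pr x n))"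
    unfolding cenum_def by blast
  \<comment> \<open>\<open>CMu\<close> stops at the value 0, so the decision is negated in order
    that a witness yields 0.\<close>
  from cdec_not[OF D(1)] obtain c where c: "\<And>i x. run (X i) c x = Some (if \<not> D i x then 1 else 0)"
    unfolding cdec_def cfun_def by blast
  obtain e where e: "code_of e = CMu c" using surj_code_of by (metis surjD)
  have "(\<exists>n. run (X i) (CMu c) x = Some n) \<longleftrightarrow> (\<exists>n. D i (pr x n))" for i x
  proof
    assume "\<exists>n. D i (pr x n)"
    then obtain n where n: "D i (pr x n)" "\<And>m. m < n \<Longrightarrow> \<not> D i (pr x m)"
      using exists_least_iff[of "\<lambda>n. D i (pr x n)"] by blast
    then have "run (X i) (CMu c) x = Some n"
      unfolding run_CMu c by simp
    then show "\<exists>n. run (X i) (CMu c) x = Some n" by blast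
  qed (auto simp: run_CMu c simp del: run.simps split: if_splits)
  then have "P i x \<longleftrightarrow> x \<in> enum_set (X i) e" for i x
    unfolding D(2) enum_set_def phi_def e by auto
  then show ?thesis by blast
qed

lemma ce_in_iff_cenum: "ce_in X S \<longleftrightarrow> cenum (\<lambda>_ :: unit. X) (\<lambda>_ x. x \<in> S)"
proof
  assume "ce_in X S"
  then obtain e where "S = enum_set X e" unfolding ce_in_iff by blast
  then show "cenum (\<lambda>_ :: unit. X) (\<lambda>_ x. x \<in> S)"
    using cenum_enum_set[of "\<lambda>_ :: unit. X" "\<lambda>_ _. X" "\<lambda>_ _. 0" "\<lambda>_ _. e" "\<lambda>_ x. x"]
    by (simp add: computable)
next
  assume "cenum (\<lambda>_ :: unit. X) (\<lambda>_ x. x \<in> S)"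
  from cenum_index[OF this] show "ce_in X S" unfolding ce_in_iff by auto
qed

section \<open>Parameter substitution and the jump\<close>

definition const_index :: "nat \<Rightarrow> nat" where
  "const_index y = ((\<lambda>k. 6 + 4 * pr 1 k) ^^ y) 0"

text \<open>The composition of \<open>e\<close> with the pairing of the constant \<open>y\<close>
  and the identity. The number \<open>5 + 4 * pr 2 3\<close> is an index of the identity, since 2
  and 3 are the indices of the two projections.\<close>

definition smn :: "nat \<Rightarrow> nat \<Rightarrow> nat" where
  "smn e y = 6 + 4 * pr e (5 + 4 * pr (const_index y) (5 + 4 * pr 2 3))"

lemma phi_const_index: "phi X (const_index y) x = Some y"
proof (induction y)
  case (Suc y)
  have "phi X (const_index (Suc y)) x = phi X (6 + 4 * pr 1 (const_index y)) x"
    by (simp add: const_index_def)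
  then show ?case unfolding phi_comp by (simp add: Suc phi_basic[simplified])
qed (simp add: const_index_def phi_basic)

lemma phi_smn [simp]: "phi X (smn e y) x = phi X e (pr y x)"
  unfolding smn_def phi_comp phi_pair by (simp add: phi_const_index phi_basic)

lemma enum_set_smn [simp]: "x \<in> enum_set X (smn e y) \<longleftrightarrow> pr y x \<in> enum_set X e"
  by (simp add: enum_set_def)

lemma cfun_smn [computable]:
  assumes "cfun X e" "cfun X y"
  shows "cfun X (\<lambda>i x. smn (e i x) (y i x))"
  unfolding smn_def const_index_def by (intro computable assms)

text \<open>The program \<open>smn e x\<close> halts on all inputs or on none, according to
  \<open>P i x\<close>. The diagonal question that the jump answers about it is therefore the
  question whether \<open>P i x\<close> holds.\<close>

lemma cdec_jump:
  assumes "cenum X P"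
  shows "cdec (\<lambda>i. jump (X i)) P"
proof -
  have "cenum X (\<lambda>i z. P i (p1 z))"
    by (rule cenum_comp[OF assms]) (intro computable)
  from cenum_index[OF this] obtain e where
    e: "\<And>i x. P i (p1 x) \<longleftrightarrow> x \<in> enum_set (X i) e" by blast
  have "P i x \<longleftrightarrow> smn e x \<in> jump (X i)" for i x
    using e[of i "pr x (smn e x)"] by (simp add: jump_def enum_set_def)
  then show ?thesis by (rule cdec_cong[rotated]) (intro computable)
qed

lemma cenum_reduce:
  assumes "cenum Y P" "cdec X (\<lambda>i x. x \<in> Y i)"
  shows "cenum X P"
proof -
  from cenum_index[OF assms(1)] obtain e where e: "\<And>i x. P i x \<longleftrightarrow> x \<in> enum_set (Y i) e" by blast
  have "cdec X (\<lambda>i z. p2 z \<in> Y i)"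
    by (rule cdec_comp[OF assms(2)]) (intro computable)
  from cenum_enum_set[OF this cfun_const cfun_const cfun_id]
  show ?thesis by (rule cenum_cong) (rule e)
qed

section \<open>Ranks and isomorphisms of trees\<close>

lemma less_osuc_iff: "\<gamma> < osuc \<beta> \<longleftrightarrow> \<gamma> \<le> \<beta>"
  using osuc_le_iff not_less by blast

lemma less_SUP_ordinal_iff:
  fixes g :: "nat \<Rightarrow> countable_ordinal"
  shows "\<gamma> < (SUP n. g n) \<longleftrightarrow> (\<exists>n. \<gamma> < g n)"
  by (subst less_cSUP_iff) (auto intro: countable_bdd_above_ordinal)

lemma le_SUP_ordinal:
  fixes g :: "nat \<Rightarrow> countable_ordinal"
  shows "g n \<le> (SUP n. g n)"
  by (rule cSUP_upper) (auto intro: countable_bdd_above_ordinal)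

text \<open>In contrast to \<open>node_rank\<close> this makes sense for every relation: it fails at
  a node from which an infinite descent starts, so that a rank bound includes
  well-foundedness.\<close>

inductive rank_less :: "'a rel \<Rightarrow> countable_ordinal \<Rightarrow> 'a \<Rightarrow> bool" for r where
  "\<gamma> < \<beta> \<Longrightarrow> (\<And>y. (y, x) \<in> r - Id \<Longrightarrow> rank_less r \<gamma> y) \<Longrightarrow> rank_less r \<beta> x"

lemma rank_less_mono: "rank_less r \<beta> x \<Longrightarrow> \<beta> \<le> \<beta>' \<Longrightarrow> rank_less r \<beta>' x"
  by (erule rank_less.cases) (blast intro: rank_less.intros order.strict_trans2)

lemma rank_less_osuc_iff: "rank_less r (osuc \<beta>) x \<longleftrightarrow> (\<forall>y. (y, x) \<in> r - Id \<longrightarrow> rank_less r \<beta> y)"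
proof
  assume "rank_less r (osuc \<beta>) x"
  then obtain \<gamma> where "\<gamma> < osuc \<beta>" "\<forall>y. (y, x) \<in> r - Id \<longrightarrow> rank_less r \<gamma> y"
    by cases blast
  then show "\<forall>y. (y, x) \<in> r - Id \<longrightarrow> rank_less r \<beta> y"
    unfolding less_osuc_iff by (meson rank_less_mono)
qed (blast intro: rank_less.intros less_osuc)

lemma rank_less_SUP_iff: "rank_less r (SUP n :: nat. g n) x \<longleftrightarrow> (\<exists>n. rank_less r (g n) x)"
proof
  assume "rank_less r (SUP n. g n) x"
  then show "\<exists>n. rank_less r (g n) x"
    by cases (auto simp: less_SUP_ordinal_iff intro: rank_less.intros)
qed (auto intro: rank_less_mono le_SUP_ordinal)

lemma not_rank_less_0: "\<not> rank_less r 0 x"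
  using zero_ordinal_le by (metis rank_less.cases not_less)

lemma rank_less_iff_node_rank:
  fixes r :: "'a :: countable rel"
  assumes "well_founded r"
  shows "rank_less r \<beta> x \<longleftrightarrow> node_rank r x < \<beta>"
proof -
  have "wf (r - Id)"
    using assms unfolding well_founded_def wf_iff_no_infinite_down_chain .
  then show ?thesis
  proof (induction x arbitrary: \<beta> rule: wf_induct_rule)
    case (less x)
    \<comment> \<open>Countability of the type keeps the supremum that defines the rank bounded,
      hence a true supremum.\<close>
    have bdd: "bdd_above ((\<lambda>q. osuc (node_rank r q)) ` {q. (q, x) \<in> r - Id})"
      by (intro countable_bdd_above_ordinal) auto
    show ?case
    proof
      assume "rank_less r \<beta> x"
      then obtain \<gamma> where \<gamma>: "\<gamma> < \<beta>" "\<And>y. (y, x) \<in> r - Id \<Longrightarrow> rank_less r \<gamma> y"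
        by cases blast
      have "node_rank r x \<le> \<gamma>"
      \<comment> \<open>A minimal element has to be separated: its rank is the supremum of the empty
        set, which is 0 by \<open>Sup_empty_ordinal\<close>, while \<open>cSUP_least\<close> asks
        for a nonempty set.\<close>
      proof (cases "{q. (q, x) \<in> r - Id} = {}")
        case True
        then show ?thesis
          unfolding node_rank_eq[OF assms, of x] by (simp only: image_empty Sup_empty_ordinal zero_ordinal_le)
      next
        case False
        then show ?thesis
          unfolding node_rank_eq[OF assms, of x]
          by (rule cSUP_least) (use \<gamma>(2) less.IH in \<open>auto simp: osuc_le_iff\<close>)
      qed
      then show "node_rank r x < \<beta>" using \<gamma>(1) by simp
    next
      assume "node_rank r x < \<beta>"
      moreover have "rank_less r (node_rank r x) y" if "(y, x) \<in> r - Id" for y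
      proof -
        have "osuc (node_rank r y) \<le> node_rank r x"
          unfolding node_rank_eq[OF assms, of x] by (rule cSUP_upper[OF _ bdd]) (use that in blast)
        then show ?thesis using less.IH[OF that] by (simp add: osuc_le_iff)
      qed
      ultimately show "rank_less r \<beta> x" by (rule rank_less.intros)
    qed
  qed
qed

lemma tree_facts:
  assumes "tree F r"
  shows tree_refl: "x \<in> F \<Longrightarrow> (x, x) \<in> r"
    and tree_trans: "(x, y) \<in> r \<Longrightarrow> (y, z) \<in> r \<Longrightarrow> (x, z) \<in> r"
    and tree_antisym: "(x, y) \<in> r \<Longrightarrow> (y, x) \<in> r \<Longrightarrow> x = y"
    and tree_field: "(x, y) \<in> r \<Longrightarrow> x \<in> F \<and> y \<in> F"
    and tree_finite: "x \<in> F \<Longrightarrow> finite {a. (x, a) \<in> r - Id}"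
    and tree_linear: "(x, a) \<in> r \<Longrightarrow> (x, b) \<in> r \<Longrightarrow> (a, b) \<in> r \<or> (b, a) \<in> r"
proof -
  have po: "partial_order_on F r" and
    up: "\<And>p. p \<in> F \<Longrightarrow> finite {a. (p, a) \<in> r - Id} \<and>
      linear_order_on {a. (p, a) \<in> r - Id} (Restr r {a. (p, a) \<in> r - Id})"
    using assms unfolding tree_def Let_def by auto
  show refl: "x \<in> F \<Longrightarrow> (x, x) \<in> r" for x
    using po unfolding partial_order_on_def preorder_on_def refl_on_def by blast
  show "(x, y) \<in> r \<Longrightarrow> (y, z) \<in> r \<Longrightarrow> (x, z) \<in> r"
    using po unfolding partial_order_on_def preorder_on_def trans_def by blast
  show "(x, y) \<in> r \<Longrightarrow> (y, x) \<in> r \<Longrightarrow> x = y"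
    using po unfolding partial_order_on_def antisym_def by blast
  show field: "(x, y) \<in> r \<Longrightarrow> x \<in> F \<and> y \<in> F" for x y
    using po unfolding partial_order_on_def preorder_on_def by blast
  show "x \<in> F \<Longrightarrow> finite {a. (x, a) \<in> r - Id}" using up by blast
  assume a: "(x, a) \<in> r" "(x, b) \<in> r"
  show "(a, b) \<in> r \<or> (b, a) \<in> r"
  proof (cases "a = x \<or> b = x \<or> a = b")
    case True
    then show ?thesis using a refl[of a] field[OF a(1)] by blast
  next
    case False
    then show ?thesis
      using up[of x] field[OF a(1)] a unfolding linear_order_on_def total_on_def by blast
  qed
qed

section \<open>Children of a node\<close>

abbreviation down :: "'a rel \<Rightarrow> 'a \<Rightarrow> 'a set" where
  "down r x \<equiv> {u. (u, x) \<in> r}"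

abbreviation children :: "'a rel \<Rightarrow> 'a \<Rightarrow> 'a set" where
  "children r x \<equiv> {z. (x, z) \<in> direct_succ r}"

lemma children_below: "z \<in> children r x \<Longrightarrow> (z, x) \<in> r - Id"
  unfolding direct_succ_def by blast

text \<open>Only finitely many nodes lie above \<open>y\<close>, so those that are also strictly
  below \<open>x\<close> have a maximal element, and this is a child of \<open>x\<close>.\<close>

lemma child_exists:
  assumes t: "tree F r" and "(y, x) \<in> r - Id"
  shows "\<exists>z\<in>children r x. (y, z) \<in> r"
proof -
  let ?A = "{a. (y, a) \<in> r \<and> (a, x) \<in> r - Id}"
  have y: "y \<in> F" "(y, y) \<in> r" using tree_field[OF t] tree_refl[OF t] assms(2) by blast+
  have "finite (insert y {a. (y, a) \<in> r - Id})" using tree_finite[OF t y(1)] by simp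
  then have "finite ?A" by (rule rev_finite_subset) blast
  have "transp_on ?A (\<lambda>a b. (a, b) \<in> r - Id)"
    by (rule transp_onI) (use tree_trans[OF t] tree_antisym[OF t] in blast)
  moreover have "asymp_on ?A (\<lambda>a b. (a, b) \<in> r - Id)"
    by (rule asymp_onI) (use tree_antisym[OF t] in blast)
  moreover have "?A \<noteq> {}" using y assms(2) by blast
  ultimately have "\<exists>z\<in>?A. \<forall>w\<in>?A. w \<noteq> z \<longrightarrow> (z, w) \<notin> r - Id"
    using \<open>finite ?A\<close> by (intro Finite_Set.bex_max_element)
  then obtain z where z: "z \<in> ?A" "\<forall>w\<in>?A. w \<noteq> z \<longrightarrow> (z, w) \<notin> r - Id" by (rule bexE)
  have "\<not> ((w, x) \<in> r - Id \<and> (z, w) \<in> r - Id)" for w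
    using z tree_trans[OF t, of y z w] by auto
  then have "z \<in> children r x" using z(1) unfolding direct_succ_def by blast
  then show ?thesis using z(1) by blast
qed

lemma child_unique:
  assumes t: "tree F r" and "z \<in> children r x" "z' \<in> children r x" "(y, z) \<in> r" "(y, z') \<in> r"
  shows "z = z'"
  using tree_linear[OF t assms(4,5)] assms(2,3) unfolding direct_succ_def by blast

lemma rank_less_down:
  assumes t: "tree F r" and "rank_less r \<beta> x" "(y, x) \<in> r"
  shows "rank_less r \<beta> y"
proof (cases "y = x")
  case False
  obtain \<gamma> where \<gamma>: "\<gamma> < \<beta>" "\<And>y. (y, x) \<in> r - Id \<Longrightarrow> rank_less r \<gamma> y"
    using assms(2) by cases blast
  have "rank_less r \<gamma> y" by (rule \<gamma>(2)) (use False assms(3) in simp)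
  then show ?thesis by (rule rank_less_mono[OF _ less_imp_le[OF \<gamma>(1)]])
qed (use assms in simp)

text \<open>Each node strictly below \<open>x\<close> lies below a child, and rank bounds pass
  downwards.\<close>

lemma rank_less_osuc_iff_children:
  assumes t: "tree F r"
  shows "rank_less r (osuc \<beta>) x \<longleftrightarrow> (\<forall>z\<in>children r x. rank_less r \<beta> z)"
  unfolding rank_less_osuc_iff
  using child_exists[OF t] children_below[of _ x r] rank_less_down[OF t] by blast

section \<open>Decomposing and gluing isomorphisms of subtrees\<close>

lemma tree_isomorphic_refl: "tree_isomorphic F r F r"
  unfolding tree_isomorphic_def by (rule exI[of _ id]) auto

lemma tree_isomorphic_sym: "tree_isomorphic F r F' r' \<Longrightarrow> tree_isomorphic F' r' F r"
  unfolding tree_isomorphic_def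
proof (elim exE conjE)
  fix f assume f: "bij_betw f F F'" "\<forall>x\<in>F. \<forall>y\<in>F. (x, y) \<in> r \<longleftrightarrow> (f x, f y) \<in> r'"
  let ?g = "inv_into F f"
  have "bij_betw ?g F' F" using f(1) by (rule bij_betw_inv_into)
  moreover have "(x, y) \<in> r' \<longleftrightarrow> (?g x, ?g y) \<in> r" if "x \<in> F'" "y \<in> F'" for x y
    using f(2)[rule_format, of "?g x" "?g y"] that bij_betw_inv_into_right[OF f(1)]
      bij_betwE[OF \<open>bij_betw ?g F' F\<close>] by simp
  ultimately show "\<exists>g. bij_betw g F' F \<and> (\<forall>x\<in>F'. \<forall>y\<in>F'. (x, y) \<in> r' \<longleftrightarrow> (g x, g y) \<in> r)" by blast
qed

lemma tree_isomorphic_trans: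
  "tree_isomorphic F r F' r' \<Longrightarrow> tree_isomorphic F' r' F'' r'' \<Longrightarrow> tree_isomorphic F r F'' r''"
  unfolding tree_isomorphic_def
proof (elim exE conjE)
  fix f g
  assume f: "bij_betw f F F'" "\<forall>x\<in>F. \<forall>y\<in>F. (x, y) \<in> r \<longleftrightarrow> (f x, f y) \<in> r'"
    and g: "bij_betw g F' F''" "\<forall>x\<in>F'. \<forall>y\<in>F'. (x, y) \<in> r' \<longleftrightarrow> (g x, g y) \<in> r''"
  have "bij_betw (g \<circ> f) F F''" by (rule bij_betw_trans[OF f(1) g(1)])
  moreover have "\<forall>x\<in>F. \<forall>y\<in>F. (x, y) \<in> r \<longleftrightarrow> ((g \<circ> f) x, (g \<circ> f) y) \<in> r''"
    using f(2) g(2) bij_betwE[OF f(1)] by simp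
  ultimately show "\<exists>h. bij_betw h F F'' \<and> (\<forall>x\<in>F. \<forall>y\<in>F. (x, y) \<in> r \<longleftrightarrow> (h x, h y) \<in> r'')" by blast
qed

abbreviation sub_iso :: "'a rel \<Rightarrow> 'a \<Rightarrow> 'b rel \<Rightarrow> 'b \<Rightarrow> bool" where
  "sub_iso r x r' y \<equiv> tree_isomorphic (down r x) r (down r' y) r'"

text \<open>An isomorphism preserves the greatest element, so it maps \<open>x\<close> to
  \<open>y\<close>. Being a child is definable from the order, so children go to children, and the
  restriction to the part below a child is again an isomorphism.\<close>

lemma sub_iso_children:
  assumes t: "tree F r" "tree F' r'" and "x \<in> F" "y \<in> F'" and iso: "sub_iso r x r' y"
  shows "\<exists>g. bij_betw g (children r x) (children r' y) \<and> (\<forall>z\<in>children r x. sub_iso r z r' (g z))"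
proof -
  obtain f where f: "bij_betw f (down r x) (down r' y)"
    and ord: "\<And>u v. (u, x) \<in> r \<Longrightarrow> (v, x) \<in> r \<Longrightarrow> (u, v) \<in> r \<longleftrightarrow> (f u, f v) \<in> r'"
    using iso unfolding tree_isomorphic_def by blast
  have img: "(f u, y) \<in> r'" if "(u, x) \<in> r" for u
    using bij_betwE[OF f] that by blast
  have inj: "u = v" if "f u = f v" "(u, x) \<in> r" "(v, x) \<in> r" for u v
    using bij_betw_imp_inj_on[OF f] that unfolding inj_on_def by blast
  have surj: "\<exists>u. (u, x) \<in> r \<and> v = f u" if "(v, y) \<in> r'" for v
    using bij_betw_imp_surj_on[OF f] that by blast
  have xx: "(x, x) \<in> r" and yy: "(y, y) \<in> r'" using tree_refl[OF t(1)] tree_refl[OF t(2)] assms by auto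
  have fx: "f x = y"
    using surj[OF yy] ord[OF _ xx] img[OF xx] tree_antisym[OF t(2)] by blast
  have child: "f z \<in> children r' y \<longleftrightarrow> z \<in> children r x" if z: "(z, x) \<in> r" for z
  proof -
    have "(f z, y) \<in> r' - Id \<longleftrightarrow> (z, x) \<in> r - Id"
      using inj[OF _ z xx] fx img[OF z] z by auto
    moreover have "(\<exists>w. (w, y) \<in> r' - Id \<and> (f z, w) \<in> r' - Id) \<longleftrightarrow> (\<exists>w. (w, x) \<in> r - Id \<and> (z, w) \<in> r - Id)"
    proof
      assume "\<exists>w. (w, y) \<in> r' - Id \<and> (f z, w) \<in> r' - Id"
      then obtain w where w: "(w, y) \<in> r' - Id" "(f z, w) \<in> r' - Id" by blast
      then obtain u where "(u, x) \<in> r" "w = f u" using surj by blast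
      then show "\<exists>w. (w, x) \<in> r - Id \<and> (z, w) \<in> r - Id" using w fx ord[OF z] by blast
    next
      assume "\<exists>w. (w, x) \<in> r - Id \<and> (z, w) \<in> r - Id"
      then obtain w where w: "(w, x) \<in> r - Id" "(z, w) \<in> r - Id" by blast
      then have "(f w, y) \<in> r' - Id" "(f z, f w) \<in> r' - Id"
        using img[of w] inj[of w x] inj[of z w] fx xx z ord[OF z, of w] by auto
      then show "\<exists>w. (w, y) \<in> r' - Id \<and> (f z, w) \<in> r' - Id" by blast
    qed
    ultimately show ?thesis unfolding direct_succ_def by blast
  qed
  have "bij_betw f (children r x) (children r' y)"
  proof (rule bij_betw_subset[OF f])
    show "children r x \<subseteq> down r x" using children_below[of _ x r] by blast
    show "f ` children r x = children r' y"
    proof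
      show "f ` children r x \<subseteq> children r' y" using child children_below[of _ x r] by blast
      show "children r' y \<subseteq> f ` children r x"
      proof
        fix v assume v: "v \<in> children r' y"
        then obtain u where "(u, x) \<in> r" "v = f u" using surj children_below[of v y r'] by blast
        then show "v \<in> f ` children r x" using child[of u] v by blast
      qed
    qed
  qed
  moreover have "sub_iso r z r' (f z)" if "z \<in> children r x" for z
  proof -
    have z: "(z, x) \<in> r" using children_below[OF that] by blast
    have zx: "(u, x) \<in> r" if "(u, z) \<in> r" for u using tree_trans[OF t(1) that z] .
    have "bij_betw f (down r z) (down r' (f z))"
    proof (rule bij_betw_subset[OF f])
      show "down r z \<subseteq> down r x" using zx by blast
      show "f ` down r z = down r' (f z)"
      proof
        show "f ` down r z \<subseteq> down r' (f z)" using ord[OF zx z] by blast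
        show "down r' (f z) \<subseteq> f ` down r z"
        proof
          fix v assume v: "v \<in> down r' (f z)"
          then have "(v, y) \<in> r'" using tree_trans[OF t(2) _ img[OF z]] by blast
          then obtain u where "(u, x) \<in> r" "v = f u" using surj by blast
          then show "v \<in> f ` down r z" using ord[of u z] z v by blast
        qed
      qed
    qed
    then show ?thesis unfolding tree_isomorphic_def using ord zx by blast
  qed
  ultimately show ?thesis by blast
qed

text \<open>The nodes strictly below \<open>x\<close> split into the disjoint subtrees of its
  children; \<open>c u\<close> is the child above \<open>u\<close>. Nodes under different children
  are incomparable on both sides, so the union of the given isomorphisms, extended by mapping
  \<open>x\<close> to \<open>y\<close>, respects the order.\<close>

lemma sub_iso_glue:
  assumes t: "tree F r" "tree F' r'" and "x \<in> F" "y \<in> F'"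
    and g: "bij_betw g (children r x) (children r' y)" "\<forall>z\<in>children r x. sub_iso r z r' (g z)"
  shows "sub_iso r x r' y"
proof -
  have xx: "(x, x) \<in> r" and yy: "(y, y) \<in> r'" using tree_refl[OF t(1)] tree_refl[OF t(2)] assms by auto
  from g(2) have "\<forall>z. \<exists>f. z \<in> children r x \<longrightarrow> bij_betw f (down r z) (down r' (g z)) \<and>
      (\<forall>u\<in>down r z. \<forall>v\<in>down r z. (u, v) \<in> r \<longleftrightarrow> (f u, f v) \<in> r')"
    unfolding tree_isomorphic_def by blast
  then obtain f where f: "\<And>z. z \<in> children r x \<Longrightarrow> bij_betw (f z) (down r z) (down r' (g z))"
      "\<And>z u v. z \<in> children r x \<Longrightarrow> (u, z) \<in> r \<Longrightarrow> (v, z) \<in> r \<Longrightarrow> (u, v) \<in> r \<longleftrightarrow> (f z u, f z v) \<in> r'"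
    by (subst (asm) choice_iff) blast
  have "\<forall>u. \<exists>z. (u, x) \<in> r - Id \<longrightarrow> z \<in> children r x \<and> (u, z) \<in> r"
    using child_exists[OF t(1)] by blast
  then obtain c where c: "\<And>u. (u, x) \<in> r - Id \<Longrightarrow> c u \<in> children r x"
      "\<And>u. (u, x) \<in> r - Id \<Longrightarrow> (u, c u) \<in> r"
    by (subst (asm) choice_iff) blast
  have gchild: "g z \<in> children r' y" if "z \<in> children r x" for z
    using bij_betwE[OF g(1)] that by blast
  define h where "h u = (if u = x then y else f (c u) u)" for u
  have hx: "h x = y" by (simp add: h_def)
  have hbelow: "(h u, g (c u)) \<in> r'" if "(u, x) \<in> r - Id" for u
    using bij_betwE[OF f(1)[OF c(1)[OF that]]] c(2)[OF that] that by (auto simp: h_def)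
  have hy: "(h u, y) \<in> r' - Id" if "(u, x) \<in> r - Id" for u
  proof -
    have gy: "(g (c u), y) \<in> r' - Id" using children_below[OF gchild[OF c(1)[OF that]]] .
    then show ?thesis
      using hbelow[OF that] tree_trans[OF t(2), of "h u" "g (c u)" y]
        tree_antisym[OF t(2), of "g (c u)" y] by blast
  qed
  have ord: "(u, v) \<in> r \<longleftrightarrow> (h u, h v) \<in> r'" if uv: "(u, x) \<in> r" "(v, x) \<in> r" for u v
  proof -
    consider "v = x" | "v \<noteq> x" "u = x" | "(u, x) \<in> r - Id" "(v, x) \<in> r - Id"
      using uv by blast
    then show ?thesis
    proof cases
      case 1
      have "(h u, y) \<in> r'" using hy[of u] uv hx yy by (cases "u = x") auto
      then show ?thesis using 1 uv hx by simp
    next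
      case 2
      then have "(h v, y) \<in> r' - Id" using hy[of v] uv by blast
      then have "(y, h v) \<notin> r'" using tree_antisym[OF t(2)] by blast
      moreover have "(x, v) \<notin> r" using tree_antisym[OF t(1)] uv 2 by blast
      ultimately show ?thesis using 2 hx by simp
    next
      case 3
      show ?thesis
      proof (cases "c u = c v")
        case True
        then show ?thesis using f(2)[OF c(1)[OF 3(1)] c(2)[OF 3(1)], of v] c(2)[OF 3(2)] 3
          by (auto simp: h_def)
      next
        case False
        have "(u, v) \<notin> r"
        proof
          assume "(u, v) \<in> r"
          then have "(u, c v) \<in> r" using tree_trans[OF t(1)] c(2)[OF 3(2)] by blast
          then show False using child_unique[OF t(1) c(1)[OF 3(1)] c(1)[OF 3(2)] c(2)[OF 3(1)]] False by blast
        qed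
        moreover have "(h u, h v) \<notin> r'"
        proof
          assume "(h u, h v) \<in> r'"
          then have "(h u, g (c v)) \<in> r'" using tree_trans[OF t(2)] hbelow[OF 3(2)] by blast
          then have "g (c u) = g (c v)"
            using child_unique[OF t(2) gchild[OF c(1)[OF 3(1)]] gchild[OF c(1)[OF 3(2)]] hbelow[OF 3(1)]] by blast
          then show False
            using bij_betw_imp_inj_on[OF g(1)] c(1)[OF 3(1)] c(1)[OF 3(2)] False unfolding inj_on_def by blast
        qed
        ultimately show ?thesis by blast
      qed
    qed
  qed
  have himg: "(h u, y) \<in> r'" if "(u, x) \<in> r" for u
    using ord[OF that xx] that hx by simp
  have "inj_on h (down r x)"
  proof (rule inj_onI)
    fix u v assume uv: "u \<in> down r x" "v \<in> down r x" "h u = h v"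
    have "(h u, h u) \<in> r'" using tree_refl[OF t(2)] tree_field[OF t(2)] himg[of u] uv by blast
    then have "(u, v) \<in> r" "(v, u) \<in> r" using ord[of u v] ord[of v u] uv by auto
    then show "u = v" by (rule tree_antisym[OF t(1)])
  qed
  moreover have "h ` down r x = down r' y"
  proof
    show "h ` down r x \<subseteq> down r' y" using himg by blast
    show "down r' y \<subseteq> h ` down r x"
    proof
      fix v assume v: "v \<in> down r' y"
      show "v \<in> h ` down r x"
      proof (cases "v = y")
        case True
        then show ?thesis using hx xx by blast
      next
        case False
        then obtain z' where z': "z' \<in> children r' y" "(v, z') \<in> r'"
          using child_exists[OF t(2), of v y] v by blast
        then obtain z where z: "z \<in> children r x" "z' = g z"
          using bij_betw_imp_surj_on[OF g(1)] by blast
        then obtain u where u: "(u, z) \<in> r" "v = f z u"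
          using bij_betw_imp_surj_on[OF f(1)[OF z(1)]] z'(2) by blast
        have zx: "(z, x) \<in> r - Id" using children_below[OF z(1)] .
        have ux: "(u, x) \<in> r - Id"
          using tree_trans[OF t(1) u(1), of x] tree_antisym[OF t(1), of z x] zx u(1) by blast
        then have "c u = z" using child_unique[OF t(1) c(1)[OF ux] z(1) c(2)[OF ux] u(1)] by blast
        then have "v = h u" using u(2) ux by (simp add: h_def)
        then show ?thesis using ux by blast
      qed
    qed
  qed
  ultimately have "bij_betw h (down r x) (down r' y)" unfolding bij_betw_def by blast
  then show ?thesis unfolding tree_isomorphic_def using ord by blast
qed

text \<open>A lower bound on the size: every \<open>m\<close> qualifies if \<open>A\<close> is
  infinite. Such bounds are positive in \<open>A\<close>, so they stay enumerable when membership is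
  enumerable, which an exact count would not.\<close>

definition has_card :: "'a set \<Rightarrow> nat \<Rightarrow> bool" where
  "has_card A m \<longleftrightarrow> (\<exists>S\<subseteq>A. finite S \<and> card S = m)"

lemma has_card_image: "has_card A m \<Longrightarrow> inj_on g A \<Longrightarrow> g ` A \<subseteq> B \<Longrightarrow> has_card B m"
  unfolding has_card_def by (meson card_image finite_imageI image_mono inj_on_subset order_trans)

text \<open>Lower bounds determine the size of a finite set, and satisfying all of them
  characterises the infinite sets, any two of which are in bijection when countable.\<close>

lemma bij_betw_of_has_card:
  fixes A :: "'a :: countable set" and B :: "'b :: countable set"
  assumes "\<And>m. has_card A m \<longleftrightarrow> has_card B m"
  shows "\<exists>g. bij_betw g A B"
proof -
  have le: "finite S \<Longrightarrow> finite T \<Longrightarrow> (\<And>m. has_card S m \<Longrightarrow> has_card T m) \<Longrightarrow> card S \<le> card T"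
    for S :: "'c set" and T :: "'d set"
    unfolding has_card_def by (metis card_mono order_refl)
  have fin: "finite S" if "finite T" "\<And>m. has_card S m \<Longrightarrow> has_card T m"
    for S :: "'c set" and T :: "'d set"
  proof (rule ccontr)
    assume "infinite S"
    then have "has_card S (Suc (card T))"
      unfolding has_card_def using infinite_arbitrarily_large[of S] by blast
    then have "has_card T (Suc (card T))" by (rule that(2))
    then obtain U where "U \<subseteq> T" "card U = Suc (card T)" unfolding has_card_def by blast
    then show False using card_mono[OF that(1), of U] by simp
  qed
  show ?thesis
  proof (cases "finite A")
    case True
    then have "finite B" using fin[of A B] assms by blast
    then have "card A = card B" using le[of A B] le[of B A] True assms by (simp add: le_antisym)
    then show ?thesis using finite_same_card_bij[OF True \<open>finite B\<close>] by blast
  next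
    case False
    then have "infinite B" using fin[of B A] assms by blast
    then show ?thesis
      using bij_betw_trans[OF to_nat_on_infinite[OF countableI_type False]
        bij_betw_from_nat_into[OF countableI_type \<open>infinite B\<close>]] by blast
  qed
qed

text \<open>Bijections between the fibres of each colour combine to one bijection. The colours will
  be isomorphism classes of subtrees.\<close>

lemma colour_matching:
  fixes A :: "'a :: countable set" and B :: "'b :: countable set"
  assumes "\<And>c m. has_card {x\<in>A. a x = c} m \<longleftrightarrow> has_card {y\<in>B. b y = c} m"
  shows "\<exists>g. bij_betw g A B \<and> (\<forall>x\<in>A. b (g x) = a x)"
proof -
  have "\<forall>c. \<exists>h. bij_betw h {x\<in>A. a x = c} {y\<in>B. b y = c}"
    using bij_betw_of_has_card[OF assms] by blast
  then obtain h where h: "\<And>c. bij_betw (h c) {x\<in>A. a x = c} {y\<in>B. b y = c}" by metis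
  let ?g = "\<lambda>x. h (a x) x"
  have g: "?g x \<in> B \<and> b (?g x) = a x" if "x \<in> A" for x
    using bij_betwE[OF h[of "a x"]] that by blast
  have "inj_on ?g A"
  proof (rule inj_onI)
    fix x y assume xy: "x \<in> A" "y \<in> A" "?g x = ?g y"
    then have "a x = a y" using g by metis
    then show "x = y" using xy bij_betw_imp_inj_on[OF h[of "a x"]] unfolding inj_on_def by simp
  qed
  moreover have "?g ` A = B"
  proof
    show "?g ` A \<subseteq> B" using g by blast
    show "B \<subseteq> ?g ` A"
    proof
      fix y assume "y \<in> B"
      then obtain x where "x \<in> A" "a x = b y" "y = h (b y) x"
        using bij_betw_imp_surj_on[OF h[of "b y"]] by blast
      then show "y \<in> ?g ` A" by (intro image_eqI[of _ _ x]) simp_all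
    qed
  qed
  ultimately have "bij_betw ?g A B" unfolding bij_betw_def by blast
  then show ?thesis using g by blast
qed

section \<open>Counting isomorphism types among the children\<close>

definition iso_below :: "countable_ordinal \<Rightarrow> 'a rel \<Rightarrow> 'a \<Rightarrow> 'b rel \<Rightarrow> 'b \<Rightarrow> bool" where
  "iso_below \<beta> r x r' y \<longleftrightarrow> rank_less r \<beta> x \<and> rank_less r' \<beta> y \<and> sub_iso r x r' y"

definition copies :: "countable_ordinal \<Rightarrow> 'a rel \<Rightarrow> 'a \<Rightarrow> 'b rel \<Rightarrow> 'b \<Rightarrow> nat \<Rightarrow> bool" where
  "copies \<beta> r z r' y m \<longleftrightarrow> has_card {w\<in>children r' y. iso_below \<beta> r z r' w} m"

text \<open>Since \<open>sub_iso\<close> is reflexive, the conjunct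
  \<open>iso_below \<beta> r z r z\<close> is a test that the rank of \<open>z\<close> is below
  \<open>\<beta>\<close>; expressing it in this way lets a single relation serve for ranks and
  isomorphisms. The second conjunct compares multiplicities of isomorphism types in one
  direction.\<close>

definition embeds :: "countable_ordinal \<Rightarrow> 'a rel \<Rightarrow> 'a \<Rightarrow> 'b rel \<Rightarrow> 'b \<Rightarrow> bool" where
  "embeds \<beta> r x r' y \<longleftrightarrow> (\<forall>z\<in>children r x. iso_below \<beta> r z r z \<and>
     (\<forall>m. copies \<beta> r z r x m \<longrightarrow> copies \<beta> r z r' y m))"

lemma embeds_of_iso:
  assumes t: "tree F r" "tree F' r'" and xy: "x \<in> F" "y \<in> F'" and "iso_below (osuc \<beta>) r x r' y"
  shows "embeds \<beta> r x r' y"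
  unfolding embeds_def
proof (intro ballI conjI allI impI)
  have rx: "rank_less r \<beta> z" if "z \<in> children r x" for z
    using assms(5) rank_less_osuc_iff_children[OF t(1)] that unfolding iso_below_def by blast
  have ry: "rank_less r' \<beta> z" if "z \<in> children r' y" for z
    using assms(5) rank_less_osuc_iff_children[OF t(2)] that unfolding iso_below_def by blast
  obtain g where g: "bij_betw g (children r x) (children r' y)" "\<And>z. z \<in> children r x \<Longrightarrow> sub_iso r z r' (g z)"
    using sub_iso_children[OF t xy] assms(5) unfolding iso_below_def by blast
  fix z m assume z: "z \<in> children r x"
  show "iso_below \<beta> r z r z" using rx[OF z] tree_isomorphic_refl unfolding iso_below_def by blast
  assume "copies \<beta> r z r x m"
  then show "copies \<beta> r z r' y m"
    unfolding copies_def
  proof (rule has_card_image)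
    show "inj_on g {w \<in> children r x. iso_below \<beta> r z r w}"
      using bij_betw_imp_inj_on[OF g(1)] by (rule inj_on_subset) blast
    show "g ` {w \<in> children r x. iso_below \<beta> r z r w} \<subseteq> {w \<in> children r' y. iso_below \<beta> r z r' w}"
      using bij_betwE[OF g(1)] ry rx g(2) unfolding iso_below_def by (blast intro: tree_isomorphic_trans)
  qed
qed

lemma iso_below_sym: "iso_below \<beta> r x r' y \<Longrightarrow> iso_below \<beta> r' y r x"
  unfolding iso_below_def using tree_isomorphic_sym by blast

text \<open>Turns isomorphism into equality, as \<open>colour_matching\<close> requires.\<close>

definition iso_class :: "'a rel \<Rightarrow> 'a \<Rightarrow> ('a rel \<times> 'a) set" where
  "iso_class r z = {(q, v). sub_iso r z q v}"

lemma iso_class_eq_iff: "iso_class r z = iso_class r' w \<longleftrightarrow> sub_iso r z r' w"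
proof
  assume "iso_class r z = iso_class r' w"
  moreover have "(r', w) \<in> iso_class r' w" by (simp add: iso_class_def tree_isomorphic_refl)
  ultimately have "(r', w) \<in> iso_class r z" by simp
  then show "sub_iso r z r' w" by (simp add: iso_class_def)
next
  assume "sub_iso r z r' w"
  then show "iso_class r z = iso_class r' w"
    unfolding iso_class_def using tree_isomorphic_trans tree_isomorphic_sym by blast
qed

lemma embeds_has_card:
  assumes "embeds \<beta> r x r' y" "\<And>w. w \<in> children r' y \<Longrightarrow> rank_less r' \<beta> w"
    and "has_card {z\<in>children r x. iso_class r z = c} m"
  shows "has_card {z\<in>children r' y. iso_class r' z = c} m"
proof (cases "\<exists>z\<in>children r x. iso_class r z = c")
  case True
  then obtain z where z: "z \<in> children r x" "iso_class r z = c" by blast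
  have rx: "rank_less r \<beta> w" if "w \<in> children r x" for w
    using assms(1) that unfolding embeds_def iso_below_def by blast
  have "{w\<in>children r x. iso_below \<beta> r z r w} = {w\<in>children r x. iso_class r w = c}"
    unfolding iso_below_def z(2)[symmetric] iso_class_eq_iff
    using rx z(1) tree_isomorphic_sym by blast
  moreover have "{w\<in>children r' y. iso_below \<beta> r z r' w} = {w\<in>children r' y. iso_class r' w = c}"
    unfolding iso_below_def z(2)[symmetric] iso_class_eq_iff
    using rx z(1) assms(2) tree_isomorphic_sym by blast
  ultimately show ?thesis
    using assms(1,3) z(1) unfolding embeds_def copies_def by auto
next
  case False
  \<comment> \<open>A colour that no child of \<open>x\<close> has only satisfies the trivial lower
    bound.\<close>
  then have "m = 0" using assms(3) unfolding has_card_def by (metis (mono_tags, lifting) all_not_in_conv card.empty mem_Collect_eq subset_iff)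
  then show ?thesis unfolding has_card_def by (intro exI[of _ "{}"]) simp
qed

text \<open>Two embeddings give the same lower bounds for each isomorphism class among the children,
  so there is a bijection of the children that preserves classes, and the isomorphisms below them
  can be glued. The rank tests inside \<open>embeds\<close> supply the rank bounds.\<close>

lemma iso_below_osuc_iff:
  fixes r r' :: "nat rel"
  assumes t: "tree F r" "tree F' r'" and xy: "x \<in> F" "y \<in> F'"
  shows "iso_below (osuc \<beta>) r x r' y \<longleftrightarrow> embeds \<beta> r x r' y \<and> embeds \<beta> r' y r x"
proof
  assume iso: "iso_below (osuc \<beta>) r x r' y"
  show "embeds \<beta> r x r' y \<and> embeds \<beta> r' y r x"
    using embeds_of_iso[OF t xy iso] embeds_of_iso[OF t(2,1) xy(2,1) iso_below_sym[OF iso]] by (rule conjI)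
next
  assume e: "embeds \<beta> r x r' y \<and> embeds \<beta> r' y r x"
  have rx: "rank_less r \<beta> w" if "w \<in> children r x" for w
    using e that unfolding embeds_def iso_below_def by blast
  have ry: "rank_less r' \<beta> w" if "w \<in> children r' y" for w
    using e that unfolding embeds_def iso_below_def by blast
  have "\<exists>g. bij_betw g (children r x) (children r' y) \<and> (\<forall>z\<in>children r x. iso_class r' (g z) = iso_class r z)"
  proof (rule colour_matching, rule iffI)
    fix c m
    show "has_card {z\<in>children r x. iso_class r z = c} m \<Longrightarrow> has_card {z\<in>children r' y. iso_class r' z = c} m"
      by (rule embeds_has_card[OF conjunct1[OF e] ry])
    show "has_card {z\<in>children r' y. iso_class r' z = c} m \<Longrightarrow> has_card {z\<in>children r x. iso_class r z = c} m"
      by (rule embeds_has_card[OF conjunct2[OF e] rx])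
  qed
  then have "sub_iso r x r' y"
    using sub_iso_glue[OF t xy] unfolding iso_class_eq_iff using tree_isomorphic_sym by blast
  then show "iso_below (osuc \<beta>) r x r' y"
    unfolding iso_below_def rank_less_osuc_iff_children[OF t(1)] rank_less_osuc_iff_children[OF t(2)]
    using rx ry by blast
qed

section \<open>The back-and-forth operator on tree indices\<close>

lemma cenum_lift: "cenum X P \<Longrightarrow> cenum (\<lambda>i. jump (X i)) P"
  by (rule cenum_cdec[OF cdec_jump])

lemma cdec_lift: "cdec X P \<Longrightarrow> cdec (\<lambda>i. jump (X i)) P"
  by (rule cdec_jump[OF cenum_cdec])

definition child_index :: "nat \<Rightarrow> nat \<Rightarrow> nat \<Rightarrow> bool" where
  "child_index s z x \<longleftrightarrow> phi {} (p2 (p2 s)) (pr x z) = Some 1"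

abbreviation quad :: "nat \<Rightarrow> nat \<Rightarrow> nat \<Rightarrow> nat \<Rightarrow> nat" where
  "quad s x t y \<equiv> pr s (pr x (pr t y))"

text \<open>Requiring the listed children to increase makes them distinct, so a lower bound on the
  number of copies becomes a single existential quantifier over sequence numbers.\<close>

definition copies_index :: "nat set \<Rightarrow> nat \<Rightarrow> nat \<Rightarrow> nat \<Rightarrow> nat \<Rightarrow> nat \<Rightarrow> bool" where
  "copies_index Q s z t y m \<longleftrightarrow> (\<exists>w.
     (\<forall>i<m. child_index t (nth_of w i) y \<and> quad s z t (nth_of w i) \<in> Q) \<and>
     (\<forall>i<m. \<forall>j<i. nth_of w j < nth_of w i))"

definition embeds_index :: "nat set \<Rightarrow> nat \<Rightarrow> nat \<Rightarrow> nat \<Rightarrow> nat \<Rightarrow> bool" where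
  "embeds_index Q s x t y \<longleftrightarrow> (\<forall>z. child_index s z x \<longrightarrow> quad s z s z \<in> Q \<and>
     (\<forall>m. copies_index Q s z s x m \<longrightarrow> copies_index Q s z t y m))"

definition back_forth :: "nat set \<Rightarrow> nat set" where
  "back_forth Q = {quad s x t y | s x t y. embeds_index Q s x t y \<and> embeds_index Q t y s x}"

text \<open>Correctness only: how hard \<open>Q\<close> is to compute is tracked separately. Nothing
  is demanded of quadruples that do not consist of tree indices with nodes of these trees, so
  \<open>back_forth\<close> need not recognise valid indices.\<close>

definition decides_iso :: "nat set \<Rightarrow> countable_ordinal \<Rightarrow> bool" where
  "decides_iso Q \<beta> \<longleftrightarrow> (\<forall>s F r t F' r' x y. computable_tree s F r \<longrightarrow> computable_tree t F' r' \<longrightarrow>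
     x \<in> F \<longrightarrow> y \<in> F' \<longrightarrow> (quad s x t y \<in> Q \<longleftrightarrow> iso_below \<beta> r x r' y))"

lemma decides_isoD:
  "decides_iso Q \<beta> \<Longrightarrow> computable_tree s F r \<Longrightarrow> computable_tree t F' r' \<Longrightarrow> x \<in> F \<Longrightarrow> y \<in> F' \<Longrightarrow>
    quad s x t y \<in> Q \<longleftrightarrow> iso_below \<beta> r x r' y"
  unfolding decides_iso_def by blast

lemma decides_iff: "decides e S \<Longrightarrow> phi {} e x = Some 1 \<longleftrightarrow> x \<in> S"
  unfolding decides_def by simp

lemma child_index_iff:
  assumes "computable_tree s F r"
  shows "child_index s z x \<longleftrightarrow> z \<in> children r x"
proof -
  obtain i j k where "s = pr i (pr j k)" "decides k (prod_encode ` direct_succ r)"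
    using assms unfolding computable_tree_def decides_rel_def by blast
  then have "child_index s z x \<longleftrightarrow> pr x z \<in> prod_encode ` direct_succ r"
    unfolding child_index_def by (simp only: decides_iff prod_encode_inverse snd_conv)
  then show ?thesis by (auto simp: inj_image_mem_iff)
qed

lemma sequence_of_card:
  "(\<exists>w. (\<forall>i<m. nth_of w i \<in> A) \<and> (\<forall>i<m. \<forall>j<i. nth_of w j < nth_of w i)) \<longleftrightarrow> has_card A m"
proof
  assume "\<exists>w. (\<forall>i<m. nth_of w i \<in> A) \<and> (\<forall>i<m. \<forall>j<i. nth_of w j < nth_of w i)"
  then obtain w where w: "\<forall>i<m. nth_of w i \<in> A" "\<forall>i<m. \<forall>j<i. nth_of w j < nth_of w i" by blast
  have "inj_on (nth_of w) {..<m}"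
    by (rule inj_onI) (metis w(2) lessThan_iff linorder_neqE_nat less_irrefl)
  then have "card (nth_of w ` {..<m}) = m" by (simp add: card_image)
  moreover have "nth_of w ` {..<m} \<subseteq> A" using w(1) by blast
  ultimately show "has_card A m" unfolding has_card_def by blast
next
  assume "has_card A m"
  then obtain S where S: "S \<subseteq> A" "finite S" "card S = m" unfolding has_card_def by blast
  let ?L = "sorted_list_of_set S"
  have len: "length ?L = m" using S by simp
  obtain w where w: "\<forall>i<m. nth_of w i = ?L ! i" using nth_of_exists by blast
  have "nth_of w i \<in> A" if "i < m" for i
    using w that S len nth_mem[of i ?L] by auto
  moreover have "nth_of w j < nth_of w i" if "i < m" "j < i" for i j
    using w that len strict_sorted_list_of_set[of S] by (simp add: sorted_wrt_iff_nth_less)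
  ultimately show "\<exists>w. (\<forall>i<m. nth_of w i \<in> A) \<and> (\<forall>i<m. \<forall>j<i. nth_of w j < nth_of w i)" by blast
qed

lemma copies_index_iff:
  assumes Q: "decides_iso Q \<beta>" and t: "computable_tree s F r" "computable_tree t F' r'" and "z \<in> F"
  shows "copies_index Q s z t y m \<longleftrightarrow> copies \<beta> r z r' y m"
proof -
  have "w \<in> F'" if "w \<in> children r' y" for w
    using children_below[OF that] tree_field[of F' r' w y] t(2) unfolding computable_tree_def by blast
  then have "child_index t w y \<and> quad s z t w \<in> Q \<longleftrightarrow> w \<in> {w\<in>children r' y. iso_below \<beta> r z r' w}" for w
    using decides_isoD[OF Q t \<open>z \<in> F\<close>, of w] child_index_iff[OF t(2)] by blast
  then show ?thesis unfolding copies_index_def copies_def by (simp only: sequence_of_card)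
qed

lemma embeds_index_iff:
  assumes Q: "decides_iso Q \<beta>" and t: "computable_tree s F r" "computable_tree t F' r'"
  shows "embeds_index Q s x t y \<longleftrightarrow> embeds \<beta> r x r' y"
proof -
  have F: "z \<in> F" if "z \<in> children r x" for z
    using children_below[OF that] tree_field[of F r z x] t(1) unfolding computable_tree_def by blast
  show ?thesis
    unfolding embeds_index_def embeds_def Ball_def
    using child_index_iff[OF t(1)] decides_isoD[OF Q t(1) t(1) F F]
      copies_index_iff[OF Q t(1) t(1) F] copies_index_iff[OF Q t F] by meson
qed

lemma quad_in_back_forth: "quad s x t y \<in> back_forth Q \<longleftrightarrow> embeds_index Q s x t y \<and> embeds_index Q t y s x"
  unfolding back_forth_def by auto

lemma decides_iso_back_forth:
  assumes "decides_iso Q \<beta>"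
  shows "decides_iso (back_forth Q) (osuc \<beta>)"
  unfolding decides_iso_def
proof (intro allI impI)
  fix s F r t F' r' x y
  assume t: "computable_tree s F r" "computable_tree t F' r'" and xy: "x \<in> F" "y \<in> F'"
  have "tree F r" "tree F' r'" using t unfolding computable_tree_def by blast+
  from iso_below_osuc_iff[OF this xy]
  show "quad s x t y \<in> back_forth Q \<longleftrightarrow> iso_below (osuc \<beta>) r x r' y"
    unfolding quad_in_back_forth embeds_index_iff[OF assms t] embeds_index_iff[OF assms t(2,1)] by simp
qed

lemma decides_iso_empty: "decides_iso {} 0"
  unfolding decides_iso_def iso_below_def by (simp add: not_rank_less_0)

text \<open>The count of copies is enumerable in \<open>X\<close> and hence decided by the first
  jump. Failure of \<open>embeds_index\<close> is an existential statement over predicates decided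
  there, so it is enumerable in the first jump and decided by the second.\<close>

lemma cdec_back_forth:
  "cdec (\<lambda>X. jump (jump X)) (\<lambda>X z. p2 z \<in> back_forth (enum_set X (p1 z)))"
proof -
  let ?I = "\<lambda>X :: nat set. X"
  have Q: "cenum ?I (\<lambda>X z. q X z \<in> enum_set X (g X z))" if "cfun ?I g" "cfun ?I q" for q g
  proof (rule cenum_enum_set[where w = "\<lambda>_ _. 0"])
    show "cdec ?I (\<lambda>X z. p2 z \<in> X)" by (rule cdec_oracle) (intro computable)
  qed (intro computable that)+
  have copies: "cenum ?I (\<lambda>X v. copies_index (enum_set X (p1 v)) (p1 (p2 v)) (p1 (p2 (p2 v)))
      (p1 (p2 (p2 (p2 v)))) (p1 (p2 (p2 (p2 (p2 v))))) (p2 (p2 (p2 (p2 (p2 v))))))"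
    unfolding copies_index_def child_index_def by (intro computable Q)
  have copies': "cdec jump (\<lambda>X v. copies_index (enum_set X (g X v)) (s X v) (z X v) (t X v) (y X v) (m X v))"
    if f: "cfun jump g" "cfun jump s" "cfun jump z" "cfun jump t" "cfun jump y" "cfun jump m" for g s z t y m
    using cdec_comp[OF cdec_jump[OF copies] cfun_pr[OF f(1) cfun_pr[OF f(2) cfun_pr[OF f(3)
      cfun_pr[OF f(4) cfun_pr[OF f(5,6)]]]]]] by simp
  have Q': "cdec jump (\<lambda>X z. q X z \<in> enum_set X (g X z))" if f: "cfun jump g" "cfun jump q" for q g
  proof -
    have "cenum ?I (\<lambda>X z. p2 z \<in> enum_set X (p1 z))" by (intro Q computable)
    from cdec_comp[OF cdec_jump[OF this] cfun_pr[OF f]] show ?thesis by simp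
  qed
  have child: "cdec jump (\<lambda>X v. child_index (s X v) (z X v) (x X v))"
    if f: "cfun jump s" "cfun jump z" "cfun jump x" for s z x
  proof -
    have "cenum ?I (\<lambda>X v. child_index (p1 v) (p1 (p2 v)) (p2 (p2 v)))"
      unfolding child_index_def by (intro computable)
    from cdec_comp[OF cdec_jump[OF this] cfun_pr[OF f(1) cfun_pr[OF f(2,3)]]] show ?thesis by simp
  qed
  have "cenum jump (\<lambda>X v. \<not> embeds_index (enum_set X (p1 v)) (p1 (p2 v)) (p1 (p2 (p2 v)))
      (p1 (p2 (p2 (p2 v)))) (p2 (p2 (p2 (p2 v)))))"
    unfolding embeds_index_def not_all not_imp de_Morgan_conj
    by (intro computable Q' child copies' cenum_cdec[OF child] cenum_cdec[OF cdec_not] cenum_cdec[OF copies'])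
  from cdec_not[OF cdec_jump[OF this]]
  have "cdec (\<lambda>X. jump (jump X)) (\<lambda>X v. embeds_index (enum_set X (p1 v)) (p1 (p2 v)) (p1 (p2 (p2 v)))
      (p1 (p2 (p2 (p2 v)))) (p2 (p2 (p2 (p2 v)))))" by simp
  \<comment> \<open>The second conjunct is the same predicate after exchanging the two pairs of tree
    index and node.\<close>
  from cdec_conj[OF this cdec_comp[OF this, of "\<lambda>X v. pr (p1 v) (pr (p1 (p2 (p2 (p2 v)))) (pr (p2 (p2 (p2 (p2 v)))) (pr (p1 (p2 v)) (p1 (p2 (p2 v))))))"]]
  have "cdec (\<lambda>X. jump (jump X)) (\<lambda>X v. quad (p1 (p2 v)) (p1 (p2 (p2 v)))
      (p1 (p2 (p2 (p2 v)))) (p2 (p2 (p2 (p2 v)))) \<in> back_forth (enum_set X (p1 v)))"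
    unfolding quad_in_back_forth by (simp add: computable)
  then show ?thesis by simp
qed

text \<open>One \<open>b\<close> works for all oracles and all indices, so the passage from a rank
  to its successor is the computable map \<open>smn b\<close> on indices and can be iterated by a
  program.\<close>

lemma back_forth_index: "\<exists>b. \<forall>X g. enum_set (jump (jump X)) (smn b g) = back_forth (enum_set X g)"
proof -
  from cenum_index[OF cenum_cdec[OF cdec_back_forth]] obtain b where
    "\<And>X z. p2 z \<in> back_forth (enum_set X (p1 z)) \<longleftrightarrow> z \<in> enum_set (jump (jump X)) b" by blast
  from this[of "pr _ _"] show ?thesis by (intro exI[of _ b]) auto
qed

section \<open>Complexity of being an index of a tree\<close>

lemma tree_iff:
  "tree F r \<longleftrightarrow> r \<subseteq> F \<times> F \<and> (\<forall>x\<in>F. (x, x) \<in> r) \<and>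
    (\<forall>x y z. (x, y) \<in> r \<longrightarrow> (y, z) \<in> r \<longrightarrow> (x, z) \<in> r) \<and>
    (\<forall>x y. (x, y) \<in> r \<longrightarrow> (y, x) \<in> r \<longrightarrow> x = y) \<and>
    (\<exists>g\<in>F. \<forall>x\<in>F. (x, g) \<in> r) \<and>
    (\<forall>p\<in>F. finite {a. (p, a) \<in> r}) \<and>
    (\<forall>p a b. (p, a) \<in> r \<longrightarrow> (p, b) \<in> r \<longrightarrow> (a, b) \<in> r \<or> (b, a) \<in> r)" (is "_ \<longleftrightarrow> ?R")
proof
  assume t: "tree F r"
  have "\<exists>g\<in>F. \<forall>x\<in>F. (x, g) \<in> r" using t unfolding tree_def by blast
  moreover have "finite {a. (p, a) \<in> r}" if "p \<in> F" for p
    by (rule finite_subset[of _ "insert p {a. (p, a) \<in> r - Id}"]) (use tree_finite[OF t that] in auto)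
  moreover have "r \<subseteq> F \<times> F" using tree_field[OF t] by auto
  ultimately show ?R
    using tree_refl[OF t] tree_trans[OF t] tree_antisym[OF t] tree_linear[OF t]
    by (intro conjI ballI allI impI) simp_all
next
  assume R: ?R
  note R1 = R[THEN conjunct2] and R2 = R[THEN conjunct2, THEN conjunct2]
  note R3 = R2[THEN conjunct2] and R4 = R2[THEN conjunct2, THEN conjunct2]
  note R5 = R4[THEN conjunct2]
  have sub: "r \<subseteq> F \<times> F" using R by (rule conjunct1)
  have refl: "(x, x) \<in> r" if "x \<in> F" for x
    using R1[THEN conjunct1] that by blast
  have tr: "(x, z) \<in> r" if "(x, y) \<in> r" "(y, z) \<in> r" for x y z
    using R2[THEN conjunct1] that by blast
  have anti: "x = y" if "(x, y) \<in> r" "(y, x) \<in> r" for x y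
    using R3[THEN conjunct1] that by blast
  have top: "\<exists>g\<in>F. \<forall>x\<in>F. (x, g) \<in> r" using R4 by (rule conjunct1)
  have fin: "finite {a. (p, a) \<in> r}" if "p \<in> F" for p
    using R5[THEN conjunct1] that by blast
  have lin: "(a, b) \<in> r \<or> (b, a) \<in> r" if "(p, a) \<in> r" "(p, b) \<in> r" for p a b
    using R5[THEN conjunct2] that by blast
  have "finite {a. (p, a) \<in> r - Id} \<and> linear_order_on {a. (p, a) \<in> r - Id} (Restr r {a. (p, a) \<in> r - Id})"
    if "p \<in> F" for p
  proof
    show "finite {a. (p, a) \<in> r - Id}"
      by (rule rev_finite_subset[OF fin[OF that]]) blast
    show "linear_order_on {a. (p, a) \<in> r - Id} (Restr r {a. (p, a) \<in> r - Id})"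
      unfolding linear_order_on_def partial_order_on_def preorder_on_def
    proof (intro conjI)
      show "refl_on {a. (p, a) \<in> r - Id} (Restr r {a. (p, a) \<in> r - Id})"
        using refl sub by (auto simp: refl_on_def)
      show "trans (Restr r {a. (p, a) \<in> r - Id})" by (rule transI) (auto intro: tr)
      show "antisym (Restr r {a. (p, a) \<in> r - Id})" by (rule antisymI) (auto intro: anti)
      show "total_on {a. (p, a) \<in> r - Id} (Restr r {a. (p, a) \<in> r - Id})"
        by (rule total_onI) (use lin in auto)
    qed blast
  qed
  moreover have "partial_order_on F r"
    unfolding partial_order_on_def preorder_on_def
    by (intro conjI sub transI antisymI refl_onI refl) (auto intro: tr anti)
  ultimately show "tree F r"
    unfolding tree_def Let_def using top by blast
qed

definition total_index :: "nat \<Rightarrow> bool" where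
  "total_index e \<longleftrightarrow> (\<forall>x. phi {} e x = Some 0 \<or> phi {} e x = Some 1)"

text \<open>For indices of total characteristic functions this says that the set, the relation and the
  successor relation fail to be those of a computable tree.  Negated atoms are written as
  \<open>= Some 0\<close> rather than \<open>\<noteq> Some 1\<close>, to keep the quantifier complexity low.\<close>

definition defect :: "nat \<Rightarrow> nat \<Rightarrow> nat \<Rightarrow> bool" where
  "defect i j k \<longleftrightarrow>
     (\<exists>x y. phi {} j (pr x y) = Some 1 \<and> (phi {} i x = Some 0 \<or> phi {} i y = Some 0)) \<or>
     (\<exists>x. phi {} i x = Some 1 \<and> phi {} j (pr x x) = Some 0) \<or>
     (\<exists>x y z. phi {} j (pr x y) = Some 1 \<and> phi {} j (pr y z) = Some 1 \<and> phi {} j (pr x z) = Some 0) \<or>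
     (\<exists>x y. phi {} j (pr x y) = Some 1 \<and> phi {} j (pr y x) = Some 1 \<and> x \<noteq> y) \<or>
     \<not> (\<exists>g. \<not> (phi {} i g = Some 0 \<or> (\<exists>x. phi {} i x = Some 1 \<and> phi {} j (pr x g) = Some 0))) \<or>
     (\<exists>p. phi {} i p = Some 1 \<and> \<not> (\<exists>n. \<not> (\<exists>a. n < a \<and> phi {} j (pr p a) = Some 1))) \<or>
     (\<exists>p a b. phi {} j (pr p a) = Some 1 \<and> phi {} j (pr p b) = Some 1 \<and>
        phi {} j (pr a b) = Some 0 \<and> phi {} j (pr b a) = Some 0) \<or>
     (\<exists>x y. phi {} k (pr x y) = Some 1 \<and> (phi {} j (pr y x) = Some 0 \<or> x = y \<or>
        (\<exists>z. phi {} j (pr z x) = Some 1 \<and> z \<noteq> x \<and> phi {} j (pr y z) = Some 1 \<and> y \<noteq> z))) \<or>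
     (\<exists>x y. phi {} k (pr x y) = Some 0 \<and> phi {} j (pr y x) = Some 1 \<and> x \<noteq> y \<and>
        \<not> (\<exists>z. phi {} j (pr z x) = Some 1 \<and> z \<noteq> x \<and> phi {} j (pr y z) = Some 1 \<and> y \<noteq> z))"

lemma total_indexD: "total_index e \<Longrightarrow> phi {} e x = Some 0 \<longleftrightarrow> phi {} e x \<noteq> Some 1"
  unfolding total_index_def by (metis option.inject zero_neq_one)

lemma defect_iff:
  assumes tot: "total_index i" "total_index j" "total_index k"
  defines "F \<equiv> {x. phi {} i x = Some 1}" and "r \<equiv> {(x, y). phi {} j (pr x y) = Some 1}"
    and "E \<equiv> {(x, y). phi {} k (pr x y) = Some 1}"
  shows "defect i j k \<longleftrightarrow> \<not> (tree F r \<and> E = direct_succ r)"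
proof -
  have F: "phi {} i x = Some 1 \<longleftrightarrow> x \<in> F" "phi {} i x = Some 0 \<longleftrightarrow> x \<notin> F" for x
    using total_indexD[OF tot(1)] unfolding F_def by auto
  have r: "phi {} j (pr x y) = Some 1 \<longleftrightarrow> (x, y) \<in> r" "phi {} j (pr x y) = Some 0 \<longleftrightarrow> (x, y) \<notin> r" for x y
    using total_indexD[OF tot(2)] unfolding r_def by auto
  have E: "phi {} k (pr x y) = Some 1 \<longleftrightarrow> (x, y) \<in> E" "phi {} k (pr x y) = Some 0 \<longleftrightarrow> (x, y) \<notin> E" for x y
    using total_indexD[OF tot(3)] unfolding E_def by auto
  have E_iff: "E = direct_succ r \<longleftrightarrow> (\<forall>x y. (x, y) \<in> E \<longleftrightarrow> (y, x) \<in> r \<and> x \<noteq> y \<and>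
      \<not> (\<exists>z. (z, x) \<in> r \<and> z \<noteq> x \<and> (y, z) \<in> r \<and> y \<noteq> z))"
    unfolding direct_succ_def set_eq_iff by auto
  have fin: "finite {a. (p, a) \<in> r} \<longleftrightarrow> (\<exists>n. \<not> (\<exists>a. n < a \<and> (p, a) \<in> r))" for p
  proof -
    have "infinite {a. (p, a) \<in> r} \<longleftrightarrow> (\<forall>n. \<exists>a. n < a \<and> (p, a) \<in> r)"
      by (simp add: infinite_nat_iff_unbounded)
    then show ?thesis by blast
  qed
  have sub: "(\<exists>x y. (x, y) \<in> r \<and> (x \<notin> F \<or> y \<notin> F)) \<longleftrightarrow> \<not> r \<subseteq> F \<times> F"
    by auto
  have eqs:
    "(\<exists>x. x \<in> F \<and> (x, x) \<notin> r) \<longleftrightarrow> \<not> (\<forall>x\<in>F. (x, x) \<in> r)"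
    "(\<exists>x y z. (x, y) \<in> r \<and> (y, z) \<in> r \<and> (x, z) \<notin> r) \<longleftrightarrow>
      \<not> (\<forall>x y z. (x, y) \<in> r \<longrightarrow> (y, z) \<in> r \<longrightarrow> (x, z) \<in> r)"
    "(\<exists>x y. (x, y) \<in> r \<and> (y, x) \<in> r \<and> x \<noteq> y) \<longleftrightarrow> \<not> (\<forall>x y. (x, y) \<in> r \<longrightarrow> (y, x) \<in> r \<longrightarrow> x = y)"
    "(\<exists>g. \<not> (g \<notin> F \<or> (\<exists>x. x \<in> F \<and> (x, g) \<notin> r))) \<longleftrightarrow> (\<exists>g\<in>F. \<forall>x\<in>F. (x, g) \<in> r)"
    "(\<exists>p. p \<in> F \<and> \<not> (\<exists>n. \<not> (\<exists>a. n < a \<and> (p, a) \<in> r))) \<longleftrightarrow>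
      \<not> (\<forall>p\<in>F. \<exists>n. \<not> (\<exists>a. n < a \<and> (p, a) \<in> r))"
    "(\<exists>p a b. (p, a) \<in> r \<and> (p, b) \<in> r \<and> (a, b) \<notin> r \<and> (b, a) \<notin> r) \<longleftrightarrow>
      \<not> (\<forall>p a b. (p, a) \<in> r \<longrightarrow> (p, b) \<in> r \<longrightarrow> (a, b) \<in> r \<or> (b, a) \<in> r)"
    by blast+
  define B where "B x y \<longleftrightarrow> (\<exists>z. (z, x) \<in> r \<and> z \<noteq> x \<and> (y, z) \<in> r \<and> y \<noteq> z)" for x y
  have E_eq: "(\<exists>x y. (x, y) \<in> E \<and> ((y, x) \<notin> r \<or> x = y \<or> B x y)) \<or>
      (\<exists>x y. (x, y) \<notin> E \<and> (y, x) \<in> r \<and> x \<noteq> y \<and> \<not> B x y) \<longleftrightarrow>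
      \<not> (\<forall>x y. (x, y) \<in> E \<longleftrightarrow> (y, x) \<in> r \<and> x \<noteq> y \<and> \<not> B x y)"
    by blast
  show ?thesis
    unfolding defect_def tree_iff E_iff fin F r E sub eqs E_eq[unfolded B_def]
    by (simp only: de_Morgan_conj disj_assoc)
qed

lemma computable_tree_iff:
  "(\<exists>F r. computable_tree s F r) \<longleftrightarrow> total_index (p1 s) \<and> total_index (p1 (p2 s)) \<and> total_index (p2 (p2 s)) \<and>
     \<not> defect (p1 s) (p1 (p2 s)) (p2 (p2 s))" (is "?L \<longleftrightarrow> ?R")
proof
  have total: "total_index e" if "decides e S" for e S
    using that unfolding decides_def total_index_def by auto
  assume ?L
  then obtain F r i j k where *: "tree F r" "s = pr i (pr j k)" "decides i F" "decides_rel j r"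
      "decides_rel k (direct_succ r)"
    unfolding computable_tree_def by blast
  have rel: "{(x, y). phi {} e (pr x y) = Some 1} = q" if "decides_rel e q" for e q
    using decides_iff[OF that[unfolded decides_rel_def]] by (auto simp: inj_image_mem_iff)
  have tot: "total_index i" "total_index j" "total_index k"
    using * total unfolding decides_rel_def by auto
  have "{x. phi {} i x = Some 1} = F" using decides_iff[OF *(3)] by blast
  then have "\<not> defect i j k" unfolding defect_iff[OF tot] rel[OF *(4)] rel[OF *(5)] using *(1) by simp
  then show ?R using tot *(2) by simp
next
  have decides: "decides e S" if "total_index e" "\<And>x. phi {} e x = Some 1 \<longleftrightarrow> x \<in> S" for e S
    unfolding decides_def using that(2) total_indexD[OF that(1)] by simp
  assume R: ?R
  let ?F = "{x. phi {} (p1 s) x = Some 1}" and ?r = "{(x, y). phi {} (p1 (p2 s)) (pr x y) = Some 1}"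
    and ?E = "{(x, y). phi {} (p2 (p2 s)) (pr x y) = Some 1}"
  have img: "x \<in> prod_encode ` {(x, y). phi {} e (pr x y) = Some 1} \<longleftrightarrow> phi {} e x = Some 1" for e x
  proof -
    have "x \<in> prod_encode ` q \<longleftrightarrow> prod_decode x \<in> q" for q
      by (metis image_iff prod_decode_inverse prod_encode_inverse)
    then show ?thesis by (simp add: case_prod_beta)
  qed
  have "tree ?F ?r" "?E = direct_succ ?r" using R defect_iff by blast+
  moreover have "decides (p1 s) ?F" "decides_rel (p1 (p2 s)) ?r" "decides_rel (p2 (p2 s)) ?E"
    unfolding decides_rel_def using R by (auto intro!: decides simp: img[simplified])
  ultimately have "computable_tree s ?F ?r"
    unfolding computable_tree_def by (metis pr_p1_p2)
  then show ?L by blast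
qed

text \<open>Failure of totality is already enumerable in one jump. The most expensive clause is that
  some node has infinitely many nodes above it: an existential, a universal and an existential
  quantifier, enumerable in the second jump.\<close>

lemma cenum_not_computable_tree:
  "cenum (\<lambda>_ :: unit. jump (jump {})) (\<lambda>_ s. \<not> (\<exists>F r. computable_tree s F r))"
proof -
  let ?X = "\<lambda>_ :: unit. {} :: nat set"
  let ?J = "\<lambda>_ :: unit. jump {}"
  let ?JJ = "\<lambda>_ :: unit. jump (jump {})"
  have not: "cenum ?J (\<lambda>i x. \<not> P i x)" if "cenum ?X P" for P :: "unit \<Rightarrow> nat \<Rightarrow> bool"
    by (intro cenum_cdec cdec_not cdec_jump that)
  have not': "cenum ?JJ (\<lambda>i x. \<not> P i x)" if "cenum ?J P" for P :: "unit \<Rightarrow> nat \<Rightarrow> bool"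
    by (intro cenum_cdec cdec_not cdec_jump that)
  have neq: "cenum Y (\<lambda>i x. f i x \<noteq> g i x)" if "cfun Y f" "cfun Y g" for Y f g
    by (intro cenum_cdec cdec_not cdec_eq that)
  have "cenum ?J (\<lambda>_ x. \<not> total_index x)"
    unfolding total_index_def not_all by (rule cenum_ex, rule not) (intro computable)
  then have tot: "cenum ?JJ (\<lambda>i x. \<not> total_index (f i x))" if "cfun ?JJ f" for f
    by (rule cenum_comp[OF cenum_lift that])
  have defect: "cenum ?JJ (\<lambda>_ s. defect (p1 s) (p1 (p2 s)) (p2 (p2 s)))"
    unfolding defect_def
    \<comment> \<open>Disjuncts that negate nothing but equations are enumerable without an oracle
      and are lifted through both jumps. In the others the outer negated existential is paid for by
      the second jump, \<open>not'\<close>, and an inner one by the first,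
      \<open>not\<close>.\<close>
    by (intro cenum_disj) (rule cenum_lift, rule cenum_lift, (intro computable neq; fail) |
      intro computable not' not neq)+
  show ?thesis
    unfolding computable_tree_iff de_Morgan_conj not_not
    by (intro cenum_disj tot defect computable)
qed

section \<open>Ordinal notations and limit stages\<close>

lemma inO_power: "inO (2 ^ a) \<Longrightarrow> a \<noteq> 0 \<Longrightarrow> inO a"
  by (erule inO.cases) (auto simp: index_simps)

lemma inO_limD:
  assumes "inO (3 * 5 ^ e)"
  shows "\<exists>f. \<forall>n. phi {} e n = Some (f n) \<and> inO (f n) \<and> lessO (f n) (f (Suc n))"
  using assms by (rule inO.cases) (auto simp: index_simps)

lemma lessO_inO: "lessO a b \<Longrightarrow> inO a \<and> inO b"
  by (induction rule: inO_lessO.inducts(2)[where ?P1.0 = "\<lambda>_. True"]) (auto intro: inO_lessO.intros)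

lemma lessO_trans: "lessO b c \<Longrightarrow> lessO a b \<Longrightarrow> lessO a c"
  by (induction rule: inO_lessO.inducts(2)[where ?P1.0 = "\<lambda>_. True"]) (auto intro: inO_lessO.intros)

lemma lessO_fundamental:
  assumes "inO (3 * 5 ^ e)" "phi {} e n = Some a"
  shows "lessO a (3 * 5 ^ e)"
proof -
  obtain f where f: "\<And>n. phi {} e n = Some (f n)" "\<And>n. lessO (f n) (f (Suc n))"
    using inO_limD[OF assms(1)] by blast
  show ?thesis by (rule lessO_lim[OF assms(1) f(1)[of "Suc n"]]) (use f[of n] assms(2) in simp)
qed

lemma lessO_power_le: "lessO x y \<Longrightarrow> 2 ^ x = y \<or> lessO (2 ^ x) y"
proof (induction rule: inO_lessO.inducts(2)[where ?P1.0 = "\<lambda>_. True"])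
  case (lessO_suc_trans a b)
  then show ?case using inO_lessO.lessO_suc inO_lessO.lessO_suc_trans by blast
next
  case (lessO_lim e n a b)
  then show ?case using lessO_fundamental inO_lessO.lessO_lim by blast
qed auto

lemma lessO_power_lim: "lessO x (3 * 5 ^ e) \<Longrightarrow> lessO (2 ^ x) (3 * 5 ^ e)"
  using lessO_power_le[of x "3 * 5 ^ e"] two_power_neq_lim by blast

lemma one_lessO: "inO a \<Longrightarrow> a = 1 \<or> lessO 1 a"
proof (induction rule: inO_lessO.inducts(1)[where ?P2.0 = "\<lambda>_ _. True"])
  case (inO_suc a)
  then show ?case using lessO_suc lessO_suc_trans by blast
next
  case (inO_lim e f)
  have "inO (3 * 5 ^ e)" using inO_lim inO_lessO.inO_lim by blast
  then show ?case using inO_lim lessO_fundamental lessO_trans by (metis (no_types))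
qed auto

lemma lessO_denotes:
  "lessO a b \<Longrightarrow> denotes a \<alpha> \<Longrightarrow> denotes b \<beta> \<Longrightarrow> \<alpha> < \<beta>"
proof (induction arbitrary: \<beta> rule: inO_lessO.inducts(2)[where ?P1.0 = "\<lambda>_. True"])
  case (lessO_suc a)
  have "denotes (2 ^ a) (osuc \<alpha>)" using lessO_suc by (intro denotes_suc)
  then show ?case using denotes_unique lessO_suc less_osuc by metis
next
  case (lessO_suc_trans a b)
  obtain \<gamma> where \<gamma>: "denotes a \<gamma>" using denotes_ex lessO_suc_trans by blast
  then have "\<beta> = osuc \<gamma>" using denotes_unique[OF denotes_suc] lessO_suc_trans by blast
  moreover have "\<alpha> < \<gamma>" using lessO_suc_trans \<gamma> by blast
  ultimately show ?case using less_osuc less_trans by blast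
next
  case (lessO_lim e n a b)
  from lessO_lim.prems(2) obtain f g where fg: "\<And>n. phi {} e n = Some (f n)" "\<And>n. denotes (f n) (g n)"
      "\<beta> = (SUP n. g n)"
    by cases (auto simp: index_simps)
  have "\<alpha> < g n" using lessO_lim fg(1,2)[of n] by simp
  then show ?case unfolding fg(3) less_SUP_ordinal_iff by blast
qed auto

lemma denotes_below: "denotes a \<gamma> \<Longrightarrow> \<beta> \<le> \<gamma> \<Longrightarrow> \<exists>b. denotes b \<beta>"
proof (induction rule: denotes.induct)
  case denotes_zero
  then show ?case using denotes.denotes_zero zero_ordinal_le by (metis order.antisym)
next
  case (denotes_suc a \<gamma>)
  then show ?case
    using denotes.denotes_suc by (metis less_osuc_iff order.order_iff_strict)
next
  case (denotes_lim e f g)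
  show ?case
  proof (cases "\<beta> = (SUP n. g n)")
    case True
    then show ?thesis using denotes.denotes_lim denotes_lim by metis
  next
    case False
    then have "\<beta> < (SUP n. g n)" using denotes_lim.prems by simp
    then show ?thesis using denotes_lim.IH less_SUP_ordinal_iff less_imp_le by metis
  qed
qed

text \<open>A fundamental sequence extending the notation \<open>b\<close> by \<open>x\<close>, where \<open>x = Suc m\<close> codes the element
  \<open>m\<close> of a well-order, \<open>x = 0\<close> a point above all elements, and \<open>l\<close> will be an index of the program
  that computes this very sequence.\<close>

primrec notation_seq :: "(nat \<Rightarrow> nat \<Rightarrow> bool) \<Rightarrow> nat \<Rightarrow> nat \<Rightarrow> nat \<Rightarrow> nat \<Rightarrow> nat" where
  "notation_seq R l b x 0 = b"
| "notation_seq R l b x (Suc m) = (if R m x then 3 * 5 ^ smn l (pr l (pr (notation_seq R l b x m) (Suc m)))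
     else 2 ^ notation_seq R l b x m)"

lemma notation_seq_eq: "notation_seq R l b x n =
   rec_nat b (\<lambda>m s. if R m x then 3 * 5 ^ smn l (pr l (pr s (Suc m))) else 2 ^ s) n"
  by (induction n) simp_all

text \<open>The predecessors \<open>m\<close> of \<open>x\<close> are visited in the order of the
  natural numbers, and each is stacked on the notation reached so far; other numbers contribute a
  successor step. The sequence thus increases along one branch even if the ordinals
  \<open>\<rho> (Suc m)\<close> do not, at the price of overshooting, which is why only a lower
  bound on the denoted ordinal results.\<close>

lemma notation_above:
  fixes \<rho> :: "nat \<Rightarrow> countable_ordinal"
  assumes R: "cdec (\<lambda>_ :: unit. {}) (\<lambda>_ z. R (p1 z) (p2 z))"
    and decr: "\<And>m x. R m x \<Longrightarrow> \<rho> (Suc m) < \<rho> x"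
    and sup: "\<And>\<delta> x. \<delta> < \<rho> x \<Longrightarrow> \<exists>m. R m x \<and> \<delta> \<le> \<rho> (Suc m)"
  shows "\<exists>a \<gamma>. denotes a \<gamma> \<and> \<rho> x \<le> \<gamma>"
proof -
  have R': "cdec (\<lambda>_ :: unit. {}) (\<lambda>_ z. R (f z) (g z))"
    if "cfun (\<lambda>_ :: unit. {}) (\<lambda>_. f)" "cfun (\<lambda>_ :: unit. {}) (\<lambda>_. g)" for f g
    using cdec_comp[OF R cfun_pr[OF that]] by simp
  have "cfun (\<lambda>_ :: unit. {}) (\<lambda>_ z. notation_seq R (p1 (p1 z)) (p1 (p2 (p1 z))) (p2 (p2 (p1 z))) (p2 z))"
    unfolding notation_seq_eq by (intro computable R')
  then obtain c where "\<And>z. run {} c z =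
      Some (notation_seq R (p1 (p1 z)) (p1 (p2 (p1 z))) (p2 (p2 (p1 z))) (p2 z))"
    unfolding cfun_def by blast
  moreover obtain l where "code_of l = c" using surj_code_of by (metis surjD)
  ultimately have l: "phi {} (smn l (pr l (pr b x))) n = Some (notation_seq R l b x n)" for b x n
    by (simp add: phi_def[of "{}" l])
  define h :: "nat \<Rightarrow> nat \<Rightarrow> nat" where "h b x = 3 * 5 ^ smn l (pr l (pr b x))" for b x
  let ?s = "notation_seq R l"
  have s_Suc: "?s b x (Suc m) = (if R m x then h (?s b x m) (Suc m) else 2 ^ ?s b x m)" for b x m
    by (simp add: h_def)
  \<comment> \<open>The claim must hold for every \<open>b\<close>, because a predecessor is
    appended to whatever notation has been reached when its turn comes.\<close>
  have "\<forall>b. inO b \<longrightarrow> inO (h b x) \<and> lessO b (h b x) \<and> (\<forall>\<gamma>. denotes (h b x) \<gamma> \<longrightarrow> \<rho> x \<le> \<gamma>)" for x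
  proof (induction "\<rho> x" arbitrary: x rule: less_induct)
    case less
    have IH: "inO (h b (Suc m))" "lessO b (h b (Suc m))" "denotes (h b (Suc m)) \<gamma> \<Longrightarrow> \<rho> (Suc m) \<le> \<gamma>"
      if "R m x" "inO b" for m b \<gamma>
      using less[OF decr[OF that(1)]] that(2) by blast+
    show ?case
    proof (intro allI impI)
      fix b assume b: "inO b"
      have step: "inO (?s b x (Suc n)) \<and> lessO (?s b x n) (?s b x (Suc n))" if "inO (?s b x n)" for n
        unfolding s_Suc using IH(1,2)[OF _ that] inO_suc[OF that] lessO_suc[OF that] by simp
      have inO_s: "inO (?s b x n)" for n
        by (induction n) (use b step in simp_all)
      have lim: "inO (h b x)"
        unfolding h_def by (rule inO_lim[OF l]) (use inO_s step in blast)+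
      have below: "lessO (?s b x n) (h b x)" for n
        using lessO_fundamental[OF _ l] lim unfolding h_def by blast
      \<comment> \<open>If the limit denoted less than \<open>\<rho> x\<close>, some predecessor
        \<open>m\<close> would satisfy \<open>\<gamma> \<le> \<rho> (Suc m)\<close>. The entry at
        position \<open>Suc m\<close> already denotes at least \<open>\<rho> (Suc m)\<close>, yet it
        lies strictly below the limit.\<close>
      have "\<rho> x \<le> \<gamma>" if \<gamma>: "denotes (h b x) \<gamma>" for \<gamma>
      proof (rule ccontr)
        assume "\<not> \<rho> x \<le> \<gamma>"
        then obtain m where m: "R m x" "\<gamma> \<le> \<rho> (Suc m)" using sup[of \<gamma> x] unfolding not_le by blast
        have s: "?s b x (Suc m) = h (?s b x m) (Suc m)" unfolding s_Suc using m(1) by simp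
        obtain \<delta> where \<delta>: "denotes (h (?s b x m) (Suc m)) \<delta>"
          using denotes_ex[OF IH(1)[OF m(1) inO_s[of m]]] by blast
        have "\<delta> < \<gamma>" using lessO_denotes[OF below[of "Suc m"] _ \<gamma>] \<delta> s by simp
        moreover have "\<rho> (Suc m) \<le> \<delta>" by (rule IH(3)[OF m(1) inO_s \<delta>])
        ultimately show False using m(2) by simp
      qed
      moreover have "lessO b (h b x)" using below[of 0] by simp
      ultimately show "inO (h b x) \<and> lessO b (h b x) \<and> (\<forall>\<gamma>. denotes (h b x) \<gamma> \<longrightarrow> \<rho> x \<le> \<gamma>)"
        using lim by blast
    qed
  qed
  then show ?thesis using denotes_ex inO_zero by metis
qed

text \<open>A notation for some larger ordinal is enough: by \<open>denotes_below\<close> every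
  ordinal up to it has a notation as well.\<close>

lemma computable_ordinal_denotes:
  assumes "computable_ordinal \<alpha>"
  shows "\<exists>a \<gamma>. denotes a \<gamma> \<and> \<alpha> \<le> \<gamma>"
proof -
  let ?S = "{(\<beta>, \<gamma>). \<beta> \<le> \<gamma> \<and> \<gamma> < \<alpha>}"
  obtain r e where e: "decides_rel e r" and "r =o ?S"
    using assms unfolding computable_ordinal_def by blast
  then obtain f where f: "iso r ?S f" unfolding ordIso_def by blast
  have Field: "Field ?S = {..<\<alpha>}" unfolding Field_def by auto
  have bij: "bij_betw f (Field r) {..<\<alpha>}" and
    ord: "\<And>a b. a \<in> Field r \<Longrightarrow> b \<in> Field r \<Longrightarrow> (a, b) \<in> r \<longleftrightarrow> f a \<le> f b"
    using f bij_betwE[of f "Field r" "{..<\<alpha>}"] unfolding iso_iff2 Field by auto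
  \<comment> \<open>The point 0 sits on top with value \<open>\<alpha>\<close>, and
    \<open>Suc m\<close> stands for the element \<open>m\<close>. Numbers outside the field get the
    value 0, below which there is nothing to approximate, and \<open>R m x\<close> never relates
    them to a predecessor.\<close>
  define \<rho> where "\<rho> x = (if x = 0 then \<alpha> else if x - 1 \<in> Field r then f (x - 1) else 0)" for x
  define R where "R m x \<longleftrightarrow> (if x = 0 then (m, m) \<in> r else (m, x - 1) \<in> r \<and> m \<noteq> x - 1)" for m x
  have "\<exists>a \<gamma>. denotes a \<gamma> \<and> \<rho> 0 \<le> \<gamma>"
  proof (rule notation_above)
    have "cdec (\<lambda>_ :: unit. {}) (\<lambda>_ z. z \<in> prod_encode ` r)"
      using e unfolding decides_rel_def decides_def phi_def cdec_def cfun_def by blast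
    then have r: "cdec (\<lambda>_ :: unit. {}) (\<lambda>_ z. (g z, h z) \<in> r)"
      if "cfun (\<lambda>_ :: unit. {}) (\<lambda>_. g)" "cfun (\<lambda>_ :: unit. {}) (\<lambda>_. h)" for g h
      by (rule cdec_cong[OF cdec_comp[OF _ cfun_pr[OF that]]]) (auto simp: inj_image_mem_iff)
    have "cdec (\<lambda>_ :: unit. {}) (\<lambda>_ z. p2 z = 0 \<and> (p1 z, p1 z) \<in> r \<or>
        p2 z \<noteq> 0 \<and> (p1 z, p2 z - 1) \<in> r \<and> p1 z \<noteq> p2 z - 1)"
      by (intro computable r)
    then show "cdec (\<lambda>_ :: unit. {}) (\<lambda>_ z. R (p1 z) (p2 z))"
      by (rule cdec_cong) (simp add: R_def)
  next
    fix m x assume R: "R m x"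
    show "\<rho> (Suc m) < \<rho> x"
    proof (cases "x = 0")
      case True
      then have "m \<in> Field r" using R unfolding R_def Field_def by auto
      then show ?thesis using bij_betwE[OF bij] True by (auto simp: \<rho>_def)
    next
      case False
      then have "(m, x - 1) \<in> r" "m \<noteq> x - 1" using R unfolding R_def by auto
      moreover from this have mx: "m \<in> Field r" "x - 1 \<in> Field r" unfolding Field_def by auto
      ultimately have "f m \<le> f (x - 1)" "f m \<noteq> f (x - 1)"
        using ord bij_betw_imp_inj_on[OF bij] by (auto simp: inj_on_def)
      then show ?thesis using mx False by (simp add: \<rho>_def)
    qed
  next
    fix \<delta> x assume \<delta>: "\<delta> < \<rho> x"
    have le: "\<rho> x \<le> \<alpha>"
      using bij_betwE[OF bij] zero_ordinal_le by (auto simp: \<rho>_def intro: less_imp_le)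
    then obtain m where m: "m \<in> Field r" "f m = \<delta>"
      using \<delta> bij_betw_imp_surj_on[OF bij] by (metis imageE lessThan_iff order.strict_trans2)
    have "R m x"
    proof (cases "x = 0")
      case True
      then show ?thesis using ord[OF m(1) m(1)] by (simp add: R_def)
    next
      case False
      have "x - 1 \<in> Field r"
        using \<delta> False zero_ordinal_le[of \<delta>] by (auto simp: \<rho>_def split: if_splits)
      then show ?thesis using \<delta> m ord[OF m(1), of "x - 1"] False by (auto simp: R_def \<rho>_def)
    qed
    then show "\<exists>m. R m x \<and> \<delta> \<le> \<rho> (Suc m)" using m by (auto simp: \<rho>_def)
  qed
  then show ?thesis by (simp add: \<rho>_def)
qed

text \<open>\<open>stage b g0 l u w g\<close>: relative to \<open>H(w)\<close>, the index \<open>g\<close> enumerates the isomorphic pairs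
  of nodes of rank below \<open>|u|\<close>; each successor costs two jumps.\<close>

inductive stage :: "nat \<Rightarrow> nat \<Rightarrow> nat \<Rightarrow> nat \<Rightarrow> nat \<Rightarrow> nat \<Rightarrow> bool" for b g0 l where
  stage_zero: "stage b g0 l 1 1 g0"
| stage_lim: "stage b g0 l (3 * 5 ^ e) (3 * 5 ^ e) (smn l (pr l e))"
| stage_suc: "stage b g0 l u w g \<Longrightarrow> stage b g0 l (2 ^ u) (2 ^ 2 ^ w) (smn b g)"

lemma stage_pos: "stage b g0 l u w g \<Longrightarrow> u \<noteq> 0 \<and> w \<noteq> 0"
  by (induction rule: stage.induct) auto

text \<open>Unfolds the induction into an iteration count \<open>n\<close> above 1 or above a limit
  notation. Iteration is covered by the closure rules, so being a stage is an enumerable relation,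
  also with the index \<open>l\<close> as a variable.\<close>

lemma stage_iff: "stage b g0 l u w g \<longleftrightarrow> (\<exists>n.
    u = ((\<lambda>u. 2 ^ u) ^^ n) 1 \<and> w = ((\<lambda>w. 2 ^ 2 ^ w) ^^ n) 1 \<and> g = ((\<lambda>g. smn b g) ^^ n) g0 \<or>
    (\<exists>e. u = ((\<lambda>u. 2 ^ u) ^^ n) (3 * 5 ^ e) \<and> w = ((\<lambda>w. 2 ^ 2 ^ w) ^^ n) (3 * 5 ^ e) \<and>
      g = ((\<lambda>g. smn b g) ^^ n) (smn l (pr l e))))" (is "_ \<longleftrightarrow> (\<exists>n. ?A n u w g \<or> ?B n u w g)")
proof
  assume "stage b g0 l u w g"
  then show "\<exists>n. ?A n u w g \<or> ?B n u w g"
  proof (induction rule: stage.induct)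
    case stage_zero
    show ?case by (rule exI[of _ 0]) simp
  next
    case (stage_lim e)
    show ?case by (rule exI[of _ 0]) auto
  next
    case (stage_suc u w g)
    then obtain n where "?A n u w g \<or> ?B n u w g" by blast
    then show ?case by (intro exI[of _ "Suc n"]) auto
  qed
next
  have "stage b g0 l (((\<lambda>u. 2 ^ u) ^^ n) 1) (((\<lambda>w. 2 ^ 2 ^ w) ^^ n) 1) (((\<lambda>g. smn b g) ^^ n) g0)" for n
    by (induction n) (auto intro: stage.intros simp del: One_nat_def)
  moreover have "stage b g0 l (((\<lambda>u. 2 ^ u) ^^ n) (3 * 5 ^ e)) (((\<lambda>w. 2 ^ 2 ^ w) ^^ n) (3 * 5 ^ e))
      (((\<lambda>g. smn b g) ^^ n) (smn l (pr l e)))" for n e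
    by (induction n) (auto intro: stage.intros)
  moreover assume "\<exists>n. ?A n u w g \<or> ?B n u w g"
  ultimately show "stage b g0 l u w g" by (elim exE disjE conjE) simp_all
qed

section \<open>Enumerating isomorphic pairs along a notation\<close>

definition column :: "nat \<Rightarrow> nat set \<Rightarrow> nat set" where
  "column w X = {x. pr w x \<in> X}"

text \<open>An index \<open>l\<close> passed to itself as an argument can refer to the stages it belongs to; this
  replaces the recursion theorem.\<close>

lemma limit_index: "\<exists>l. \<forall>X e p. p \<in> enum_set X (smn l (pr l e)) \<longleftrightarrow>
    (\<exists>n v w g. phi {} e n = Some v \<and> stage b g0 l v w g \<and> p \<in> enum_set (column w X) g)"
proof -
  let ?X = "\<lambda>X :: nat set. X"
  have col: "cdec ?X (\<lambda>X z. p2 z \<in> column (p1 z) X)"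
    unfolding column_def mem_Collect_eq by (rule cdec_oracle) (intro computable)
  have "cenum ?X (\<lambda>X z. \<exists>n v w g. phi {} (p2 (p1 z)) n = Some v \<and> stage b g0 (p1 (p1 z)) v w g \<and>
      p2 z \<in> enum_set (column w X) g)"
    unfolding stage_iff by (intro computable cenum_enum_set[OF col])
  from cenum_index[OF this] obtain l where
    "\<And>X z. z \<in> enum_set X l \<longleftrightarrow> (\<exists>n v w g. phi {} (p2 (p1 z)) n = Some v \<and> stage b g0 (p1 (p1 z)) v w g \<and>
      p2 z \<in> enum_set (column w X) g)" by blast
  then show ?thesis by (intro exI[of _ l]) simp
qed

lemma stage_exists: "inO u \<Longrightarrow> \<exists>w g. stage b g0 l u w g"
  by (induction rule: inO_lessO.inducts(1)[where ?P2.0 = "\<lambda>_ _. True"]) (blast intro: stage.intros)+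

text \<open>Although the oracle notation \<open>w\<close> takes two steps for each step of
  \<open>u\<close>, it cannot reach a limit notation above \<open>u\<close>, because limits are
  closed under successor. Thus \<open>H(w)\<close> is a column of the set at the limit.\<close>

lemma stage_lessO: "stage b g0 l u w g \<Longrightarrow> lessO u (3 * 5 ^ e) \<Longrightarrow> lessO w (3 * 5 ^ e)"
proof (induction rule: stage.induct)
  case (stage_suc u w g)
  have "inO u" using lessO_inO[OF stage_suc.prems] inO_power stage_pos[OF stage_suc.hyps] by blast
  then have "lessO u (3 * 5 ^ e)" using lessO_trans[OF stage_suc.prems lessO_suc] by blast
  then show ?case using stage_suc.IH lessO_power_lim by blast
qed

lemma H_set_power: "H_set (2 ^ w) X \<Longrightarrow> w \<noteq> 0 \<Longrightarrow> \<exists>Y. H_set w Y \<and> X = jump Y"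
  by (erule H_set.cases) (auto simp: index_simps)

lemma column_H_set:
  assumes "H_set (3 * 5 ^ e) X" "lessO w (3 * 5 ^ e)"
  shows "H_set w (column w X)"
  using assms(1)
proof cases
  case (H_lim e' Y)
  then have e': "e' = e" by simp
  have "column w X = Y w" unfolding column_def H_lim(2) e' using assms(2) by auto
  then show ?thesis using H_lim(4) assms(2) e' by simp
qed (auto simp: index_simps)

text \<open>The two nodes may meet their rank bounds at different members of the sequence;
  monotonicity allows the larger one for both.\<close>

lemma iso_below_SUP_iff:
  fixes g :: "nat \<Rightarrow> countable_ordinal"
  shows "iso_below (SUP n. g n) r x r' y \<longleftrightarrow> (\<exists>n. iso_below (g n) r x r' y)"
proof
  assume "iso_below (SUP n. g n) r x r' y"
  then obtain m n where "rank_less r (g m) x" "rank_less r' (g n) y" "sub_iso r x r' y"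
    unfolding iso_below_def rank_less_SUP_iff by blast
  then show "\<exists>n. iso_below (g n) r x r' y"
    unfolding iso_below_def using rank_less_mono linear[of "g m" "g n"] by metis
qed (auto simp: iso_below_def rank_less_SUP_iff)

text \<open>Induction on the notation \<open>u\<close>, with \<open>b\<close>, \<open>g0\<close> and
  \<open>l\<close> fixed for all of them. At a limit the enumerated set is the union over the
  fundamental sequence, each member being correct relative to its own column of the oracle.\<close>

lemma iso_below_indices:
  "\<exists>b g0 l. \<forall>u \<beta> w g X. denotes u \<beta> \<longrightarrow> stage b g0 l u w g \<longrightarrow> H_set w X \<longrightarrow> decides_iso (enum_set X g) \<beta>"
proof -
  obtain b where b: "\<And>X g. enum_set (jump (jump X)) (smn b g) = back_forth (enum_set X g)"
    using back_forth_index by blast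
  \<comment> \<open>The base index enumerates the empty set, since no node has rank below 0.\<close>
  have "cenum (\<lambda>X :: nat set. X) (\<lambda>_ _. False)" by (intro computable)
  from cenum_index[OF this] obtain g0 where g0: "\<And>X. enum_set X g0 = {}" by blast
  obtain l where l: "\<And>X e p. p \<in> enum_set X (smn l (pr l e)) \<longleftrightarrow>
      (\<exists>n v w g. phi {} e n = Some v \<and> stage b g0 l v w g \<and> p \<in> enum_set (column w X) g)"
    using limit_index by blast
  have "stage b g0 l u w g \<Longrightarrow> H_set w X \<Longrightarrow> decides_iso (enum_set X g) \<beta>" if "denotes u \<beta>" for u \<beta> w g X
    using that
  proof (induction arbitrary: w g X rule: denotes.induct)
    case denotes_zero
    from denotes_zero.prems(1) have "g = g0"
      by cases (auto simp: index_simps dest: stage_pos)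
    then show ?case using g0 decides_iso_empty by simp
  next
    case (denotes_suc a \<beta>)
    from denotes_suc.prems(1) denotes_pos[OF denotes_suc.hyps] obtain w' g' where
      *: "stage b g0 l a w' g'" "w = 2 ^ 2 ^ w'" "g = smn b g'"
      by cases (auto simp: index_simps)
    obtain Y where Y: "H_set (2 ^ w') Y" "X = jump Y"
      using H_set_power[of "2 ^ w'" X] denotes_suc.prems(2) *(2) by auto
    obtain Z where "H_set w' Z" "Y = jump Z"
      using H_set_power[OF Y(1)] stage_pos[OF *(1)] by auto
    then show ?case using decides_iso_back_forth[OF denotes_suc.IH[OF *(1)]] Y(2) *(3) b by simp
  next
    case (denotes_lim e f \<beta>)
    from denotes_lim.prems(1) have "w = 3 * 5 ^ e \<and> g = smn l (pr l e)"
      by cases (auto simp: index_simps)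
    then have wg: "w = 3 * 5 ^ e" "g = smn l (pr l e)" by simp_all
    have iff: "p \<in> enum_set X g \<longleftrightarrow> (\<exists>n v h. stage b g0 l (f n) v h \<and> p \<in> enum_set (column v X) h)" for p
      unfolding wg(2) l using denotes_lim.hyps(2) by auto
    have H: "H_set v (column v X)" if "stage b g0 l (f n) v h" for n v h
      using column_H_set stage_lessO[OF that] lessO_fundamental[OF denotes_lim.hyps(1,2)]
        denotes_lim.prems(2) wg(1) by blast
    have ex: "\<exists>v h. stage b g0 l (f n) v h" for n
      using stage_exists denotes_inO[OF denotes_lim.hyps(3)] by blast
    show ?case
      unfolding decides_iso_def
    proof (intro allI impI)
      fix s F r t F' r' x y
      assume t: "computable_tree s F r" "computable_tree t F' r'" "x \<in> F" "y \<in> F'"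
      have "quad s x t y \<in> enum_set (column v X) h \<longleftrightarrow> iso_below (\<beta> n) r x r' y"
        if "stage b g0 l (f n) v h" for n v h
        using decides_isoD[OF denotes_lim.IH[OF that H[OF that]] t] .
      then show "quad s x t y \<in> enum_set X g \<longleftrightarrow> iso_below (SUP n. \<beta> n) r x r' y"
        unfolding iff iso_below_SUP_iff using ex by blast
    qed
  qed
  then show ?thesis by blast
qed

section \<open>Assembling the hierarchy level\<close>

lemma oplus_0: "\<beta> +\<^sub>o 0 = \<beta>"
  by (simp add: oplus_def)

lemma oplus_Suc: "\<beta> +\<^sub>o Suc n = osuc (\<beta> +\<^sub>o n)"
  by (simp add: oplus_def)

lemma le_oplus: "\<beta> \<le> \<beta> +\<^sub>o n"
  by (induction n) (auto simp: oplus_0 oplus_Suc intro: order_trans less_imp_le less_osuc)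

lemma osuc_inject: "osuc \<beta> = osuc \<gamma> \<longleftrightarrow> \<beta> = \<gamma>"
  by (metis less_osuc less_osuc_iff order.antisym)

lemma osuc_neq_0: "osuc \<beta> \<noteq> 0"
  by (metis less_osuc not_less zero_ordinal_le)

text \<open>Cancelling successors shows that \<open>l\<close> is finite, and the only finite ordinal
  that is not a successor is 0. This settles which clause of \<open>Sigma0\<close> applies.\<close>

lemma oplus_eq_finite:
  "\<not> successor_ordinal l \<Longrightarrow> l +\<^sub>o m = 0 +\<^sub>o n \<Longrightarrow> l = 0"
proof (induction m arbitrary: n)
  case 0
  then show ?case by (cases n) (auto simp: oplus_0 oplus_Suc successor_ordinal_def)
next
  case (Suc m)
  then show ?case by (cases n) (auto simp: oplus_0 oplus_Suc osuc_neq_0 osuc_inject)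
qed

lemma denotes_oplus: "denotes a \<beta> \<Longrightarrow> denotes (((\<lambda>a. 2 ^ a) ^^ n) a) (\<beta> +\<^sub>o n)"
  by (induction n) (auto simp: oplus_0 oplus_Suc intro: denotes_suc)

lemma H_set_oplus: "H_set a X \<Longrightarrow> H_set (((\<lambda>a. 2 ^ a) ^^ n) a) ((jump ^^ n) X)"
  by (induction n) (auto intro: H_suc)

lemma Pi0I:
  assumes "denotes a \<gamma>" "H_set a X" "ce_in X (- S)"
    and "if finite_ordinal \<beta> then \<beta> = osuc \<gamma> else \<beta> = \<gamma>"
  shows "S \<in> Pi0 \<beta>"
  using assms unfolding Pi0_def Sigma0_def by blast

lemma cdec_funpow_jump: "cdec (\<lambda>_ :: unit. X) P \<Longrightarrow> cdec (\<lambda>_ :: unit. (jump ^^ n) X) P"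
  by (induction n) (auto intro: cdec_lift)

lemma rank_less_no_descent:
  "rank_less r \<beta> x \<Longrightarrow> c 0 = x \<Longrightarrow> \<exists>i :: nat. (c (Suc i), c i) \<notin> r - Id"
proof (induction arbitrary: c rule: rank_less.induct)
  case (1 \<gamma> \<beta> x)
  show ?case
  proof (cases "(c (Suc 0), c 0) \<in> r - Id")
    case True
    then have "(c (Suc 0), x) \<in> r - Id" using "1.prems" by simp
    from "1.IH"[OF this, of "\<lambda>i. c (Suc i)"] show ?thesis by auto
  qed blast
qed

text \<open>The rank of a tree is one more than the rank of its root, so the bound
  \<open>\<alpha>\<close> for the tree is the strict bound \<open>\<alpha>\<close> for the root.
  Well-foundedness comes for free on the left side.\<close>

lemma rank_less_root_iff:
  fixes r :: "'a :: countable rel"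
  assumes t: "tree F r" and x: "x \<in> F" "\<And>y. y \<in> F \<Longrightarrow> (y, x) \<in> r"
  shows "rank_less r \<alpha> x \<longleftrightarrow> well_founded r \<and> tree_rank F r \<le> \<alpha>"
proof
  assume rank: "rank_less r \<alpha> x"
  have F: "rank_less r \<alpha> p" if "p \<in> F" for p
    by (rule rank_less_down[OF t rank x(2)[OF that]])
  have wf: "well_founded r"
    unfolding well_founded_def
  proof
    assume "\<exists>c. \<forall>i. (c (Suc i), c i) \<in> r - Id"
    then obtain c where c: "\<And>i. (c (Suc i), c i) \<in> r - Id" by blast
    then have "c 0 \<in> F" using tree_field[OF t, of "c (Suc 0)" "c 0"] by blast
    from rank_less_no_descent[OF F[OF this], of c] show False using c by blast
  qed
  moreover have "tree_rank F r \<le> \<alpha>"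
    unfolding tree_rank_def
    by (rule cSUP_least) (use F x(1) in \<open>auto simp: osuc_le_iff rank_less_iff_node_rank[OF wf]\<close>)
  ultimately show "well_founded r \<and> tree_rank F r \<le> \<alpha>" by blast
next
  assume wf: "well_founded r \<and> tree_rank F r \<le> \<alpha>"
  have "osuc (node_rank r x) \<le> tree_rank F r"
    unfolding tree_rank_def by (rule cSUP_upper[OF x(1)]) (auto intro: countable_bdd_above_ordinal)
  then have "osuc (node_rank r x) \<le> \<alpha>" using wf by auto
  then show "rank_less r \<alpha> x"
    using wf by (simp add: osuc_le_iff rank_less_iff_node_rank)
qed

section \<open>From roots to the isomorphism problem\<close>

definition root_index :: "nat \<Rightarrow> nat \<Rightarrow> bool" where
  "root_index s x \<longleftrightarrow> phi {} (p1 s) x = Some 1 \<and>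
     \<not> (\<exists>y. phi {} (p1 s) y = Some 1 \<and> phi {} (p1 (p2 s)) (pr y x) = Some 0)"

lemma root_index_iff:
  assumes "computable_tree s F r"
  shows "root_index s x \<longleftrightarrow> x \<in> F \<and> (\<forall>y\<in>F. (y, x) \<in> r)"
proof -
  obtain i j k where *: "s = pr i (pr j k)" "decides i F" "decides_rel j r"
    using assms unfolding computable_tree_def by blast
  have "phi {} j (pr y x) = Some 0 \<longleftrightarrow> (y, x) \<notin> r" for y
    using *(3) unfolding decides_rel_def decides_def by (auto simp: inj_image_mem_iff)
  then show ?thesis
    unfolding root_index_def *(1) using decides_iff[OF *(2)] by auto
qed

lemma iso_below_root_iff:
  fixes r r' :: "nat rel"
  assumes t: "tree F r" "tree F' r'"
    and x: "x \<in> F" "\<forall>z\<in>F. (z, x) \<in> r" and y: "y \<in> F'" "\<forall>z\<in>F'. (z, y) \<in> r'"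
  shows "iso_below \<alpha> r x r' y \<longleftrightarrow> well_founded r \<and> tree_rank F r \<le> \<alpha> \<and>
    well_founded r' \<and> tree_rank F' r' \<le> \<alpha> \<and> tree_isomorphic F r F' r'"
proof -
  have "down r x = F" "down r' y = F'" using x y tree_field[OF t(1)] tree_field[OF t(2)] by blast+
  then show ?thesis
    unfolding iso_below_def using rank_less_root_iff[OF t(1) x(1)] rank_less_root_iff[OF t(2) y(1)] x(2) y(2)
    by auto
qed

text \<open>A tree has exactly one root, so the condition on the roots can be stated with an
  existential quantifier, which is what an enumeration of the complement needs.\<close>

lemma not_in_tree_iso_problem_iff:
  assumes Q: "decides_iso Q \<alpha>"
  shows "p \<notin> tree_iso_problem \<alpha> \<longleftrightarrow>
    \<not> (\<exists>F r. computable_tree (p1 p) F r) \<or> \<not> (\<exists>F r. computable_tree (p2 p) F r) \<or>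
    (\<exists>x y. root_index (p1 p) x \<and> root_index (p2 p) y \<and> quad (p1 p) x (p2 p) y \<notin> Q)"
    (is "_ \<longleftrightarrow> ?A \<or> ?B \<or> ?C")
proof
  assume np: "p \<notin> tree_iso_problem \<alpha>"
  show "?A \<or> ?B \<or> ?C"
  proof (rule ccontr)
    assume no: "\<not> (?A \<or> ?B \<or> ?C)"
    then obtain F r F' r' where t: "computable_tree (p1 p) F r" "computable_tree (p2 p) F' r'" by blast
    then have trees: "tree F r" "tree F' r'" unfolding computable_tree_def by blast+
    obtain x where x: "x \<in> F" "\<forall>z\<in>F. (z, x) \<in> r" using trees(1) unfolding tree_def by blast
    obtain y where y: "y \<in> F'" "\<forall>z\<in>F'. (z, y) \<in> r'" using trees(2) unfolding tree_def by blast
    have "quad (p1 p) x (p2 p) y \<in> Q"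
      using no x y root_index_iff[OF t(1)] root_index_iff[OF t(2)] by blast
    then have "iso_below \<alpha> r x r' y" using decides_isoD[OF Q t x(1) y(1)] by blast
    then have "pr (p1 p) (p2 p) \<in> tree_iso_problem \<alpha>"
      unfolding iso_below_root_iff[OF trees x y] tree_iso_problem_def using t by blast
    then show False using np by simp
  qed
next
  assume ABC: "?A \<or> ?B \<or> ?C"
  show "p \<notin> tree_iso_problem \<alpha>"
  proof
    assume "p \<in> tree_iso_problem \<alpha>"
    then obtain F r F' r' where t: "computable_tree (p1 p) F r" "computable_tree (p2 p) F' r'"
      and iso: "well_founded r \<and> tree_rank F r \<le> \<alpha> \<and> well_founded r' \<and> tree_rank F' r' \<le> \<alpha> \<and>
        tree_isomorphic F r F' r'"
      unfolding tree_iso_problem_def by auto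
    then have trees: "tree F r" "tree F' r'" unfolding computable_tree_def by blast+
    obtain x y where xy: "root_index (p1 p) x" "root_index (p2 p) y" "quad (p1 p) x (p2 p) y \<notin> Q"
      using ABC t by blast
    then have x: "x \<in> F" "\<forall>z\<in>F. (z, x) \<in> r" and y: "y \<in> F'" "\<forall>z\<in>F'. (z, y) \<in> r'"
      using root_index_iff[OF t(1)] root_index_iff[OF t(2)] by blast+
    show False
      using xy(3) iso iso_below_root_iff[OF trees x y] decides_isoD[OF Q t x(1) y(1)] by blast
  qed
qed

text \<open>A tree has a root, and its rank is not below 0; with the empty set as \<open>Q\<close>
  this is the third alternative of the characterisation.\<close>

lemma tree_iso_problem_0: "tree_iso_problem 0 = {}"
proof -
  have "p \<notin> tree_iso_problem 0" for p
    unfolding not_in_tree_iso_problem_iff[OF decides_iso_empty]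
  proof (rule ccontr)
    assume no: "\<not> (\<not> (\<exists>F r. computable_tree (p1 p) F r) \<or> \<not> (\<exists>F r. computable_tree (p2 p) F r) \<or>
      (\<exists>x y. root_index (p1 p) x \<and> root_index (p2 p) y \<and> quad (p1 p) x (p2 p) y \<notin> {}))"
    have "\<exists>x. root_index s x" if "computable_tree s F r" for s F r
      unfolding root_index_iff[OF that] using that unfolding computable_tree_def tree_def by blast
    then show False using no by blast
  qed
  then show ?thesis by blast
qed

text \<open>The oracle must decide \<open>Q\<close>, not merely enumerate it, since the complement
  asks for quadruples outside \<open>Q\<close>. The double jump recognises numbers that are not tree
  indices.\<close>

lemma ce_in_complement:
  assumes Q: "decides_iso Q \<alpha>" and Q': "cdec (\<lambda>_ :: unit. Z) (\<lambda>_ q. q \<in> Q)"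
    and Z: "cdec (\<lambda>_ :: unit. Z) (\<lambda>_ x. x \<in> jump (jump {}))"
  shows "ce_in Z (- tree_iso_problem \<alpha>)"
proof -
  let ?Z = "\<lambda>_ :: unit. Z"
  have ct: "cenum ?Z (\<lambda>_ p. \<not> (\<exists>F r. computable_tree (f p) F r))" if "cfun ?Z (\<lambda>_. f)" for f
    by (rule cenum_comp[OF cenum_reduce[OF cenum_not_computable_tree Z] that])
  have "cenum (\<lambda>_ :: unit. {}) (\<lambda>_ z. \<exists>y. phi {} (p1 (p1 z)) y = Some 1 \<and>
      phi {} (p1 (p2 (p1 z))) (pr y (p2 z)) = Some 0)" by (intro computable)
  note no_defect = cenum_cdec[OF cdec_lift[OF cdec_not[OF cdec_jump[OF this]]]]
  have "cenum (\<lambda>_ :: unit. jump (jump {})) (\<lambda>_ z. root_index (p1 z) (p2 z))"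
    unfolding root_index_def by (rule cenum_conj[OF _ no_defect]) (intro computable)
  from cenum_comp[OF cenum_reduce[OF this Z] cfun_pr]
  have root: "cenum ?Z (\<lambda>_ z. root_index (f z) (g z))"
    if "cfun ?Z (\<lambda>_. f)" "cfun ?Z (\<lambda>_. g)" for f g
    using that by fastforce
  have nQ: "cenum ?Z (\<lambda>_ z. f z \<notin> Q)" if "cfun ?Z (\<lambda>_. f)" for f
    by (rule cenum_cdec[OF cdec_not[OF cdec_comp[OF Q' that]]])
  show ?thesis
    unfolding ce_in_iff_cenum Compl_iff not_in_tree_iso_problem_iff[OF Q]
    by (intro cenum_disj cenum_ex cenum_conj ct root nQ computable)
qed

text \<open>Each further rank costs two jumps, and for positive \<open>k\<close> the last
  application of \<open>back_forth\<close> is decided, not just enumerated, by the oracle reached.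
  For \<open>k = 0\<close> only the enumeration remains.\<close>

lemma decides_iso_level:
  assumes "decides_iso (enum_set B g) \<beta>"
  shows "\<exists>Q. decides_iso Q (\<beta> +\<^sub>o k) \<and> (\<exists>e. Q = enum_set ((jump ^^ (2 * k)) B) e) \<and>
    (k > 0 \<longrightarrow> cdec (\<lambda>_ :: unit. (jump ^^ (2 * k)) B) (\<lambda>_ q. q \<in> Q))"
proof (induction k)
  case 0
  show ?case using assms by (auto simp: oplus_0)
next
  case (Suc k)
  let ?X = "(jump ^^ (2 * k)) B"
  obtain e where e: "decides_iso (enum_set ?X e) (\<beta> +\<^sub>o k)" using Suc by blast
  have X: "(jump ^^ (2 * Suc k)) B = jump (jump ?X)" by simp
  obtain b where b: "enum_set (jump (jump ?X)) (smn b e) = back_forth (enum_set ?X e)"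
    using back_forth_index by blast
  have "cdec (\<lambda>_ :: unit. jump (jump ?X)) (\<lambda>_ z. p2 z \<in> back_forth (enum_set ?X (p1 z)))"
    using cdec_back_forth unfolding cdec_def cfun_def by blast
  from cdec_comp[OF this cfun_pr[OF cfun_const[of _ e] cfun_id]]
  have "cdec (\<lambda>_ :: unit. jump (jump ?X)) (\<lambda>_ q. q \<in> back_forth (enum_set ?X e))" by simp
  then show ?case
    unfolding X oplus_Suc using decides_iso_back_forth[OF e] b by metis
qed

text \<open>The number \<open>2 ^ 2 ^ 1\<close> is the notation for 2, because 1 denotes 0. It lies
  below every limit notation, so the double jump is a column of \<open>B\<close>.\<close>

lemma jump_jump_in_limit:
  assumes "H_set (3 * 5 ^ e) B"
  shows "cdec (\<lambda>_ :: unit. B) (\<lambda>_ x. x \<in> jump (jump {}))"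
proof -
  have "lessO 1 (3 * 5 ^ e)" using one_lessO[OF H_set_inO[OF assms]] by presburger
  from lessO_power_lim[OF lessO_power_lim[OF this]]
  have "H_set (2 ^ 2 ^ 1) (column (2 ^ 2 ^ 1) B)" by (rule column_H_set[OF assms])
  moreover have "H_set (2 ^ 2 ^ 1) (jump (jump {}))" by (intro H_suc H_zero)
  ultimately have "column (2 ^ 2 ^ 1) B = jump (jump {})" by (rule H_set_unique[rotated])
  then have "jump (jump {}) = {x. pr (2 ^ 2 ^ 1) x \<in> B}" unfolding column_def by blast
  moreover have "cdec (\<lambda>_ :: unit. B) (\<lambda>_ x. pr (2 ^ 2 ^ 1) x \<in> B)"
    by (rule cdec_oracle) (intro computable)
  ultimately show ?thesis by (simp only: mem_Collect_eq)
qed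

theorem theorem4p3:
  fixes \<alpha> l :: countable_ordinal and k :: nat
  assumes "computable_ordinal \<alpha>"
    and "\<alpha> = l +\<^sub>o k"
    and "\<not> successor_ordinal l"
  shows "tree_iso_problem \<alpha> \<in> Pi0 (l +\<^sub>o (2 * k + 1))"
proof -
  obtain a where a: "denotes a l" and a1: "l = 0 \<Longrightarrow> a = 1"
  proof (cases "l = 0")
    case True
    then show ?thesis using that denotes_zero by blast
  next
    case False
    obtain c \<gamma> where "denotes c \<gamma>" "\<alpha> \<le> \<gamma>" using computable_ordinal_denotes[OF assms(1)] by blast
    then have "\<exists>a. denotes a l" using denotes_below le_oplus[of l k] assms(2) order_trans by blast
    then show ?thesis using that False by blast
  qed
  obtain B where B: "H_set a B" using H_set_ex[OF denotes_inO[OF a]] by blast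
  obtain b g0 m where decides: "\<And>u \<beta> w g X. denotes u \<beta> \<Longrightarrow> stage b g0 m u w g \<Longrightarrow> H_set w X \<Longrightarrow>
      decides_iso (enum_set X g) \<beta>"
    using iso_below_indices by blast
  \<comment> \<open>A notation for a non-successor is 1 or a limit notation, and there
    \<open>stage\<close> uses the notation itself as oracle: no extra jumps are spent before the
    finite tail.\<close>
  have form: "a = 1 \<and> l = 0 \<or> (\<exists>e. a = 3 * 5 ^ e)"
    using a assms(3) by cases (auto simp: successor_ordinal_def)
  then obtain g where "stage b g0 m a a g" using stage.intros(1,2) by metis
  then have g: "decides_iso (enum_set B g) l" using decides a B by blast
  obtain Q e where Q: "decides_iso Q \<alpha>" "Q = enum_set ((jump ^^ (2 * k)) B) e"
      "k > 0 \<Longrightarrow> cdec (\<lambda>_ :: unit. (jump ^^ (2 * k)) B) (\<lambda>_ q. q \<in> Q)"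
    using decides_iso_level[OF g, of k] unfolding assms(2) by blast
  show ?thesis
  proof (cases "l = 0")
    case True
    have "B = {}" using H_set_unique[OF H_zero] B a1[OF True] by blast
    \<comment> \<open>Finite levels are shifted by one, so level \<open>2 * k + 1\<close> means
      enumerable in \<open>2 * k\<close> jumps of the empty set.\<close>
    let ?Z = "(jump ^^ (2 * k)) {}"
    have "ce_in ?Z (- tree_iso_problem \<alpha>)"
    proof (cases k)
      case 0
      then have "- tree_iso_problem \<alpha> = UNIV"
        using True assms(2) tree_iso_problem_0 by (simp add: oplus_0)
      then show ?thesis unfolding ce_in_iff_cenum by (simp add: computable)
    next
      case (Suc n)
      have "cdec (\<lambda>_ :: unit. (jump ^^ (2 * n)) (jump (jump {}))) (\<lambda>_ x. x \<in> jump (jump {}))"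
        by (rule cdec_funpow_jump, rule cdec_oracle) (intro computable)
      then have "cdec (\<lambda>_ :: unit. ?Z) (\<lambda>_ x. x \<in> jump (jump {}))"
        using Suc by (simp add: funpow_swap1)
      then show ?thesis using ce_in_complement[OF Q(1)] Q(3) Suc \<open>B = {}\<close> by simp
    qed
    moreover have "finite_ordinal (l +\<^sub>o (2 * k + 1))" unfolding finite_ordinal_def True by blast
    moreover have "l +\<^sub>o (2 * k + 1) = osuc (0 +\<^sub>o (2 * k))" using True by (simp add: oplus_Suc)
    ultimately show ?thesis
      by (intro Pi0I[OF denotes_oplus[OF denotes_zero] H_set_oplus[OF H_zero]]) simp_all
  next
    case False
    then obtain c where c: "a = 3 * 5 ^ c" using form by blast
    \<comment> \<open>Infinite levels are not shifted, so all \<open>2 * k + 1\<close> jumps are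
      available: after \<open>2 * k\<close> of them \<open>Q\<close> is enumerable, and the last one
      decides it.\<close>
    let ?Z = "(jump ^^ (2 * k + 1)) B"
    have "cdec (\<lambda>_ :: unit. ?Z) (\<lambda>_ x. x \<in> jump (jump {}))"
      by (rule cdec_funpow_jump[OF jump_jump_in_limit]) (use B c in simp)
    moreover have "cenum (\<lambda>_ :: unit. (jump ^^ (2 * k)) B) (\<lambda>_ q. q \<in> Q)"
      unfolding ce_in_iff_cenum[symmetric] ce_in_iff using Q(2) by blast
    from cdec_jump[OF this] have "cdec (\<lambda>_ :: unit. ?Z) (\<lambda>_ q. q \<in> Q)" by simp
    ultimately have "ce_in ?Z (- tree_iso_problem \<alpha>)" by (intro ce_in_complement[OF Q(1)])
    moreover have "\<not> finite_ordinal (l +\<^sub>o (2 * k + 1))"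
      unfolding finite_ordinal_def using oplus_eq_finite[OF assms(3)] False by blast
    ultimately show ?thesis
      by (intro Pi0I[OF denotes_oplus[OF a] H_set_oplus[OF B]]) simp_all
  qed
qed

end
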